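(* Let $m$ be a square-free positive integer and let $\mathcal{O}_m$ be the ring of integers of the imaginary quadratic field $\mathbb{Q}(\sqrt{-m})$. The Bianchi group $\mathrm{PSL}(2,\mathcal{O}_m)$ contains a subgroup $\Delta_m$ which embeds in a right-angled Coxeter group and has index $$[\mathrm{PSL}(2,\mathcal{O}_m):\Delta_m]=\begin{cases}48 & \text{if } m\equiv 1,2 \pmod 4,\\ 120 & \text{if } m\equiv 3 \pmod 8,\\ 72 & \text{if } m\equiv 7 \pmod 8,\end{cases}$$ where $\Delta_m$ is the principal congruence subgroup of level $2$ if $m\equiv 1,2 \pmod 4$, and is otherwise a congruence subgroup of level $4$.
   Context: $\mathcal{O}_m=\mathbb{Z}[\sqrt{-m}]$ if $m\equiv 1,2 \pmod 4$ and $\mathcal{O}_m=\mathbb{Z}[\frac{1+\sqrt{-m}}{2}]$ if $m\equiv 3\pmod 4$. For an ideal $\mathscr{I}$ of $\mathcal{O}_m$, the principal congruence subgroup of level $\mathscr{I}$, denoted $\mathrm{PSL}(2,\mathcal{O}_m)_{(\mathscr{I})}$, is the image in $\mathrm{PSL}(2,\mathcal{O}_m)$ of the group of matrices $M\in\mathrm{SL}(2,\mathcal{O}_m)$ with $M\equiv I$ modulo $\mathscr{I}$ (entrywise). Level $2$ (resp. $4$) means level the ideal $(2)=2\mathcal{O}_m$ (resp. $(4)=4\mathcal{O}_m$). A subgroup is congruence of level $4$ if it contains $\mathrm{PSL}(2,\mathcal{O}_m)_{(4)}$. A right-angled Coxeter group (RACG) is a group with a presentation $\langle r\in V : r^2=1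 \ (r\in V),\ (rs)^2=1 \ (\{r,s\}\in E)\rangle$ for a finite simple graph $(V,E)$. "Embeds" means that there is an injective group homomorphism. *)

theory Defs
  imports
    "HOL-Algebra.Coset"
    "HOL-Algebra.Ideal"
    "HOL-Algebra.Generated_Rings"
    "HOL-Analysis.Determinants"
    "HOL-Computational_Algebra.Squarefree"
begin

section \<open>The rings \<open>\<O>\<^sub>m\<close>\<close>

definition complex_ring :: "complex ring" where
  "complex_ring = \<lparr>carrier = UNIV, monoid.mult = (*), one = 1, zero = 0, add = (+)\<rparr>"

text \<open>Note that \<^term>\<open>csqrt (- of_nat m)\<close> is \<open>i\<surd>m\<close>, and that \<^const>\<open>generate_ring\<close> yields
  the smallest subring containing the given set, so the carrier of \<open>Om m\<close> is literally
  \<open>\<int>[\<surd>-m]\<close> or \<open>\<int>[(1 + \<surd>-m)/2]\<close>.\<close>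

definition Om_generator :: "nat \<Rightarrow> complex" where
  "Om_generator m =
    (if m mod 4 = 3 then (1 + csqrt (- of_nat m)) / 2 else csqrt (- of_nat m))"

definition Om :: "nat \<Rightarrow> complex ring" where
  "Om m = complex_ring\<lparr>carrier := generate_ring complex_ring {Om_generator m}\<rparr>"


section \<open>Bianchi groups and their congruence subgroups\<close>

definition SL2 :: "nat \<Rightarrow> (complex^2^2) monoid" where
  "SL2 m = \<lparr>carrier = {M. (\<forall>i j. M $ i $ j \<in> carrier (Om m)) \<and> det M = 1},
            monoid.mult = (**), one = mat 1\<rparr>"

definition plus_minus_one :: "(complex^2^2) set" where
  "plus_minus_one = {mat 1, - mat 1}"

definition PSL2 :: "nat \<Rightarrow> (complex^2^2) set monoid" where
  "PSL2 m = SL2 m Mod plus_minus_one"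

definition principal_congruence_subgroup :: "nat \<Rightarrow> complex set \<Rightarrow> (complex^2^2) set set" where
  "principal_congruence_subgroup m I =
     (\<lambda>M. plus_minus_one #>\<^bsub>SL2 m\<^esub> M) `
       {M \<in> carrier (SL2 m). \<forall>i j. M $ i $ j - mat 1 $ i $ j \<in> I}"

definition congruence_subgroup_of_level :: "nat \<Rightarrow> complex set \<Rightarrow> (complex^2^2) set set \<Rightarrow> bool" where
  "congruence_subgroup_of_level m I H \<longleftrightarrow>
     subgroup H (PSL2 m) \<and> principal_congruence_subgroup m I \<subseteq> H"


section \<open>Group presentations and right-angled Coxeter groups\<close>

text \<open>Words over \<open>S \<union> S\<^sup>-\<^sup>1\<close>: the letter \<open>(x, True)\<close> stands for \<open>x\<close> and \<open>(x, False)\<close> for its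
  formal inverse.\<close>

definition group_words :: "'a set \<Rightarrow> ('a \<times> bool) list set" where
  "group_words S = lists (S \<times> UNIV)"

inductive_set presentation_rel ::
    "'a set \<Rightarrow> ('a \<times> bool) list set \<Rightarrow> (('a \<times> bool) list \<times> ('a \<times> bool) list) set"
  for S R where
    refl: "w \<in> group_words S \<Longrightarrow> (w, w) \<in> presentation_rel S R"
  | sym: "(v, w) \<in> presentation_rel S R \<Longrightarrow> (w, v) \<in> presentation_rel S R"
  | trans: "(u, v) \<in> presentation_rel S R \<Longrightarrow> (v, w) \<in> presentation_rel S R
      \<Longrightarrow> (u, w) \<in> presentation_rel S R"
  | cancel: "u \<in> group_words S \<Longrightarrow> v \<in> group_words S \<Longrightarrow> x \<in> S
      \<Longrightarrow> (u @ [(x, b), (x, \<not> b)] @ v, u @ v) \<in> presentation_rel S R"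
  | relator: "u \<in> group_words S \<Longrightarrow> v \<in> group_words S \<Longrightarrow> r \<in> R \<Longrightarrow> r \<in> group_words S
      \<Longrightarrow> (u @ r @ v, u @ v) \<in> presentation_rel S R"

text \<open>The group \<open>\<langle>S : r = 1 (r \<in> R)\<rangle>\<close>.\<close>

definition presented_group ::
    "'a set \<Rightarrow> ('a \<times> bool) list set \<Rightarrow> ('a \<times> bool) list set monoid" where
  "presented_group S R =
    \<lparr>carrier = group_words S // presentation_rel S R,
     monoid.mult = (\<lambda>A B. \<Union>u\<in>A. \<Union>v\<in>B. presentation_rel S R `` {u @ v}),
     one = presentation_rel S R `` {[]}\<rparr>"

definition finite_simple_graph :: "'a set \<Rightarrow> 'a set set \<Rightarrow> bool" where
  "finite_simple_graph V E \<longleftrightarrow> finite V \<and> (\<forall>e\<in>E. e \<subseteq> V \<and> card e = 2)"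

definition RACG :: "'a set \<Rightarrow> 'a set set \<Rightarrow> ('a \<times> bool) list set monoid" where
  "RACG V E = presented_group V
     ({[(r, True), (r, True)] | r. r \<in> V} \<union>
      {[(r, True), (s, True), (r, True), (s, True)] | r s. {r, s} \<in> E})"

text \<open>Every finite simple graph is isomorphic to one whose vertices are natural numbers, so fixing
  the vertex type is no restriction.\<close>

definition embeds_in_RACG :: "('g, 'b) monoid_scheme \<Rightarrow> bool" where
  "embeds_in_RACG G \<longleftrightarrow>
     (\<exists>(V :: nat set) E h. finite_simple_graph V E \<and> h \<in> mon G (RACG V E))"


section \<open>Basic facts\<close>

lemma cring_complex_ring: "cring complex_ring"
proof (rule cringI)
  show "abelian_group complex_ring"
  proof (rule abelian_groupI)
    fix x assume "x \<in> carrier complex_ring"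
    show "\<exists>y\<in>carrier complex_ring. y \<oplus>\<^bsub>complex_ring\<^esub> x = \<zero>\<^bsub>complex_ring\<^esub>"
      by (rule bexI[of _ "- x"]) (simp_all add: complex_ring_def)
  qed (auto simp: complex_ring_def)
  show "comm_monoid complex_ring"
    by (rule comm_monoidI) (auto simp: complex_ring_def)
qed (auto simp: complex_ring_def algebra_simps)

lemma
  shows one_in_Om: "1 \<in> carrier (Om m)"
    and zero_in_Om: "0 \<in> carrier (Om m)"
    and uminus_in_Om: "x \<in> carrier (Om m) \<Longrightarrow> - x \<in> carrier (Om m)"
    and add_in_Om: "x \<in> carrier (Om m) \<Longrightarrow> y \<in> carrier (Om m) \<Longrightarrow> x + y \<in> carrier (Om m)"
    and mult_in_Om: "x \<in> carrier (Om m) \<Longrightarrow> y \<in> carrier (Om m) \<Longrightarrow> x * y \<in> carrier (Om m)"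
proof -
  interpret C: cring complex_ring by (rule cring_complex_ring)
  have "subring (generate_ring complex_ring {Om_generator m}) complex_ring"
    by (rule C.generate_ring_is_subring) (simp add: complex_ring_def)
  then have sub: "subring (carrier (Om m)) complex_ring"
    by (simp add: Om_def)
  have neg: "\<ominus>\<^bsub>complex_ring\<^esub> x = - x" for x
    by (rule C.minus_equality) (simp_all add: complex_ring_def)
  show "1 \<in> carrier (Om m)" "0 \<in> carrier (Om m)"
    using subringE(2,3)[OF sub] by (simp_all add: complex_ring_def)
  show "- x \<in> carrier (Om m)" if "x \<in> carrier (Om m)"
    using subringE(5)[OF sub that] by (simp add: neg)
  show "x + y \<in> carrier (Om m)" if "x \<in> carrier (Om m)" "y \<in> carrier (Om m)"
    using subringE(7)[OF sub that] by (simp add: complex_ring_def)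
  show "x * y \<in> carrier (Om m)" if "x \<in> carrier (Om m)" "y \<in> carrier (Om m)"
    using subringE(6)[OF sub that] by (simp add: complex_ring_def)
qed

lemma Om_generator_square:
  "\<exists>c d. Om_generator m * Om_generator m = of_int c + of_int d * Om_generator m"
proof (cases "m mod 4 = 3")
  case False
  then have "Om_generator m * Om_generator m = of_int (- int m) + of_int 0 * Om_generator m"
    by (simp add: Om_generator_def power_mult_distrib flip: power2_eq_square of_real_power)
  then show ?thesis by blast
next
  case True
  define k where "k = m div 4"
  have m: "m = 4 * k + 3" using True k_def by presburger
  define s where "s = csqrt (- of_nat m)"
  have s: "s * s = - (4 * of_nat k + 3)"
    unfolding s_def m power2_eq_square[symmetric] power2_csqrt by simp
  have g: "Om_generator m = (1 + s) / 2" by (simp add: Om_generator_def True s_def)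
  have "Om_generator m * Om_generator m = (1 + 2 * s + s * s) / 4"
    unfolding g by (simp add: field_simps)
  also have "\<dots> = of_int (- int k - 1) + of_int 1 * Om_generator m"
    unfolding s g by (simp add: field_simps)
  finally show ?thesis by blast
qed

lemma carrier_Om: "carrier (Om m) = {of_int a + of_int b * Om_generator m | a b. True}"
proof (intro equalityI subsetI)
  interpret C: cring complex_ring by (rule cring_complex_ring)
  let ?g = "Om_generator m"
  obtain c d where cd: "?g * ?g = of_int c + of_int d * ?g"
    using Om_generator_square by blast
  fix x assume "x \<in> carrier (Om m)"
  then have "x \<in> generate_ring complex_ring {?g}" by (simp add: Om_def)
  then have "\<exists>a b. x = of_int a + of_int b * ?g"
  proof (induction rule: generate_ring.induct)
    case one
    show ?case by (intro exI[of _ 1] exI[of _ 0]) (simp add: complex_ring_def)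
  next
    case (incl h)
    then show ?case by (intro exI[of _ 0] exI[of _ 1]) simp
  next
    case (a_inv h)
    then obtain a b where h: "h = of_int a + of_int b * ?g" by blast
    have "\<ominus>\<^bsub>complex_ring\<^esub> h = - h"
      by (rule C.minus_equality) (simp_all add: complex_ring_def)
    then show ?case unfolding h
      by (intro exI[of _ "- a"] exI[of _ "- b"]) simp
  next
    case (eng_add x y)
    then obtain a b a' b' where "x = of_int a + of_int b * ?g" "y = of_int a' + of_int b' * ?g"
      by blast
    then show ?case
      by (intro exI[of _ "a + a'"] exI[of _ "b + b'"]) (simp add: complex_ring_def algebra_simps)
  next
    case (eng_mult x y)
    then obtain a b a' b' where xy: "x = of_int a + of_int b * ?g" "y = of_int a' + of_int b' * ?g"
      by blast
    have "x * y = of_int (a * a') + of_int (a * b' + b * a') * ?g + of_int (b * b') * (?g * ?g)"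
      unfolding xy by (simp add: algebra_simps)
    also have "\<dots> = of_int (a * a' + b * b' * c) + of_int (a * b' + b * a' + b * b' * d) * ?g"
      unfolding cd by (simp add: algebra_simps)
    finally show ?case
      by (intro exI[of _ "a * a' + b * b' * c"] exI[of _ "a * b' + b * a' + b * b' * d"])
         (simp add: complex_ring_def)
  qed
  then show "x \<in> {of_int a + of_int b * ?g | a b. True}" by blast
next
  fix x assume "x \<in> {of_int a + of_int b * Om_generator m | a b. True}"
  then obtain a b where x: "x = of_int a + of_int b * Om_generator m" by blast
  have nat: "of_nat n \<in> carrier (Om m)" for n
    by (induction n) (auto intro: zero_in_Om one_in_Om add_in_Om)
  have int: "of_int n \<in> carrier (Om m)" for n
    by (cases n) (use nat[of "nat \<bar>n\<bar>"] in \<open>auto dest: uminus_in_Om simp del: of_nat_Suc\<close>)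
  have "Om_generator m \<in> carrier (Om m)"
    by (simp add: Om_def generate_ring.incl)
  then show "x \<in> carrier (Om m)" unfolding x by (intro add_in_Om mult_in_Om int)
qed

lemma group_SL2: "group (SL2 m)"
proof (rule groupI)
  fix M N assume "M \<in> carrier (SL2 m)" "N \<in> carrier (SL2 m)"
  then show "M \<otimes>\<^bsub>SL2 m\<^esub> N \<in> carrier (SL2 m)"
    by (auto simp: SL2_def det_mul)
       (auto simp: matrix_matrix_mult_def sum_2 intro!: add_in_Om mult_in_Om)
next
  show "\<one>\<^bsub>SL2 m\<^esub> \<in> carrier (SL2 m)"
    by (auto simp: SL2_def) (auto simp: mat_def one_in_Om zero_in_Om)
next
  fix M assume M: "M \<in> carrier (SL2 m)"
  define N :: "complex^2^2" where
    "N = (\<chi> i j. if i = j then (if i = 1 then M $ 2 $ 2 else M $ 1 $ 1) else - M $ i $ j)"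
  have "N \<in> carrier (SL2 m)"
    using M by (auto simp: SL2_def N_def det_2 algebra_simps uminus_in_Om)
  moreover have "N ** M = mat 1"
    using M by (simp add: SL2_def N_def det_2 vec_eq_iff forall_2 matrix_matrix_mult_def sum_2
        mat_def algebra_simps)
  ultimately show "\<exists>N\<in>carrier (SL2 m). N \<otimes>\<^bsub>SL2 m\<^esub> M = \<one>\<^bsub>SL2 m\<^esub>"
    by (auto simp: SL2_def)
qed (auto simp: SL2_def matrix_mul_assoc)

lemma normal_plus_minus_one: "plus_minus_one \<lhd> SL2 m"
proof -
  interpret SL: group "SL2 m" by (rule group_SL2)
  have uminus_mult: "(- A) ** B = - (A ** B)" "A ** (- B) = - (A ** B)" for A B :: "complex^2^2"
    by (simp_all add: matrix_matrix_mult_def vec_eq_iff sum_2)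
  have mem: "- mat 1 \<in> carrier (SL2 m)" "mat 1 \<in> carrier (SL2 m)"
    by (auto simp: SL2_def mat_def one_in_Om zero_in_Om uminus_in_Om det_2)
  have "inv\<^bsub>SL2 m\<^esub> (- mat 1) = - mat 1"
    by (rule SL.inv_equality) (use mem in \<open>simp_all add: SL2_def uminus_mult\<close>)
  moreover have "inv\<^bsub>SL2 m\<^esub> (mat 1) = mat 1"
    by (rule SL.inv_equality) (use mem in \<open>simp_all add: SL2_def\<close>)
  ultimately have sub: "subgroup plus_minus_one (SL2 m)"
    by (intro SL.subgroupI) (use mem in \<open>auto simp: plus_minus_one_def\<close>,
        auto simp: SL2_def uminus_mult)
  show ?thesis
  proof (rule SL.normal_invI[OF sub])
    fix M N assume M: "M \<in> carrier (SL2 m)" and N: "N \<in> plus_minus_one"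
    have "M \<otimes>\<^bsub>SL2 m\<^esub> N = N \<otimes>\<^bsub>SL2 m\<^esub> M"
      using N by (auto simp: plus_minus_one_def SL2_def uminus_mult)
    then show "M \<otimes>\<^bsub>SL2 m\<^esub> N \<otimes>\<^bsub>SL2 m\<^esub> inv\<^bsub>SL2 m\<^esub> M \<in> plus_minus_one"
      using M N subgroup.mem_carrier[OF sub N] by (simp add: SL.m_assoc)
  qed
qed

lemma group_PSL2: "group (PSL2 m)"
  unfolding PSL2_def by (rule normal.factorgroup_is_group[OF normal_plus_minus_one])

lemma presentation_rel_words:
  "(v, w) \<in> presentation_rel S R \<Longrightarrow> v \<in> group_words S \<and> w \<in> group_words S"
  by (induction rule: presentation_rel.induct) (auto simp: group_words_def)

lemma equiv_presentation_rel: "equiv (group_words S) (presentation_rel S R)"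
  by (intro equivI refl_onI symI transI)
     (auto dest: presentation_rel_words intro: presentation_rel.intros)

lemma presentation_rel_append:
  assumes "(u, u') \<in> presentation_rel S R" "(v, v') \<in> presentation_rel S R"
  shows "(u @ v, u' @ v') \<in> presentation_rel S R"
proof -
  have words: "a @ b \<in> group_words S \<longleftrightarrow> a \<in> group_words S \<and> b \<in> group_words S" for a b
    by (auto simp: group_words_def)
  have 1: "(u @ w, u' @ w) \<in> presentation_rel S R" if "w \<in> group_words S" for w
    using assms(1)
  proof induction
    case (cancel a b x c)
    then show ?case using presentation_rel.cancel[where u = a and v = "b @ w" and x = x and b = c] that by (simp add: words)
  next
    case (relator a b r)
    then show ?case using presentation_rel.relator[where u = a and v = "b @ w" and r = r] that by (simp add: words)
  qed (use that in \<open>auto simp: words intro: presentation_rel.intros\<close>)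
  have 2: "(w @ v, w @ v') \<in> presentation_rel S R" if "w \<in> group_words S" for w
    using assms(2)
  proof induction
    case (cancel a b x c)
    then show ?case using presentation_rel.cancel[where u = "w @ a" and v = b and x = x and b = c] that by (simp add: words)
  next
    case (relator a b r)
    then show ?case using presentation_rel.relator[where u = "w @ a" and v = b and r = r] that by (simp add: words)
  qed (use that in \<open>auto simp: words intro: presentation_rel.intros\<close>)
  show ?thesis
    using 1[of v] 2[of u'] assms by (blast dest: presentation_rel_words intro: presentation_rel.trans)
qed

lemma mult_presented_group:
  assumes "u \<in> group_words S" "v \<in> group_words S"
  shows "presentation_rel S R `` {u} \<otimes>\<^bsub>presented_group S R\<^esub> presentation_rel S R `` {v}
    = presentation_rel S R `` {u @ v}"
proof -
  have "congruent2 (presentation_rel S R) (presentation_rel S R)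
          (\<lambda>u v. presentation_rel S R `` {u @ v})"
    by (intro congruent2I') (auto intro!: equiv_class_eq[OF equiv_presentation_rel]
        presentation_rel_append)
  then show ?thesis
    using UN_equiv_class2[OF equiv_presentation_rel equiv_presentation_rel _ assms]
    by (simp add: presented_group_def)
qed

lemma group_presented_group: "group (presented_group S R)"
proof -
  let ?r = "presentation_rel S R"
  let ?G = "presented_group S R"
  have car: "A \<in> carrier ?G \<longleftrightarrow> (\<exists>u\<in>group_words S. A = ?r `` {u})" for A
    by (auto simp: presented_group_def quotient_def)
  have words: "a @ b \<in> group_words S \<longleftrightarrow> a \<in> group_words S \<and> b \<in> group_words S" for a b
    by (auto simp: group_words_def)
  have nil: "[] \<in> group_words S" by (simp add: group_words_def)
  have one: "\<one>\<^bsub>?G\<^esub> = ?r `` {[]}" by (simp add: presented_group_def)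
  have inverse: "\<exists>v\<in>group_words S. (v @ u, []) \<in> ?r" if "u \<in> group_words S" for u
    using that
  proof (induction u)
    case Nil
    then show ?case using presentation_rel.refl[OF nil] nil by force
  next
    case (Cons y u)
    obtain x b where y: "y = (x, b)" by fastforce
    have x: "x \<in> S" and u: "u \<in> group_words S" using Cons.prems by (auto simp: group_words_def y)
    obtain v where v: "v \<in> group_words S" "(v @ u, []) \<in> ?r" using Cons.IH[OF u] by blast
    have "(v @ [(x, \<not> b), (x, \<not> \<not> b)] @ u, v @ u) \<in> ?r"
      by (rule presentation_rel.cancel[OF v(1) u x])
    then have "((v @ [(x, \<not> b)]) @ y # u, []) \<in> ?r"
      using v(2) by (auto simp: y intro: presentation_rel.trans)
    moreover have "v @ [(x, \<not> b)] \<in> group_words S" using v(1) x by (auto simp: group_words_def)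
    ultimately show ?case by blast
  qed
  show ?thesis
  proof (rule groupI)
    fix A assume "A \<in> carrier ?G"
    then obtain u where u: "u \<in> group_words S" "A = ?r `` {u}" by (auto simp: car)
    obtain v where v: "v \<in> group_words S" "(v @ u, []) \<in> ?r" using inverse[OF u(1)] by blast
    have "?r `` {v} \<otimes>\<^bsub>?G\<^esub> A = \<one>\<^bsub>?G\<^esub>"
      using u v by (simp add: one mult_presented_group equiv_class_eq[OF equiv_presentation_rel])
    then show "\<exists>B\<in>carrier ?G. B \<otimes>\<^bsub>?G\<^esub> A = \<one>\<^bsub>?G\<^esub>" using v(1) car by blast
  qed (auto simp: car one mult_presented_group words nil intro: nil)
qed

end

theory Submission
  imports Defs
begin

text \<open>
  \<open>SL\<^sub>2(\<O>\<^sub>m)\<close> acts on the binary Hermitian forms over \<open>\<O>\<^sub>m\<close>, a lattice of signature \<open>(1, 3)\<close> under twice the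
  determinant. Writing \<open>2 m\<close> or \<open>(m - 1) / 2\<close> as a sum of four squares embeds this lattice into the odd
  unimodular lattice of signature \<open>(1, 7)\<close>, and a matrix congruent to 1 modulo 2, extended by the
  identity on the orthogonal complement, preserves that lattice and acts trivially on it modulo 2.

  Up to sign the group of all such isometries is generated by the reflections in the 56 classes of norm
  \<open>-1\<close> and degree 1 (the exceptional curves of a del Pezzo surface of degree 2): a reflection
  decreases the degree of the image \<open>v\<close> of the anticanonical class as long as \<open>v\<close> is negative on some
  exceptional curve, and otherwise \<open>v\<close> is the anticanonical class itself. Different exceptional
  curves intersect in 0 or at least 1 points, so the 56 reflections generate a right-angled Coxeter group,
  as a sign argument on reduced words shows.

  So the whole level 2 subgroup embeds. Its index is the order of \<open>SL\<^sub>2(\<O>\<^sub>m / 2)\<close>, namely 48, 60 or 36;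
  if \<open>m \<equiv> 3 (mod 4)\<close> we pass to a subgroup of index 2 which contains the level 4 subgroup.
\<close>

section \<open>Faithfulness of the reflection representation of a right-angled Coxeter group\<close>

text \<open>An integral vector of the unimodular lattice projects only into the dual of the
  Hermitian lattice, so that congruence to 1 modulo 2 has to be verified on dual vectors. This
  shapes the assumption \<open>dual_vector\<close> and is settled in
  \<open>herm_act_level2_offdiag\<close>. Congruence modulo 2 is what ties the matrices to vectors
  of norm -1. The reflection in such an e adds 2 (v . e) e to v, an even multiple, so it is itself
  trivial modulo 2. Conversely the image of \<open>kap\<close> is \<open>kap + 2 u\<close>, and
  nonnegativity of the odd integers 1 + 2 (u . e) already gives u . e \<ge> 0. So u is nef and has
  nonnegative norm, and comparing the norms of \<open>kap + 2 u\<close> and \<open>kap\<close>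
  leaves only u = 0. The dimension comes from Lagrange's theorem: two coordinates for the diagonal
  of the Hermitian matrix, two that represent 1, and four for the squares that represent the square
  root of -m.\<close>

locale right_angled_roots =
  fixes B :: "'v::real_vector \<Rightarrow> 'v \<Rightarrow> real" and V :: "nat set" and e :: "nat \<Rightarrow> 'v" and k :: 'v
  assumes finite_V: "finite V"
    and bilinear_B: "bilinear B"
    and B_sym: "B x y = B y x"
    and root_norm: "i \<in> V \<Longrightarrow> B (e i) (e i) = -1"
    and root_pair: "i \<in> V \<Longrightarrow> j \<in> V \<Longrightarrow> i \<noteq> j \<Longrightarrow> B (e i) (e j) = 0 \<or> B (e i) (e j) \<ge> 1"
    and root_pos: "i \<in> V \<Longrightarrow> B k (e i) > 0"
begin

lemmas B_simps = bilinear_ladd[OF bilinear_B] bilinear_radd[OF bilinear_B]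
  bilinear_lmul[OF bilinear_B] bilinear_rmul[OF bilinear_B]
  bilinear_lsub[OF bilinear_B] bilinear_rsub[OF bilinear_B]
  bilinear_lneg[OF bilinear_B] bilinear_rneg[OF bilinear_B]
  bilinear_lzero[OF bilinear_B] bilinear_rzero[OF bilinear_B]

definition edges :: "nat set set" where
  "edges = {{i, j} | i j. i \<in> V \<and> j \<in> V \<and> i \<noteq> j \<and> B (e i) (e j) = 0}"

definition relators :: "(nat \<times> bool) list set" where
  "relators = {[(r, True), (r, True)] | r. r \<in> V} \<union>
      {[(r, True), (s, True), (r, True), (s, True)] | r s. {r, s} \<in> edges}"

abbreviation rel :: "((nat \<times> bool) list \<times> (nat \<times> bool) list) set" where
  "rel \<equiv> presentation_rel V relators"

lemma RACG_eq: "RACG V edges = presented_group V relators"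
  by (simp add: RACG_def relators_def)

lemma finite_simple_graph_edges: "finite_simple_graph V edges"
  by (auto simp: finite_simple_graph_def finite_V edges_def)

lemma edge_iff: "{i, j} \<in> edges \<longleftrightarrow> i \<in> V \<and> j \<in> V \<and> i \<noteq> j \<and> B (e i) (e j) = 0"
  by (auto simp: edges_def doubleton_eq_iff B_sym)

text \<open>The sign is plus because the roots have norm -1.\<close>

definition reflect :: "nat \<Rightarrow> 'v \<Rightarrow> 'v" where
  "reflect i v = v + (2 * B v (e i)) *\<^sub>R e i"

text \<open>The exponent of a letter is dropped, a reflection being its own inverse;
  \<open>rel_letter\<close> is the counterpart for words.\<close>

fun act :: "(nat \<times> bool) list \<Rightarrow> 'v \<Rightarrow> 'v" where
  "act [] v = v"
| "act (x # w) v = reflect (fst x) (act w v)"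

lemma act_append: "act (u @ v) x = act u (act v x)"
  by (induction u) auto

lemma reflect_involution:
  assumes "i \<in> V" shows "reflect i (reflect i v) = v"
proof -
  have "reflect i (reflect i v) = v + (2 * B v (e i) + 2 * (B v (e i) + 2 * B v (e i) * (-1))) *\<^sub>R e i"
    using root_norm[OF assms] by (simp add: reflect_def B_simps scaleR_left_distrib)
  then show ?thesis by simp
qed

lemma reflect_isometry:
  assumes "i \<in> V" shows "B (reflect i v) (reflect i w) = B v w"
  using root_norm[OF assms] B_sym[of "e i" w] by (simp add: reflect_def B_simps algebra_simps)

lemma reflect_commute:
  assumes "{i, j} \<in> edges" shows "reflect i (reflect j v) = reflect j (reflect i v)"
  using assms B_sym[of "e j" "e i"] by (simp add: edge_iff reflect_def B_simps)

lemma act_rel: "(u, v) \<in> rel \<Longrightarrow> act u = act v"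
proof (induction rule: presentation_rel.induct)
  case (relator u v r)
  have sq: "reflect i (reflect j (reflect i (reflect j x))) = x" if "{i, j} \<in> edges" for i j x
    using that by (metis reflect_commute reflect_involution edge_iff)
  have "act r x = x" for x
    using relator(3) by (auto simp: relators_def reflect_involution sq)
  then show ?case by (auto simp: act_append fun_eq_iff)
qed (auto simp: act_append fun_eq_iff reflect_involution)

section \<open>Words in the Coxeter generators up to the relations\<close>

lemma rel_refl: "w \<in> group_words V \<Longrightarrow> (w, w) \<in> rel"
  by (rule presentation_rel.refl)

lemma group_words_simps [simp]:
  "[] \<in> group_words V" "x # w \<in> group_words V \<longleftrightarrow> fst x \<in> V \<and> w \<in> group_words V"
  "u @ v \<in> group_words V \<longleftrightarrow> u \<in> group_words V \<and> v \<in> group_words V"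
  by (cases x; auto simp: group_words_def)+

text \<open>The relator covers only two positive letters. Free cancellation gives the mixed signs,
  and together they identify a letter with its formal inverse.\<close>

lemma rel_square:
  assumes "i \<in> V" shows "([(i, b), (i, c)], []) \<in> rel"
proof -
  have tt: "([(i, True), (i, True)], []) \<in> rel"
    using presentation_rel.relator[of "[]" V "[]" "[(i, True), (i, True)]" relators] assms
    by (auto simp: relators_def)
  have tf: "([(i, b), (i, \<not> b)], []) \<in> rel" for b
    using presentation_rel.cancel[of "[]" V "[]" i b relators] assms by auto
  have ft: "([(i, False)], [(i, True)]) \<in> rel"
  proof -
    have "([(i, False)] @ [(i, True), (i, True)], [(i, False)] @ []) \<in> rel"
      by (intro presentation_rel_append tt rel_refl) (simp add: assms)
    moreover have "([(i, False), (i, True)] @ [(i, True)], [] @ [(i, True)]) \<in> rel"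
      using tf[of False] by (intro presentation_rel_append rel_refl) (simp_all add: assms)
    ultimately show ?thesis
      by (auto intro: presentation_rel.trans presentation_rel.sym)
  qed
  have one: "([(i, b)], [(i, True)]) \<in> rel" for b
    using ft rel_refl[of "[(i, True)]"] assms by (cases b) auto
  have "([(i, b)] @ [(i, c)], [(i, True)] @ [(i, True)]) \<in> rel"
    by (intro presentation_rel_append one)
  then show ?thesis using tt by (auto intro: presentation_rel.trans)
qed

lemma rel_letter:
  assumes "i \<in> V" shows "([(i, b)], [(i, True)]) \<in> rel"
proof -
  have "([(i, b)] @ [(i, b), (i, True)], [(i, b)] @ []) \<in> rel"
    by (intro presentation_rel_append rel_square rel_refl) (simp_all add: assms)
  moreover have "([(i, b), (i, b)] @ [(i, True)], [] @ [(i, True)]) \<in> rel"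
    by (intro presentation_rel_append rel_square rel_refl) (simp_all add: assms)
  ultimately show ?thesis
    by (auto intro: presentation_rel.trans presentation_rel.sym)
qed

text \<open>Multiplying ijij = 1 on the right by ji and cancelling squares gives ij = ji; the signs
  are then free by \<open>rel_letter\<close>.\<close>

lemma rel_commute:
  assumes "{i, j} \<in> edges" shows "([(i, b), (j, c)], [(j, d), (i, a)]) \<in> rel"
proof -
  have V: "i \<in> V" "j \<in> V" using assms by (auto simp: edge_iff)
  let ?i = "(i, True)" and ?j = "(j, True)"
  have r: "([?i, ?j, ?i, ?j], []) \<in> rel"
    using presentation_rel.relator[of "[]" V "[]" "[?i, ?j, ?i, ?j]" relators] assms V
    by (auto simp: relators_def)
  have "([?i, ?j, ?i, ?j] @ [?j, ?i], [] @ [?j, ?i]) \<in> rel"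
    using V by (intro presentation_rel_append r rel_refl) auto
  moreover have "([?i, ?j, ?i] @ [?j, ?j] @ [?i], [?i, ?j, ?i] @ [] @ [?i]) \<in> rel"
    using V by (intro presentation_rel_append rel_square rel_refl) auto
  moreover have "([?i, ?j] @ [?i, ?i], [?i, ?j] @ []) \<in> rel"
    using V by (intro presentation_rel_append rel_square rel_refl) auto
  ultimately have 1: "([?i, ?j], [?j, ?i]) \<in> rel"
    by simp (metis presentation_rel.trans presentation_rel.sym)
  have 2: "([(i, b)] @ [(j, c)], [?i] @ [?j]) \<in> rel"
    using V by (intro presentation_rel_append rel_letter)
  have 3: "([(j, d)] @ [(i, a)], [?j] @ [?i]) \<in> rel"
    using V by (intro presentation_rel_append rel_letter)
  show ?thesis using 1 2 3 by (auto intro: presentation_rel.trans presentation_rel.sym)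
qed

text \<open>For a reduced word these are the letters with which some equivalent reduced word starts.\<close>

fun descents :: "(nat \<times> bool) list \<Rightarrow> nat set" where
  "descents [] = {}"
| "descents (x # w) = insert (fst x) {t \<in> descents w. {fst x, t} \<in> edges}"

text \<open>Prefixing a letter spoils reducedness exactly when an equal letter can be moved to the
  front of the rest, where the two would cancel.\<close>

fun reduced :: "(nat \<times> bool) list \<Rightarrow> bool" where
  "reduced [] \<longleftrightarrow> True"
| "reduced (x # w) \<longleftrightarrow> reduced w \<and> fst x \<notin> descents w"

text \<open>The letter is carried to the front past letters that commute with it. The length is
  recorded because \<open>shorten_unreduced\<close> then cancels it against the preceding
  letter.\<close>

lemma descent_front:
  assumes "w \<in> group_words V" "s \<in> descents w"
  shows "\<exists>w'. w' \<in> group_words V \<and> length w = Suc (length w') \<and> (w, (s, True) # w') \<in> rel"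
  using assms
proof (induction w)
  case (Cons x w)
  obtain i b where x: "x = (i, b)" by fastforce
  have V: "i \<in> V" "w \<in> group_words V" using Cons.prems by (auto simp: x)
  show ?case
  proof (cases "s = i")
    case True
    have "([(i, b)] @ w, [(i, True)] @ w) \<in> rel"
      using V by (intro presentation_rel_append rel_letter rel_refl)
    then show ?thesis using V True x by auto
  next
    case False
    then have s: "s \<in> descents w" "{i, s} \<in> edges" using Cons.prems by (auto simp: x)
    obtain w' where w': "w' \<in> group_words V" "length w = Suc (length w')"
      "(w, (s, True) # w') \<in> rel"
      using Cons.IH[OF V(2) s(1)] by blast
    have "([(i, b)] @ w, [(i, b)] @ (s, True) # w') \<in> rel"
      using V by (intro presentation_rel_append rel_refl w') auto
    moreover have "([(i, b), (s, True)] @ w', [(s, True), (i, b)] @ w') \<in> rel"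
      using s w' by (intro presentation_rel_append rel_commute rel_refl)
    ultimately have "(x # w, (s, True) # (i, b) # w') \<in> rel"
      by (auto simp: x intro: presentation_rel.trans)
    moreover have "(i, b) # w' \<in> group_words V" using w' V by simp
    ultimately show ?thesis using w'(2) by (metis length_Cons)
  qed
qed simp

lemma shorten_unreduced:
  assumes "w \<in> group_words V" "\<not> reduced w"
  shows "\<exists>w'. w' \<in> group_words V \<and> length w' < length w \<and> (w, w') \<in> rel"
  using assms
proof (induction w)
  case (Cons x w)
  obtain i b where x: "x = (i, b)" by fastforce
  have V: "i \<in> V" "w \<in> group_words V" using Cons.prems by (auto simp: x)
  show ?case
  proof (cases "reduced w")
    case True
    then have "i \<in> descents w" using Cons.prems x by simp
    then obtain w' where w': "w' \<in> group_words V" "length w = Suc (length w')"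
      "(w, (i, True) # w') \<in> rel"
      using descent_front V by blast
    have "([(i, b)] @ w, [(i, b)] @ (i, True) # w') \<in> rel"
      using V by (intro presentation_rel_append rel_refl w') auto
    moreover have "([(i, b), (i, True)] @ w', [] @ w') \<in> rel"
      using V w' by (intro presentation_rel_append rel_square rel_refl)
    ultimately have "(x # w, w') \<in> rel" by (auto simp: x intro: presentation_rel.trans)
    then show ?thesis using w' by (auto intro!: exI[of _ w'])
  next
    case False
    then obtain w' where w': "w' \<in> group_words V" "length w' < length w" "(w, w') \<in> rel"
      using Cons.IH V by blast
    have "([(i, b)] @ w, [(i, b)] @ w') \<in> rel"
      using V by (intro presentation_rel_append rel_refl w') auto
    then show ?thesis using w' V x by (intro exI[of _ "x # w'"]) auto
  qed
qed simp

lemma reduced_exists: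
  "w \<in> group_words V \<Longrightarrow> \<exists>w'. w' \<in> group_words V \<and> reduced w' \<and> (w, w') \<in> rel"
proof (induction "length w" arbitrary: w rule: less_induct)
  case less
  show ?case
  proof (cases "reduced w")
    case True
    then show ?thesis using less.prems rel_refl by blast
  next
    case False
    then obtain w' where "w' \<in> group_words V" "length w' < length w" "(w, w') \<in> rel"
      using shorten_unreduced less.prems by blast
    then show ?thesis using less.hyps[of w'] by (blast intro: presentation_rel.trans)
  qed
qed

text \<open>The third conjunct is what makes the induction work: it controls the sign of the
  \<open>t\<close>-coordinate after a reflection in a root that does not commute with \<open>t\<close>.\<close>

lemma reduced_signs:
  assumes "w \<in> group_words V" "reduced w"
  shows "(\<forall>s\<in>descents w. B (act w k) (e s) < 0)
    \<and> (\<forall>t\<in>V - descents w. B (act w k) (e t) > 0)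
    \<and> (\<forall>s\<in>descents w. \<forall>t\<in>V. t \<noteq> s \<longrightarrow> {s, t} \<notin> edges \<longrightarrow>
        B (act w k) (e s) + B (act w k) (e t) > 0)"
  using assms
proof (induction w)
  case Nil
  then show ?case using root_pos by auto
next
  case (Cons x w)
  define s where "s = fst x"
  define c where "c t = B (act w k) (e t)" for t
  define c' where "c' t = B (act (x # w) k) (e t)" for t
  have s: "s \<in> V" and w: "w \<in> group_words V" "reduced w" and sw: "s \<notin> descents w"
    using Cons.prems by (auto simp: s_def)
  have IH1: "r \<in> descents w \<Longrightarrow> c r < 0"
    and IH2: "t \<in> V \<Longrightarrow> t \<notin> descents w \<Longrightarrow> c t > 0"
    and IH3: "r \<in> descents w \<Longrightarrow> t \<in> V \<Longrightarrow> t \<noteq> r \<Longrightarrow> {r, t} \<notin> edges \<Longrightarrow> c r + c t > 0" for r t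
    using Cons.IH[OF w] by (auto simp: c_def)
  have cs: "c s > 0" using IH2 s sw by blast
  have c': "c' t = c t + 2 * c s * B (e s) (e t)" for t
    by (simp add: c'_def c_def s_def reflect_def B_simps)
  have c's: "c' s = - c s" using c'[of s] root_norm[OF s] by simp
  have comm: "c' t = c t" if "{s, t} \<in> edges" for t
    using c'[of t] that by (simp add: edge_iff)
  have far: "c' t \<ge> c t + 2 * c s" if "t \<in> V" "t \<noteq> s" "{s, t} \<notin> edges" for t
  proof -
    have "B (e s) (e t) \<ge> 1" using root_pair[of s t] s that by (auto simp: edge_iff)
    then have "c s * 1 \<le> c s * B (e s) (e t)" using cs by (intro mult_left_mono) auto
    then show ?thesis using c'[of t] by simp
  qed
  have D: "r \<in> descents (x # w) \<longleftrightarrow> r = s \<or> r \<in> descents w \<and> {s, r} \<in> edges" for r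
    by (auto simp: s_def)
  \<comment> \<open>The s-coordinate becomes -c s while the t-coordinate gains at least 2 c s, so
    the sum is at least c s + c t. This is positive by the third induction hypothesis if t is a
    descent, and otherwise because both terms are.\<close>
  have far_s: "c' s + c' t > 0" if "t \<in> V" "t \<noteq> s" "{s, t} \<notin> edges" for t
  proof (cases "t \<in> descents w")
    case True
    then have "c t + c s > 0" using IH3[of t s] s that by (auto simp: insert_commute)
    then show ?thesis using far[OF that] c's by simp
  next
    case False
    then have "c t > 0" using IH2 that by blast
    then show ?thesis using far[OF that] c's cs by simp
  qed
  have 1: "c' r < 0" if "r \<in> descents (x # w)" for r
    using that D[of r] c's cs comm[of r] IH1[of r] by auto
  have 2: "c' t > 0" if "t \<in> V" "t \<notin> descents (x # w)" for t
  proof (cases "{s, t} \<in> edges")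
    case True
    then show ?thesis using that D[of t] comm[of t] IH2[of t] by auto
  next
    case False
    then show ?thesis using that D[of t] far_s[of t] c's cs by auto
  qed
  have 3: "c' r + c' t > 0"
    if "r \<in> descents (x # w)" "t \<in> V" "t \<noteq> r" "{r, t} \<notin> edges" for r t
  proof (cases "r = s")
    case True
    then show ?thesis using far_s that by auto
  next
    case False
    \<comment> \<open>Now r commutes with s, so its coordinate does not change. Since {r, t} is no
      edge, t is not s, and then the t-coordinate cannot drop.\<close>
    then have r: "r \<in> descents w" "{s, r} \<in> edges" using that D by auto
    then have "t \<noteq> s" using that by (auto simp: insert_commute)
    then have "c' t \<ge> c t" using far[of t] comm[of t] cs that by fastforce
    then show ?thesis using comm[OF r(2)] IH3[OF r(1) that(2-4)] by simp
  qed
  show ?case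
  proof (intro conjI ballI impI)
    fix r assume "r \<in> descents (x # w)"
    then show "B (act (x # w) k) (e r) < 0" by (rule 1[unfolded c'_def])
  next
    fix t assume "t \<in> V - descents (x # w)"
    then show "B (act (x # w) k) (e t) > 0" by (intro 2[unfolded c'_def]) blast+
  next
    fix r t assume "r \<in> descents (x # w)" "t \<in> V" "t \<noteq> r" "{r, t} \<notin> edges"
    then show "B (act (x # w) k) (e r) + B (act (x # w) k) (e t) > 0"
      by (rule 3[unfolded c'_def])
  qed
qed

text \<open>\<open>k\<close> lies in the open chamber where all coordinates are positive. A nonempty
  reduced word has its first letter as a descent and makes that coordinate negative, so it moves
  \<open>k\<close>.\<close>

lemma act_faithful:
  assumes "w \<in> group_words V" "act w k = k"
  shows "(w, []) \<in> rel"
proof -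
  obtain w' where w': "w' \<in> group_words V" "reduced w'" "(w, w') \<in> rel"
    using reduced_exists assms by blast
  show ?thesis
  proof (cases w')
    case Nil
    then show ?thesis using w' by simp
  next
    case (Cons x u)
    then have "fst x \<in> descents w'" "fst x \<in> V" using w' by auto
    then have "B (act w' k) (e (fst x)) < 0" using reduced_signs[OF w'(1,2)] by blast
    moreover have "act w' k = k" using act_rel[OF w'(3)] assms by simp
    ultimately show ?thesis using root_pos[OF \<open>fst x \<in> V\<close>] by simp
  qed
qed

lemma act_inj:
  assumes "u \<in> group_words V" "v \<in> group_words V" "act u = act v"
  shows "(u, v) \<in> rel"
proof -
  have rv: "rev v \<in> group_words V" using assms(2) by (auto simp: group_words_def)
  have rev: "act (rev w) (act w x) = x" if "w \<in> group_words V" for w x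
    using that
  proof (induction w arbitrary: x)
    case (Cons a w)
    then show ?case by (simp add: act_append reflect_involution)
  qed simp
  have "(v @ rev v, []) \<in> rel"
  proof (rule act_faithful)
    show "act (v @ rev v) k = k" using rev[OF rv] by (simp add: act_append)
  qed (use assms rv in auto)
  then have 1: "((v @ rev v) @ u, [] @ u) \<in> rel"
    using assms by (intro presentation_rel_append rel_refl)
  have "(rev v @ u, []) \<in> rel"
  proof (rule act_faithful)
    show "act (rev v @ u) k = k" using rev[OF assms(2)] assms(3) by (simp add: act_append)
  qed (use assms rv in auto)
  then have 2: "(v @ rev v @ u, v @ []) \<in> rel"
    using assms by (intro presentation_rel_append rel_refl)
  show ?thesis using 1 2 by (auto intro: presentation_rel.trans presentation_rel.sym)
qed

text \<open>The words may be chosen arbitrarily: by \<open>act_inj\<close> the class of a word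
  depends only on its action, and this makes the choice multiplicative.\<close>

theorem embeds_in_RACG_if_reflections:
  assumes "group G"
    and hom: "\<And>x y. x \<in> carrier G \<Longrightarrow> y \<in> carrier G \<Longrightarrow> \<phi> (x \<otimes>\<^bsub>G\<^esub> y) = \<phi> x \<circ> \<phi> y"
    and inj: "inj_on \<phi> (carrier G)"
    and generated: "\<And>x. x \<in> carrier G \<Longrightarrow> \<exists>w\<in>group_words V. \<phi> x = act w"
  shows "embeds_in_RACG G"
proof -
  interpret group G by fact
  define word where "word x = (SOME w. w \<in> group_words V \<and> \<phi> x = act w)" for x
  have word: "word x \<in> group_words V" "\<phi> x = act (word x)" if "x \<in> carrier G" for x
    using someI_ex[of "\<lambda>w. w \<in> group_words V \<and> \<phi> x = act w"] generated[OF that]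
    unfolding word_def by blast+
  define h where "h x = rel `` {word x}" for x
  have "h \<in> hom G (presented_group V relators)"
  proof (rule homI)
    fix x assume "x \<in> carrier G"
    then show "h x \<in> carrier (presented_group V relators)"
      using word by (auto simp: h_def presented_group_def quotient_def)
  next
    fix x y assume xy: "x \<in> carrier G" "y \<in> carrier G"
    have "(word (x \<otimes>\<^bsub>G\<^esub> y), word x @ word y) \<in> rel"
    proof (rule act_inj)
      have "act (word (x \<otimes>\<^bsub>G\<^esub> y)) = \<phi> x \<circ> \<phi> y"
        using xy by (simp add: word(2)[symmetric] hom)
      then show "act (word (x \<otimes>\<^bsub>G\<^esub> y)) = act (word x @ word y)"
        using xy word(2) by (simp add: act_append fun_eq_iff)
    qed (use xy word in auto)
    then show "h (x \<otimes>\<^bsub>G\<^esub> y) = h x \<otimes>\<^bsub>presented_group V relators\<^esub> h y"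
      using xy word by (simp add: h_def mult_presented_group
          equiv_class_eq[OF equiv_presentation_rel])
  qed
  moreover have "inj_on h (carrier G)"
  proof (rule inj_onI)
    fix x y assume xy: "x \<in> carrier G" "y \<in> carrier G" "h x = h y"
    then have "(word x, word y) \<in> rel"
      using word(1) eq_equiv_class[OF _ equiv_presentation_rel] unfolding h_def by blast
    then have "\<phi> x = \<phi> y" using act_rel word(2) xy by metis
    then show "x = y" using inj xy by (auto dest: inj_onD)
  qed
  ultimately have "h \<in> mon G (RACG V edges)"
    by (simp add: mon_def RACG_eq)
  then show ?thesis
    unfolding embeds_in_RACG_def using finite_simple_graph_edges by blast
qed

end

section \<open>Reflections generating the level 2 isometries\<close>

declare split_paired_All [simp del] split_paired_Ex [simp del]

type_synonym lorentz = "real \<times> real \<times> (real^6)"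

text \<open>The odd unimodular lattice of signature \<open>(1, 7)\<close>, written as a hyperbolic plane plus six copies
  of \<open>\<langle>-1\<rangle>\<close>; in this form a Hermitian matrix with diagonal \<open>(a, d)\<close> has the norm \<open>2 det\<close>.\<close>

definition lor :: "lorentz \<Rightarrow> lorentz \<Rightarrow> real" where
  "lor v w = fst v * fst (snd w) + fst w * fst (snd v) - snd (snd v) \<bullet> snd (snd w)"

lemma lor_Pair [simp]: "lor (a, d, X) (a', d', X') = a * d' + a' * d - X \<bullet> X'"
  by (simp add: lor_def)

lemma lor_sym: "lor v w = lor w v"
  by (simp add: lor_def inner_commute)

lemma bilinear_lor: "bilinear lor"
  by (auto simp: bilinear_def lor_def algebra_simps inner_add_left inner_add_right
      intro!: linearI)

lemmas lor_simps = bilinear_ladd[OF bilinear_lor] bilinear_radd[OF bilinear_lor]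
  bilinear_lmul[OF bilinear_lor] bilinear_rmul[OF bilinear_lor]
  bilinear_lsub[OF bilinear_lor] bilinear_rsub[OF bilinear_lor]
  bilinear_lneg[OF bilinear_lor] bilinear_rneg[OF bilinear_lor]
  bilinear_lzero[OF bilinear_lor] bilinear_rzero[OF bilinear_lor]

definition integral_vec :: "lorentz \<Rightarrow> bool" where
  "integral_vec v \<longleftrightarrow> fst v \<in> \<int> \<and> fst (snd v) \<in> \<int> \<and> (\<forall>i. snd (snd v) $ i \<in> \<int>)"

lemma integral_vec_Pair [simp]:
  "integral_vec (a, d, X) \<longleftrightarrow> a \<in> \<int> \<and> d \<in> \<int> \<and> (\<forall>i. X $ i \<in> \<int>)"
  by (simp add: integral_vec_def)

lemma integral_vec_add: "integral_vec v \<Longrightarrow> integral_vec w \<Longrightarrow> integral_vec (v + w)"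
  by (simp add: integral_vec_def)

lemma integral_vec_diff: "integral_vec v \<Longrightarrow> integral_vec w \<Longrightarrow> integral_vec (v - w)"
  by (simp add: integral_vec_def)

lemma integral_vec_scaleR: "c \<in> \<int> \<Longrightarrow> integral_vec v \<Longrightarrow> integral_vec (c *\<^sub>R v)"
  by (simp add: integral_vec_def)

lemma lor_Ints: "integral_vec v \<Longrightarrow> integral_vec w \<Longrightarrow> lor v w \<in> \<int>"
  by (auto simp: integral_vec_def lor_def inner_vec_def intro!: Ints_diff Ints_add Ints_sum)

text \<open>The surface is viewed as the quadric P1 x P1 blown up in six points: \<open>kap\<close>
  is twice each ruling minus the six exceptional curves, which are the vectors
  \<open>(0, 0, - axis i 1)\<close>.\<close>

definition kap :: lorentz where
  "kap = (2, 2, \<chi> i. 1)"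

lemma integral_kap: "integral_vec kap"
  by (simp add: kap_def)

lemma inner_ones: "(\<chi> i. 1) \<bullet> (X::real^6) = (\<Sum>i\<in>UNIV. X $ i)"
  by (simp add: inner_vec_def)

lemma lor_kap_kap: "lor kap kap = 2"
  by (simp add: kap_def inner_ones)

lemma lor_kap: "lor kap (a, d, X) = 2 * a + 2 * d - (\<Sum>i\<in>UNIV. X $ i)"
  by (simp add: kap_def inner_ones)

text \<open>The Hodge index theorem in explicit form: the complement of \<open>kap\<close> is
  negative definite. The bound by the last six coordinates, obtained from Cauchy-Schwarz, also
  serves to prove that the lines are finite in number.\<close>

lemma lor_kap_orth_le:
  assumes "lor kap v = 0" shows "lor v v \<le> - (snd (snd v) \<bullet> snd (snd v)) / 4"
proof -
  obtain a d X where v: "v = (a, d, X)" by (cases v)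
  have s: "2 * (a + d) = (\<chi> i. 1) \<bullet> X"
    using assms by (simp add: v kap_def)
  have "((\<chi> i. 1) \<bullet> X)\<^sup>2 \<le> ((\<chi> i. 1) \<bullet> ((\<chi> i. 1)::real^6)) * (X \<bullet> X)"
    by (rule Cauchy_Schwarz_ineq)
  also have "(\<chi> i. 1) \<bullet> ((\<chi> i. 1)::real^6) = 6" by (simp add: inner_ones)
  finally have "4 * (a + d)\<^sup>2 \<le> 6 * (X \<bullet> X)"
    by (simp only: s[symmetric] power_mult_distrib) simp
  moreover have "4 * (a * d) \<le> (a + d)\<^sup>2"
    using zero_le_power2[of "a - d"] by (simp add: power2_eq_square algebra_simps)
  ultimately show ?thesis by (simp add: v)
qed

lemma lor_kap_orth_nonpos: "lor kap v = 0 \<Longrightarrow> lor v v \<le> 0"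
  using lor_kap_orth_le[of v] inner_ge_zero[of "snd (snd v)"] by linarith

lemma lor_kap_orth_zero:
  assumes "lor kap v = 0" "lor v v = 0" shows "v = 0"
proof -
  obtain a d X where v: "v = (a, d, X)" by (cases v)
  have "X \<bullet> X \<le> 0" using lor_kap_orth_le[OF assms(1)] assms(2) by (simp add: v)
  then have X: "X = 0" by (metis inner_gt_zero_iff not_less)
  then have "d = - a" using assms(1) by (simp add: v kap_def)
  then show ?thesis using assms(2) X by (simp add: v zero_prod_def)
qed

lemma half_square_diff_Ints:
  assumes "(x::real) \<in> \<int>" shows "(x * x - x) / 2 \<in> \<int>"
proof -
  obtain n where x: "x = of_int n" using assms Ints_cases by blast
  have "even (n * n - n)" by simp
  then obtain c where "n * n - n = 2 * c" by blast
  then have "x * x - x = 2 * of_int c"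
    unfolding x by (metis of_int_diff of_int_mult of_int_numeral)
  then show ?thesis by simp
qed

text \<open>\<open>kap\<close> is a characteristic vector: the norm of an integral vector has the
  parity of its pairing with \<open>kap\<close>, because x * x and x have the same parity.\<close>

lemma lor_kap_orth_even:
  assumes "integral_vec v" "lor kap v = 0" shows "lor v v / 2 \<in> \<int>"
proof -
  obtain a d X where v: "v = (a, d, X)" by (cases v)
  have s: "2 * (a + d) = (\<Sum>i\<in>UNIV. X $ i)"
    using assms(2) by (simp add: v lor_kap)
  have "lor v v / 2 = a * d - (\<Sum>i\<in>UNIV. (X $ i * X $ i - X $ i) / 2) - (a + d)"
    by (simp add: v inner_vec_def sum_subtractf s[symmetric] sum_divide_distrib[symmetric]
        diff_divide_distrib add_divide_distrib)
  also have "\<dots> \<in> \<int>"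
    using assms(1) by (auto simp: v intro!: Ints_diff Ints_add Ints_mult Ints_sum half_square_diff_Ints)
  finally show ?thesis .
qed

text \<open>In the language of del Pezzo surfaces of degree 2, \<open>kap\<close> is the anticanonical class
  and these are the 56 exceptional curves.\<close>

definition line :: "lorentz \<Rightarrow> bool" where
  "line v \<longleftrightarrow> integral_vec v \<and> lor v v = -1 \<and> lor kap v = 1"

lemma line_exceptional: "line (0, 0, - axis i 1)"
  by (auto simp: line_def lor_kap axis_def inner_vec_def sum_negf if_distrib[of "\<lambda>x. x * _"]
      cong: if_cong)

lemma line_left: "line (1, 0, axis i 1)"
  by (auto simp: line_def lor_kap axis_def inner_vec_def if_distrib[of "\<lambda>x. x * _"]
      cong: if_cong)

lemma line_right: "line (0, 1, axis i 1)"
  by (auto simp: line_def lor_kap axis_def inner_vec_def if_distrib[of "\<lambda>x. x * _"]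
      cong: if_cong)

text \<open>The Geiser involution. It exhibits \<open>kap\<close> as a sum of two lines, so a class
  that is nonnegative on all lines is nonnegative on \<open>kap\<close>.\<close>

lemma line_conjugate: "line v \<Longrightarrow> line (kap - v)"
  by (simp add: line_def lor_simps lor_sym[of v kap] lor_kap_kap integral_vec_diff integral_kap)

text \<open>The difference of two lines is orthogonal to \<open>kap\<close>, hence of negative norm
  -2 - 2 (v . w); integrality does the rest.\<close>

lemma line_pair:
  assumes "line v" "line w" "v \<noteq> w" shows "lor v w = 0 \<or> lor v w \<ge> 1"
proof -
  have o: "lor kap (v - w) = 0" using assms by (simp add: lor_simps line_def)
  have "lor (v - w) (v - w) < 0"
    using lor_kap_orth_nonpos[OF o] lor_kap_orth_zero[OF o] assms(3) by force
  moreover have "lor (v - w) (v - w) = -2 - 2 * lor v w"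
    using assms lor_sym[of v w] by (simp add: lor_simps line_def)
  ultimately have "lor v w > -1" by simp
  moreover obtain n where "lor v w = of_int n"
    using lor_Ints[of v w] assms Ints_cases unfolding line_def by blast
  ultimately show ?thesis by auto
qed

lemma finite_bounded_Ints: "finite {x::real. x \<in> \<int> \<and> \<bar>x\<bar> \<le> c}"
proof -
  have "{x::real. x \<in> \<int> \<and> \<bar>x\<bar> \<le> c} \<subseteq> of_int ` {-\<lceil>c\<rceil>..\<lceil>c\<rceil>}"
  proof
    fix x :: real assume "x \<in> {x. x \<in> \<int> \<and> \<bar>x\<bar> \<le> c}"
    then obtain n where "x = of_int n" "\<bar>of_int n\<bar> \<le> c" by (auto elim: Ints_cases)
    moreover from this have "- \<lceil>c\<rceil> \<le> n" "n \<le> \<lceil>c\<rceil>" by linarith+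
    ultimately show "x \<in> of_int ` {-\<lceil>c\<rceil>..\<lceil>c\<rceil>}" by auto
  qed
  then show ?thesis by (rule finite_subset) simp
qed

text \<open>\<open>2 v - kap\<close> is orthogonal to \<open>kap\<close> and has norm -4 - 4 + 2 =
  -6, so negative definiteness bounds it. The numerical bounds are generous; only finiteness
  matters.\<close>

lemma finite_lines: "finite {v. line v}"
proof -
  define S where "S = {x::real. x \<in> \<int> \<and> \<bar>x\<bar> \<le> 20}"
  have "{v. line v} \<subseteq> S \<times> S \<times> {X. \<forall>i. X $ i \<in> S}"
  proof
    fix v assume "v \<in> {v. line v}"
    then have l: "line v" by simp
    obtain a d X where v: "v = (a, d, X)" by (cases v)
    define Y where "Y = 2 *\<^sub>R X - (\<chi> i. 1)"
    have o: "lor kap (2 *\<^sub>R v - kap) = 0"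
      using l by (simp add: lor_simps line_def lor_kap_kap)
    have n: "lor (2 *\<^sub>R v - kap) (2 *\<^sub>R v - kap) = -6"
      using l by (simp add: lor_simps line_def lor_kap_kap lor_sym[of v kap])
    have "2 *\<^sub>R v - kap = (2 * a - 2, 2 * d - 2, Y)"
      by (simp add: v kap_def Y_def)
    then have Y: "Y \<bullet> Y \<le> 24" "2 * (2 * a + 2 * d - 4) = (\<Sum>i\<in>UNIV. Y $ i)"
      and ad: "2 * ((2 * a - 2) * (2 * d - 2)) = Y \<bullet> Y - 6"
      using lor_kap_orth_le[OF o] n o by (auto simp: lor_kap)
    have Yi: "\<bar>Y $ i\<bar> \<le> 5" for i
    proof -
      have "(Y $ i)\<^sup>2 \<le> Y \<bullet> Y"
        unfolding inner_vec_def power2_eq_square inner_real_def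
        by (rule member_le_sum) auto
      then have "\<bar>Y $ i\<bar>\<^sup>2 \<le> 5\<^sup>2" using Y by simp
      then show ?thesis by (rule power2_le_imp_le) simp
    qed
    have Xi: "\<bar>X $ i\<bar> \<le> 20" for i using Yi[of i] by (simp add: Y_def)
    have "\<bar>\<Sum>i\<in>UNIV. Y $ i\<bar> \<le> (\<Sum>i\<in>(UNIV::6 set). 5)"
      by (intro order_trans[OF sum_abs] sum_mono Yi)
    then have s: "\<bar>2 * (2 * a + 2 * d - 4)\<bar> \<le> 30" using Y(2) by simp
    have "((2 * a - 2) - (2 * d - 2))\<^sup>2 = (2 * a + 2 * d - 4)\<^sup>2 - 2 * (Y \<bullet> Y - 6)"
      unfolding ad[symmetric] by (simp add: power2_eq_square algebra_simps)
    also have "\<dots> \<le> 15\<^sup>2 + 12"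
    proof -
      have "\<bar>2 * a + 2 * d - 4\<bar>\<^sup>2 \<le> 15\<^sup>2" using s by (intro power_mono) auto
      then have "(2 * a + 2 * d - 4)\<^sup>2 \<le> 225" by simp
      moreover have "Y \<bullet> Y \<ge> 0" by simp
      ultimately show ?thesis by (simp; linarith)
    qed
    also have "\<dots> \<le> 16\<^sup>2" by simp
    finally have "\<bar>(2 * a - 2) - (2 * d - 2)\<bar>\<^sup>2 \<le> 16\<^sup>2" by simp
    then have "\<bar>(2 * a - 2) - (2 * d - 2)\<bar> \<le> 16" by (rule power2_le_imp_le) simp
    then have "\<bar>a\<bar> \<le> 20" "\<bar>d\<bar> \<le> 20" using s by (auto simp: abs_le_iff)
    then show "v \<in> S \<times> S \<times> {X. \<forall>i. X $ i \<in> S}"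
      using l Xi by (auto simp: v S_def line_def)
  qed
  moreover have "finite S" unfolding S_def by (rule finite_bounded_Ints)
  moreover have "finite {X::real^6. \<forall>i. X $ i \<in> S}"
  proof (rule finite_subset)
    show "{X::real^6. \<forall>i. X $ i \<in> S} \<subseteq> vec_lambda ` (UNIV \<rightarrow>\<^sub>E S)"
    proof
      fix X :: "real^6" assume "X \<in> {X. \<forall>i. X $ i \<in> S}"
      then show "X \<in> vec_lambda ` (UNIV \<rightarrow>\<^sub>E S)"
        by (intro image_eqI[of _ _ "vec_nth X"]) auto
    qed
    show "finite (vec_lambda ` ((UNIV::6 set) \<rightarrow>\<^sub>E S))"
      by (intro finite_imageI finite_PiE) (use \<open>finite S\<close> in auto)
  qed
  ultimately show ?thesis using finite_subset by blast
qed


section \<open>Nef classes and the reflections in roots of norm -2\<close>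

definition nef :: "lorentz \<Rightarrow> bool" where
  "nef v \<longleftrightarrow> integral_vec v \<and> (\<forall>e. line e \<longrightarrow> lor v e \<ge> 0)"

text \<open>The integral vectors of norm -2 orthogonal to \<open>kap\<close> are the roots of E7.
  Their reflections are integral isometries fixing \<open>kap\<close>, so they respect all
  conditions that define a line.\<close>

lemma line_root_reflection:
  assumes "integral_vec r" "lor r r = -2" "lor kap r = 0" "line e"
  shows "line (e + lor e r *\<^sub>R r)"
  using assms lor_sym[of r e] unfolding line_def
  by (auto simp: lor_simps intro!: integral_vec_add integral_vec_scaleR lor_Ints)

lemma nef_root_reflection:
  assumes r: "integral_vec r" "lor r r = -2" "lor kap r = 0" and "nef v"
  shows "nef (v + lor v r *\<^sub>R r)" "lor (v + lor v r *\<^sub>R r) (v + lor v r *\<^sub>R r) = lor v v"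
proof -
  have "lor (v + lor v r *\<^sub>R r) e = lor v (e + lor e r *\<^sub>R r)" for e
    by (simp add: lor_simps lor_sym[of r e])
  then show "nef (v + lor v r *\<^sub>R r)"
    using assms line_root_reflection[OF r] unfolding nef_def
    by (auto intro!: integral_vec_add integral_vec_scaleR lor_Ints)
  show "lor (v + lor v r *\<^sub>R r) (v + lor v r *\<^sub>R r) = lor v v"
    using r lor_sym[of r v] by (simp add: lor_simps)
qed

text \<open>For (a, d) = (1, 0) or (0, 1) these are the roots "a ruling minus two exceptional
  curves", the only ones that the reduction of nef classes uses.\<close>

lemma root_mixed:
  fixes i j :: 6
  assumes "i \<noteq> j"
  shows "lor (a, d, axis i 1 + axis j 1) (a, d, axis i 1 + axis j 1) = 2 * a * d - 2"
    "lor kap (a, d, axis i 1 + axis j 1) = 2 * a + 2 * d - 2"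
    "a \<in> \<int> \<Longrightarrow> d \<in> \<int> \<Longrightarrow> integral_vec (a, d, axis i 1 + axis j 1)"
  using assms
  by (auto simp: kap_def inner_add_left inner_add_right inner_axis_axis inner_axis)
    (auto simp: axis_def)

text \<open>The reflections in roots orthogonal to \<open>kap\<close> permute the lines, so they may be used to
  move a nef class into a region in which its norm is easy to estimate.\<close>

lemma nef_norm_nonneg:
  assumes "nef v" shows "lor v v \<ge> 0"
  using assms
proof (induction "nat \<lfloor>lor v (1, 1, 0)\<rfloor>" arbitrary: v rule: less_induct)
  case less
  obtain a d X where v: "v = (a, d, X)" by (cases v)
  have int: "integral_vec v" using less.prems by (simp add: nef_def)
  have pos: "lor v e \<ge> 0" if "line e" for e using less.prems that by (simp add: nef_def)
  have X0: "X $ i \<ge> 0" for i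
    using pos[OF line_exceptional[of i]] by (simp add: v inner_axis)
  have Xd: "X $ i \<le> d" "X $ i \<le> a" for i
    using pos[OF line_left[of i]] pos[OF line_right[of i]] by (simp_all add: v inner_axis)
  \<comment> \<open>Pairing with \<open>(1, 1, 0)\<close> gives a + d, the quantity of the
    induction. The reflection adds the root r, for which this quantity is 1, with a coefficient of
    at most -1.\<close>
  have reduce: ?case
    if r: "integral_vec r" "lor r r = -2" "lor kap r = 0" "lor r (1, 1, 0) = 1" "lor v r < 0" for r
  proof -
    define v' where "v' = v + lor v r *\<^sub>R r"
    have "lor v r \<in> \<int>" using int r lor_Ints by blast
    then obtain n where n: "lor v r = of_int n" using Ints_cases by blast
    then have "n \<le> -1" using r(5) by simp
    then have n1: "lor v r \<le> -1" unfolding n by linarith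
    have v': "nef v'" "lor v' v' = lor v v"
      using nef_root_reflection[OF r(1-3) less.prems] by (simp_all add: v'_def)
    have le: "lor v' (1, 1, 0) \<le> lor v (1, 1, 0) - 1"
      using n1 r(4) by (simp add: v'_def lor_simps)
    have "integral_vec v" "integral_vec (1, 1, 0)" by (simp_all add: int)
    moreover have "lor v (1, 1, 0) \<ge> 0" using X0[of 0] Xd[of 0] by (simp add: v)
    \<comment> \<open>The measure is truncated at 0, so it decreases only from a positive value. At
      value 0 the reflected class, which is again nef, would have a negative a + d.\<close>
    moreover have "lor v (1, 1, 0) \<noteq> 0"
    proof
      assume "lor v (1, 1, 0) = 0"
      then have "lor v' (1, 1, 0) < 0" using le by simp
      moreover obtain a' d' X' where w: "v' = (a', d', X')" by (cases v')
      have "lor v' (1, 0, axis 0 1) \<ge> 0" "lor v' (0, 1, axis 0 1) \<ge> 0"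
        "lor v' (0, 0, - axis 0 1) \<ge> 0"
        using v'(1) line_left line_right line_exceptional by (simp_all add: nef_def)
      then have "lor v' (1, 1, 0) \<ge> 0" by (simp add: w inner_axis)
      ultimately show False by simp
    qed
    ultimately have "nat \<lfloor>lor v' (1, 1, 0)\<rfloor> < nat \<lfloor>lor v (1, 1, 0)\<rfloor>"
      using le lor_Ints[of v "(1, 1, 0)"] by (auto elim!: Ints_cases) linarith
    then show ?thesis using less.hyps[of v'] v' by simp
  qed
  show ?case
  proof (cases "\<exists>i j. i \<noteq> j \<and> (X $ i + X $ j > d \<or> X $ i + X $ j > a)")
    case True
    then obtain i j :: 6 where ij: "i \<noteq> j" "X $ i + X $ j > d \<or> X $ i + X $ j > a" by blast
    from ij(2) show ?thesis
    proof
      assume "X $ i + X $ j > d"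
      then show ?thesis
        using ij(1) root_mixed[OF ij(1), of 1 0]
        by (intro reduce[of "(1, 0, axis i 1 + axis j 1)"])
           (simp_all add: v inner_add_right inner_axis)
    next
      assume "X $ i + X $ j > a"
      then show ?thesis
        using ij(1) root_mixed[OF ij(1), of 0 1]
        by (intro reduce[of "(0, 1, axis i 1 + axis j 1)"])
           (simp_all add: v inner_add_right inner_axis)
    qed
  next
    case False
    define M where "M = min a d"
    have M0: "M \<ge> 0" using X0[of 0] Xd[of 0] by (simp add: M_def)
    have M: "X $ i + X $ j \<le> M" if "i \<noteq> j" for i j
      using False that not_less unfolding M_def by (intro min.boundedI) blast+
    \<comment> \<open>Any two coordinates now add up to at most M. If none exceeds M / 2, the six
      squares total at most 3/2 M * M; if one coordinate s does, the other five are at most M -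
      s.\<close>
    have "X \<bullet> X \<le> 2 * (M * M)"
    proof (cases "\<exists>i. X $ i > M / 2")
      case False
      then have "X $ i * X $ i \<le> (M / 2) * (M / 2)" for i
        using X0[of i] M0 by (intro mult_mono) (auto simp: not_less)
      then have "X \<bullet> X \<le> (\<Sum>i\<in>(UNIV::6 set). (M / 2) * (M / 2))"
        unfolding inner_vec_def inner_real_def by (intro sum_mono)
      then show ?thesis using mult_nonneg_nonneg[OF M0 M0] by (simp; linarith)
    next
      case True
      then obtain i where i: "X $ i > M / 2" by blast
      define s where "s = X $ i"
      obtain j :: 6 where "j \<noteq> i"
        by (metis zero_neq_one)
      then have s: "s > M / 2" "s \<le> M" using i M[of j i] X0[of j] by (auto simp: s_def)
      have "X \<bullet> X = s * s + (\<Sum>j\<in>UNIV - {i}. X $ j * X $ j)"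
        by (simp add: inner_vec_def s_def sum.remove[of _ i])
      also have "\<dots> \<le> s * s + (\<Sum>j\<in>UNIV - {i}. (M - s) * (M - s))"
      proof (intro add_left_mono sum_mono)
        fix j assume "j \<in> UNIV - {i}"
        then show "X $ j * X $ j \<le> (M - s) * (M - s)"
          using M[of i j] X0[of j] by (intro mult_mono) (auto simp: s_def)
      qed
      also have "\<dots> = s * s + 5 * ((M - s) * (M - s))"
        by (simp add: card_Diff_singleton)
      also have "\<dots> \<le> 2 * (M * M)"
      proof -
        have "(s - M / 2) * (M - s) \<ge> 0" "s * M \<ge> 0" using s M0 by simp_all
        moreover have "2 * (M * M) - (s * s + 5 * ((M - s) * (M - s)))
            = 6 * ((s - M / 2) * (M - s)) + s * M"
          by (simp add: field_simps)
        ultimately show ?thesis by linarith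
      qed
      finally show ?thesis .
    qed
    also have "\<dots> \<le> 2 * (a * d)"
      using M0 by (intro mult_left_mono mult_mono) (auto simp: M_def)
    finally show ?thesis by (simp add: v)
  qed
qed

section \<open>Isometries that are trivial modulo 2\<close>

text \<open>The condition on \<open>kap\<close> selects one of g and -g: the one that keeps
  \<open>kap\<close> in its own half of the light cone.\<close>

definition level2_isometry :: "(lorentz \<Rightarrow> lorentz) \<Rightarrow> bool" where
  "level2_isometry g \<longleftrightarrow> linear g \<and> (\<forall>v w. lor (g v) (g w) = lor v w)
    \<and> (\<forall>v. integral_vec v \<longrightarrow> (\<exists>w. integral_vec w \<and> g v = v + 2 *\<^sub>R w))
    \<and> lor (g kap) kap > 0"

text \<open>A line e goes to e + 2 w with w orthogonal to \<open>kap\<close>, so w . w is even and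
  at most 0. Preservation of the norm gives e . g(e) = -1 - 2 (w . w), while e . g(e) \<le> 2 since
  e + g(e) - kap has nonpositive norm. This excludes w . w \<le> -2, so every line is fixed, and the
  lines span.\<close>

lemma level2_isometry_fixing_kap:
  assumes g: "level2_isometry g" and kap: "g kap = kap"
  shows "g = id"
proof -
  interpret linear g using g by (simp add: level2_isometry_def)
  have iso: "lor (g v) (g w) = lor v w" for v w
    using g by (simp add: level2_isometry_def)
  have fix_line: "g e = e" if "line e" for e
  proof -
    have e: "integral_vec e" "lor e e = -1" "lor kap e = 1" using that by (auto simp: line_def)
    then obtain w where w: "integral_vec w" "g e = e + 2 *\<^sub>R w"
      using g unfolding level2_isometry_def by blast
    have ge: "lor (g e) (g e) = -1" "lor kap (g e) = 1"
      using iso[of e e] iso[of kap e] kap e by simp_all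
    have "lor kap w = 0" using ge(2) e(3) by (simp add: w lor_simps)
    then have even: "lor w w / 2 \<in> \<int>" and le: "lor w w \<le> 0" and z: "lor w w = 0 \<Longrightarrow> w = 0"
      using lor_kap_orth_even w(1) lor_kap_orth_nonpos lor_kap_orth_zero by auto
    have "lor kap (e + g e - kap) = 0"
      using e ge by (simp add: lor_simps lor_kap_kap)
    then have "lor (e + g e - kap) (e + g e - kap) \<le> 0" by (rule lor_kap_orth_nonpos)
    then have "lor e (g e) \<le> 2"
      using e ge lor_sym[of "g e" e] lor_sym[of "g e" kap] lor_sym[of e kap] by (simp add: lor_simps lor_kap_kap)
    moreover have "lor e (g e) = -1 + 2 * lor e w" by (simp add: w lor_simps e)
    moreover have "lor (g e) (g e) = -1 + 4 * lor e w + 4 * lor w w"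
      using lor_sym[of w e] by (simp add: w lor_simps e)
    ultimately have "lor w w > -2" using ge by simp
    moreover obtain n where "lor w w / 2 = of_int n" using even Ints_cases by blast
    then have "lor w w = 2 * of_int n" by simp
    ultimately have "lor w w = 0" using le by (simp; linarith)
    then show ?thesis using z w by simp
  qed
  have ax: "g (0, 0, axis i 1) = (0, 0, axis i 1)" for i
    using neg[of "(0, 0, - axis i 1)"] fix_line[OF line_exceptional[of i]] by simp
  have "g ((1, 0, axis 0 1) - (0, 0, axis 0 1)) = (1, 0, axis 0 1) - (0, 0, axis 0 1)"
    unfolding diff ax fix_line[OF line_left] ..
  then have e1: "g (1, 0, 0) = (1, 0, 0)" by (simp add: zero_prod_def)
  have "g ((0, 1, axis 0 1) - (0, 0, axis 0 1)) = (0, 1, axis 0 1) - (0, 0, axis 0 1)"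
    unfolding diff ax fix_line[OF line_right] ..
  then have e2: "g (0, 1, 0) = (0, 1, 0)" by (simp add: zero_prod_def)
  show ?thesis
  proof
    fix v :: lorentz
    obtain a d X where v: "v = (a, d, X)" by (cases v)
    have "(\<Sum>i\<in>A. X $ i *\<^sub>R (0::real, 0::real, axis i (1::real))) = (0::real, 0::real, \<Sum>i\<in>A. X $ i *\<^sub>R axis i (1::real))"
      for A :: "6 set"
      using finite[of A] by (induction A rule: finite_induct) (auto simp: zero_prod_def)
    moreover have "(\<Sum>i\<in>UNIV. X $ i *\<^sub>R axis i (1::real)) = X"
      using basis_expansion[of X] by (simp add: scalar_mult_eq_scaleR)
    ultimately have X: "(\<Sum>i\<in>UNIV. X $ i *\<^sub>R (0::real, 0::real, axis i (1::real))) = (0, 0, X)"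
      by (simp only:)
    have "v = a *\<^sub>R (1, 0, 0) + d *\<^sub>R (0, 1, 0) + (\<Sum>i\<in>UNIV. X $ i *\<^sub>R (0, 0, axis i 1))"
      unfolding X v by simp
    moreover have "g \<dots> = \<dots>" by (simp only: add scale sum e1 e2 ax)
    ultimately show "g v = id v" by simp
  qed
qed

text \<open>The expression is the pairing of v with \<open>kap + 2 e\<close>, the reflected
  \<open>kap\<close>. A reflection in a vector of negative norm does not exchange the halves of the
  light cone.\<close>

lemma kap_root_reflection_pos:
  assumes "lor v v = 2" "lor v kap > 0" "line e"
  shows "lor v kap + 2 * lor v e > 0"
proof (rule ccontr)
  assume neg: "\<not> ?thesis"
  define k where "k = lor v kap"
  define c where "c = lor v e"
  \<comment> \<open>\<open>v\<close> pairs with \<open>kap\<close> to k and \<open>kap + 2 e\<close>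
    pairs with it to 4, so this combination is orthogonal to \<open>kap\<close>. Its norm would be
    positive if the claim failed.\<close>
  define w where "w = 4 *\<^sub>R v - k *\<^sub>R (kap + 2 *\<^sub>R e)"
  have e: "lor e e = -1" "lor kap e = 1" "lor e kap = 1"
    using assms(3) lor_sym[of e kap] by (auto simp: line_def)
  have "lor kap w = 0"
    using e lor_sym[of kap v] by (simp add: w_def lor_simps lor_kap_kap k_def)
  then have "lor w w \<le> 0" by (rule lor_kap_orth_nonpos)
  moreover have "lor w w = 32 - 8 * k * (k + 2 * c) + 2 * (k * k)"
    using e assms(1) lor_sym[of kap v] lor_sym[of e v]
    by (simp add: w_def lor_simps lor_kap_kap k_def c_def algebra_simps)
  moreover have "k * (k + 2 * c) \<le> 0"
    using neg assms(2) by (intro mult_nonneg_nonpos) (auto simp: k_def c_def)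
  ultimately show False using zero_le_square[of k] by (simp add: algebra_simps)
qed

lemma line_enumeration:
  obtains V :: "nat set" and e where "right_angled_roots lor V e kap" "e ` V = {v. line v}"
proof -
  obtain e where e: "bij_betw e {0..<card {v. line v}} {v. line v}"
    using ex_bij_betw_nat_finite[OF finite_lines] by blast
  have l: "line (e i)" if "i \<in> {0..<card {v. line v}}" for i
    using e that by (auto dest: bij_betwE)
  have "right_angled_roots lor {0..<card {v. line v}} e kap"
  proof
    fix i j assume ij: "i \<in> {0..<card {v. line v}}" "j \<in> {0..<card {v. line v}}" "i \<noteq> j"
    then have "e i \<noteq> e j" using e by (auto simp: bij_betw_def inj_on_def)
    then show "lor (e i) (e j) = 0 \<or> lor (e i) (e j) \<ge> 1"
      using line_pair l ij by blast
  qed (use l in \<open>auto simp: line_def bilinear_lor lor_sym\<close>)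
  then show thesis using that e by (auto simp: bij_betw_def)
qed

theorem level2_isometry_reflections:
  assumes roots: "right_angled_roots lor V e kap" "e ` V = {v. line v}" and "level2_isometry g"
  shows "\<exists>w\<in>group_words V. g = right_angled_roots.act lor e w"
  using assms(3)
proof (induction "nat \<lfloor>lor (g kap) kap\<rfloor>" arbitrary: g rule: less_induct)
  case less
  interpret R: right_angled_roots lor V e kap by fact
  interpret g: linear g using less.prems by (simp add: level2_isometry_def)
  have iso: "lor (g v) (g w) = lor v w" for v w
    using less.prems by (simp add: level2_isometry_def)
  have mod2: "\<exists>w. integral_vec w \<and> g v = v + 2 *\<^sub>R w" if "integral_vec v" for v
    using less.prems that by (simp add: level2_isometry_def)
  have gpos: "lor (g kap) kap > 0" using less.prems by (simp add: level2_isometry_def)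
  have gkap: "lor (g kap) (g kap) = 2" by (simp add: iso lor_kap_kap)
  obtain u where u: "integral_vec u" "g kap = kap + 2 *\<^sub>R u"
    using mod2[OF integral_kap] by blast
  show ?case
  proof (cases "\<exists>i\<in>V. lor (g kap) (e i) < 0")
    case True
    then obtain i where i: "i \<in> V" "lor (g kap) (e i) < 0" by blast
    have l: "line (e i)" using i roots(2) by blast
    then have ei: "integral_vec (e i)" "lor (e i) kap = 1"
      using lor_sym[of "e i" kap] by (auto simp: line_def)
    define g' where "g' = R.reflect i \<circ> g"
    have "linear g'"
      by (intro linearI) (simp_all add: g'_def R.reflect_def g.add g.scale lor_simps
          scaleR_left_distrib scaleR_right_distrib)
    moreover have "lor (g' v) (g' w) = lor v w" for v w
      by (simp add: g'_def R.reflect_isometry[OF i(1)] iso)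
    moreover have "\<exists>w. integral_vec w \<and> g' v = v + 2 *\<^sub>R w" if v: "integral_vec v" for v
    proof -
      obtain w where w: "integral_vec w" "g v = v + 2 *\<^sub>R w" using mod2[OF v] by blast
      have "integral_vec (g v)" unfolding w(2) using v w(1)
        by (intro integral_vec_add integral_vec_scaleR) auto
      then have "integral_vec (w + lor (g v) (e i) *\<^sub>R e i)"
        using w ei by (intro integral_vec_add integral_vec_scaleR lor_Ints)
      moreover have "g' v = v + 2 *\<^sub>R (w + lor (g v) (e i) *\<^sub>R e i)"
        by (simp add: g'_def R.reflect_def w(2) scaleR_add_right)
      ultimately show ?thesis by blast
    qed
    moreover have g'kap: "lor (g' kap) kap = lor (g kap) kap + 2 * lor (g kap) (e i)"
      by (simp add: g'_def R.reflect_def lor_simps ei)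
    moreover have "\<dots> > 0" by (rule kap_root_reflection_pos[OF gkap gpos l])
    ultimately have g': "level2_isometry g'" by (simp add: level2_isometry_def)
    have ints: "lor (g kap) kap \<in> \<int>" "lor (g kap) (e i) \<in> \<int>"
      using u ei integral_kap by (auto intro!: lor_Ints integral_vec_add integral_vec_scaleR)
    have "nat \<lfloor>lor (g' kap) kap\<rfloor> < nat \<lfloor>lor (g kap) kap\<rfloor>"
      using ints i(2) gpos unfolding g'kap by (auto elim!: Ints_cases)
    then obtain w where w: "w \<in> group_words V" "g' = R.act w" using less.hyps g' by blast
    have "g = R.act ((i, True) # w)"
      using R.reflect_involution[OF i(1)] by (auto simp: fun_eq_iff w(2)[symmetric] g'_def)
    moreover have "(i, True) # w \<in> group_words V" using w i by simp
    ultimately show ?thesis by blast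
  next
    case False
    then have pos: "lor (g kap) l \<ge> 0" if "line l" for l
      using that roots(2) by (auto simp: not_less set_eq_iff image_iff) metis
    \<comment> \<open>The pairing of \<open>g kap\<close> with a line is the odd integer 1 + 2 (u .
      l), so being nonnegative it is at least 1.\<close>
    have u0: "lor u l \<ge> 0" if l: "line l" for l
    proof -
      have "lor u l \<in> \<int>" using u(1) l by (auto simp: line_def intro: lor_Ints)
      moreover have "1 + 2 * lor u l \<ge> 0"
        using pos[OF l] l by (simp add: u lor_simps line_def)
      ultimately show ?thesis by (auto elim!: Ints_cases)
    qed
    then have "nef u" using u by (simp add: nef_def)
    then have "lor u u \<ge> 0" by (rule nef_norm_nonneg)
    \<comment> \<open>\<open>kap\<close> is the sum of a line and its conjugate.\<close>
    moreover have "lor u kap \<ge> 0"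
      using u0[OF line_exceptional[of 0]] u0[OF line_conjugate[OF line_exceptional[of 0]]]
      by (simp add: lor_simps)
    moreover have "2 + 4 * lor u kap + 4 * lor u u = 2"
      using gkap lor_sym[of kap u] by (simp add: u lor_simps lor_kap_kap)
    ultimately have "lor u u = 0" "lor kap u = 0" using lor_sym[of kap u] by linarith+
    then have "g kap = kap" using lor_kap_orth_zero u by simp
    then have "g = id" by (rule level2_isometry_fixing_kap[OF less.prems])
    then have "g = R.act []" by (simp add: fun_eq_iff)
    then show ?thesis by (metis R.group_words_simps(1))
  qed
qed

section \<open>Lagrange's four squares theorem\<close>

definition sum_of_four_squares :: "int \<Rightarrow> bool" where
  "sum_of_four_squares n \<longleftrightarrow> (\<exists>a b c d. n = a\<^sup>2 + b\<^sup>2 + c\<^sup>2 + d\<^sup>2)"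

text \<open>Multiplicativity of the quaternion norm, one factor being conjugated. With these signs
  the last three squares vanish when (x, y, z, w) = (a, b, c, d); the descent uses this modulo
  m.\<close>

lemma euler_four_squares:
  fixes a b c d x y z w :: "'a::comm_ring_1"
  shows "(a\<^sup>2 + b\<^sup>2 + c\<^sup>2 + d\<^sup>2) * (x\<^sup>2 + y\<^sup>2 + z\<^sup>2 + w\<^sup>2)
    = (a * x + b * y + c * z + d * w)\<^sup>2 + (a * y - b * x + c * w - d * z)\<^sup>2
      + (a * z - c * x + d * y - b * w)\<^sup>2 + (a * w - d * x + b * z - c * y)\<^sup>2"
  by (simp add: power2_eq_square algebra_simps)

lemma sum_of_four_squares_mult:
  "sum_of_four_squares m \<Longrightarrow> sum_of_four_squares n \<Longrightarrow> sum_of_four_squares (m * n)"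
  unfolding sum_of_four_squares_def using euler_four_squares by blast

text \<open>The four terms can be paired so that each pair has an even sum. With a + b = 2 s, half
  of the sum of the squares of a and b is the sum of the squares of s and s - b.\<close>

lemma sum_of_four_squares_half:
  assumes "sum_of_four_squares (2 * n)" shows "sum_of_four_squares n"
proof -
  have pair: "sum_of_four_squares n"
    if eq: "2 * n = a\<^sup>2 + b\<^sup>2 + c\<^sup>2 + d\<^sup>2" and ev: "even (a + b)" "even (c + d)" for a b c d
  proof -
    obtain s t where s: "a + b = 2 * s" "c + d = 2 * t" using ev by (meson dvdE)
    have a: "a = 2 * s - b" "c = 2 * t - d" using s by auto
    have "n = s\<^sup>2 + (s - b)\<^sup>2 + t\<^sup>2 + (t - d)\<^sup>2"
      using eq unfolding a by (simp add: power2_eq_square algebra_simps)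
    then show ?thesis unfolding sum_of_four_squares_def by blast
  qed
  obtain a b c d where eq: "2 * n = a\<^sup>2 + b\<^sup>2 + c\<^sup>2 + d\<^sup>2"
    using assms unfolding sum_of_four_squares_def by blast
  have "even (a\<^sup>2 + b\<^sup>2 + c\<^sup>2 + d\<^sup>2)" unfolding eq[symmetric] by simp
  then have "even (a + b + c + d)" by simp
  then consider "even (a + b)" "even (c + d)" | "even (a + c)" "even (b + d)"
    | "even (a + d)" "even (b + c)" by auto
  then show ?thesis
    by cases (rule pair[of a b c d] pair[of a c b d] pair[of a d b c]; use eq in simp)+
qed

text \<open>Oddness makes the bound strict, which is what yields r < m in the descent; an even m is
  halved there instead.\<close>

lemma symmetric_residue:
  fixes x m :: int
  assumes "odd m" "m > 0"
  obtains y t where "x = y + m * t" "2 * \<bar>y\<bar> < m"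
proof (cases "2 * (x mod m) < m")
  case True
  then show ?thesis using that[of "x mod m" "x div m"] assms by simp
next
  case False
  have "x = (x mod m - m) + m * (x div m + 1)" by (simp add: algebra_simps)
  moreover have "2 * (x mod m) \<noteq> m" using assms(1) by (metis dvd_triv_left)
  moreover have "x mod m < m" using assms(2) by simp
  ultimately show ?thesis using that[of "x mod m - m" "x div m + 1"] False by simp
qed

lemma four_squares_descent:
  fixes m p :: int
  assumes p: "prime p" and m: "1 < m" "m < p" and mp: "sum_of_four_squares (m * p)"
  shows "\<exists>r. 0 < r \<and> r < m \<and> sum_of_four_squares (r * p)"
proof (cases "even m")
  case True
  then obtain k where k: "m = 2 * k" by blast
  then have "sum_of_four_squares (k * p)"
    using mp sum_of_four_squares_half[of "k * p"] by (simp add: mult.assoc)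
  then show ?thesis using k m by (intro exI[of _ k]) auto
next
  case False
  obtain a b c d where eq: "m * p = a\<^sup>2 + b\<^sup>2 + c\<^sup>2 + d\<^sup>2"
    using mp unfolding sum_of_four_squares_def by blast
  have m0: "m > 0" using m by simp
  obtain x t1 where x: "a = x + m * t1" "2 * \<bar>x\<bar> < m" using symmetric_residue[OF False m0] .
  obtain y t2 where y: "b = y + m * t2" "2 * \<bar>y\<bar> < m" using symmetric_residue[OF False m0] .
  obtain z t3 where z: "c = z + m * t3" "2 * \<bar>z\<bar> < m" using symmetric_residue[OF False m0] .
  obtain w t4 where w: "d = w + m * t4" "2 * \<bar>w\<bar> < m" using symmetric_residue[OF False m0] .
  \<comment> \<open>The quotient by m of the sum of the squares of the residues, read off from the
    expansion of \<open>m * p\<close> with a = x + m * t1 and so on.\<close>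
  define r where "r = p - 2 * (x * t1 + y * t2 + z * t3 + w * t4) - m * (t1\<^sup>2 + t2\<^sup>2 + t3\<^sup>2 + t4\<^sup>2)"
  have r: "x\<^sup>2 + y\<^sup>2 + z\<^sup>2 + w\<^sup>2 = m * r"
    using eq unfolding x(1) y(1) z(1) w(1) r_def
    by (simp add: power2_eq_square algebra_simps)
  have sq: "4 * u\<^sup>2 < m\<^sup>2" if "2 * \<bar>u\<bar> < m" for u :: int
    using power_strict_mono[OF that, of 2] by (simp add: power_mult_distrib)
  have "4 * (m * r) < 4 * (m * m)"
    using sq[OF x(2)] sq[OF y(2)] sq[OF z(2)] sq[OF w(2)] unfolding r[symmetric]
    by (simp add: power2_eq_square)
  then have "r < m" using m0 by simp
  have "m * r \<ge> 0" unfolding r[symmetric] by simp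
  then have "r \<ge> 0" using m0 by (simp add: zero_le_mult_iff)
  have "r \<noteq> 0"
  proof
    assume "r = 0"
    then have "x\<^sup>2 + y\<^sup>2 + z\<^sup>2 + w\<^sup>2 = 0" using r by simp
    then have "x = 0" "y = 0" "z = 0" "w = 0"
      by (smt (verit) zero_le_power2 zero_eq_power2)+
    then have "p = m * (t1\<^sup>2 + t2\<^sup>2 + t3\<^sup>2 + t4\<^sup>2)"
      using \<open>r = 0\<close> by (simp add: r_def)
    then have "m dvd p" by simp
    then have "m = 1 \<or> m = p" using p m0 prime_int_iff less_imp_le by metis
    then show False using m by simp
  qed
  moreover have "sum_of_four_squares (r * p)"
  proof -
    \<comment> \<open>\<open>s1\<close> to \<open>s4\<close> are the four terms of Euler's identity
      divided by m.\<close>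
    define s1 where "s1 = p - (a * t1 + b * t2 + c * t3 + d * t4)"
    define s2 where "s2 = b * t1 - a * t2 + d * t3 - c * t4"
    define s3 where "s3 = c * t1 - a * t3 + b * t4 - d * t2"
    define s4 where "s4 = d * t1 - a * t4 + c * t2 - b * t3"
    have xs: "x = a - m * t1" "y = b - m * t2" "z = c - m * t3" "w = d - m * t4"
      using x y z w by auto
    have z1: "a * x + b * y + c * z + d * w = m * s1"
      unfolding xs s1_def right_diff_distrib[of m] eq by (simp add: power2_eq_square algebra_simps)
    have z2: "a * y - b * x + c * w - d * z = m * s2"
      "a * z - c * x + d * y - b * w = m * s3" "a * w - d * x + b * z - c * y = m * s4"
      unfolding xs s2_def s3_def s4_def by (simp_all add: algebra_simps)
    have "(m * p) * (m * r) = (m * s1)\<^sup>2 + (m * s2)\<^sup>2 + (m * s3)\<^sup>2 + (m * s4)\<^sup>2"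
      unfolding eq r[symmetric] euler_four_squares z1 z2 ..
    then have "(m * m) * (r * p) = (m * m) * (s1\<^sup>2 + s2\<^sup>2 + s3\<^sup>2 + s4\<^sup>2)"
      by (simp add: power2_eq_square algebra_simps)
    then have "r * p = s1\<^sup>2 + s2\<^sup>2 + s3\<^sup>2 + s4\<^sup>2" using m0 by simp
    then show ?thesis unfolding sum_of_four_squares_def by blast
  qed
  ultimately show ?thesis using \<open>r < m\<close> \<open>r \<ge> 0\<close> by (intro exI[of _ r]) auto
qed

text \<open>Pigeonhole: with p = 2 k + 1, the values of x * x and of -1 - y * y for x, y in {0..k}
  give k + 1 residues each, and 2 k + 2 > p.\<close>

lemma sum_two_squares_plus_one_dvd:
  fixes p :: int
  assumes p: "prime p" "odd p"
  obtains x y where "p dvd x\<^sup>2 + y\<^sup>2 + 1" "0 \<le> x" "2 * x < p" "0 \<le> y" "2 * y < p"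
proof -
  obtain k where k: "p = 2 * k + 1" using p(2) by (auto elim: oddE)
  have p1: "p > 1" using p(1) prime_gt_1_int by blast
  define I where "I = {0..k}"
  have inj0: "x = y" if "x \<in> I" "y \<in> I" "p dvd x\<^sup>2 - y\<^sup>2" for x y
  proof -
    have "p dvd (x - y) * (x + y)" using that(3) by (simp add: power2_eq_square algebra_simps)
    then consider "p dvd x - y" | "p dvd x + y" using p(1) prime_dvd_mult_iff by blast
    then show ?thesis
    proof cases
      case 1
      moreover have "\<bar>x - y\<bar> < p" using that k by (auto simp: I_def)
      ultimately have "x - y = 0" using dvd_imp_le_int[of "x - y" p] p1 by linarith
      then show ?thesis by simp
    next
      case 2
      moreover have "\<bar>x + y\<bar> < p" using that k by (auto simp: I_def)
      ultimately have "x + y = 0" using dvd_imp_le_int[of "x + y" p] p1 by linarith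
      then show ?thesis using that by (auto simp: I_def)
    qed
  qed
  define f where "f x = x\<^sup>2 mod p" for x
  define g where "g y = (- 1 - y\<^sup>2) mod p" for y
  have "inj_on f I"
    using inj0 by (auto simp: inj_on_def f_def mod_eq_dvd_iff)
  moreover have "inj_on g I"
  proof (rule inj_onI)
    fix x y assume "x \<in> I" "y \<in> I" "g x = g y"
    then have "p dvd y\<^sup>2 - x\<^sup>2" by (simp add: g_def mod_eq_dvd_iff)
    then show "x = y" using inj0 \<open>x \<in> I\<close> \<open>y \<in> I\<close> by metis
  qed
  ultimately have c: "card (f ` I) = nat (k + 1)" "card (g ` I) = nat (k + 1)"
    by (simp_all add: card_image I_def)
  have "f ` I \<inter> g ` I \<noteq> {}"
  proof
    assume "f ` I \<inter> g ` I = {}"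
    then have "card (f ` I \<union> g ` I) = nat (k + 1) + nat (k + 1)"
      by (subst card_Un_disjoint) (simp_all add: c, simp_all add: I_def)
    moreover have "card (f ` I \<union> g ` I) \<le> card {0..<p}"
      using p1 by (intro card_mono) (auto simp: f_def g_def)
    ultimately show False using k p1 by simp
  qed
  then obtain x y where xy: "x \<in> I" "y \<in> I" "f x = g y" by auto
  then have "p dvd x\<^sup>2 + y\<^sup>2 + 1"
    by (simp add: f_def g_def mod_eq_dvd_iff algebra_simps)
  then show thesis using that[of x y] xy k by (auto simp: I_def)
qed

lemma sum_of_four_squares_prime:
  fixes p :: int
  assumes "prime p" shows "sum_of_four_squares p"
proof (cases "odd p")
  case False
  then have "p = 1\<^sup>2 + 1\<^sup>2 + 0\<^sup>2 + 0\<^sup>2" using assms primes_dvd_imp_eq[of 2 p] by simp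
  then show ?thesis unfolding sum_of_four_squares_def by blast
next
  case True
  obtain x y where xy: "p dvd x\<^sup>2 + y\<^sup>2 + 1" "0 \<le> x" "2 * x < p" "0 \<le> y" "2 * y < p"
    using sum_two_squares_plus_one_dvd[OF assms True] .
  then obtain m where m: "x\<^sup>2 + y\<^sup>2 + 1 = p * m" by blast
  have p1: "p > 1" using assms prime_gt_1_int by blast
  have "(2 * x)\<^sup>2 \<le> (p - 1)\<^sup>2" "(2 * y)\<^sup>2 \<le> (p - 1)\<^sup>2"
    using xy by (intro power_mono; simp)+
  then have "4 * (p * m) \<le> 2 * (p - 1)\<^sup>2 + 4"
    unfolding m[symmetric] by (simp add: power_mult_distrib)
  also have "\<dots> < 4 * (p * p)"
  proof -
    have "1 * 1 < p * p" using p1 by (intro mult_strict_mono) auto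
    then show ?thesis using p1 by (simp add: power2_eq_square algebra_simps)
  qed
  finally have mp: "m < p" using p1 by simp
  have "p * m > 0" unfolding m[symmetric] by (smt (verit) zero_le_power2)
  then have m0: "m > 0" using p1 by (simp add: zero_less_mult_iff)
  have "m * p = x\<^sup>2 + y\<^sup>2 + 1\<^sup>2 + 0\<^sup>2" using m by (simp add: mult.commute)
  then have "sum_of_four_squares (m * p)" unfolding sum_of_four_squares_def by blast
  then show ?thesis using m0 mp
  proof (induction "nat m" arbitrary: m rule: less_induct)
    case less
    show ?case
    proof (cases "m = 1")
      case False
      then have "1 < m" using less.prems by simp
      then obtain r where "0 < r" "r < m" "sum_of_four_squares (r * p)"
        using four_squares_descent[OF assms _ less.prems(3,1)] by blast
      then show ?thesis using less.hyps[of r] less.prems by simp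
    qed (use less.prems in simp)
  qed
qed

theorem four_squares: "sum_of_four_squares (int n)"
proof (induction n rule: less_induct)
  case (less n)
  consider "n = 0" | "n = 1" | "n > 1" by linarith
  then show ?case
  proof cases
    case 1
    then have "int n = 0\<^sup>2 + 0\<^sup>2 + 0\<^sup>2 + 0\<^sup>2" by simp
    then show ?thesis unfolding sum_of_four_squares_def by blast
  next
    case 2
    then have "int n = 1\<^sup>2 + 0\<^sup>2 + 0\<^sup>2 + 0\<^sup>2" by simp
    then show ?thesis unfolding sum_of_four_squares_def by blast
  next
    case 3
    then obtain p where p: "prime p" "p dvd n" using prime_factor_nat[of n] by auto
    then obtain k where k: "n = p * k" by blast
    have "p > 1" using p(1) prime_gt_1_nat by blast
    then have "k < n" using k 3 by (cases "k = 0") auto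
    then have "sum_of_four_squares (int k)" by (rule less)
    moreover have "sum_of_four_squares (int p)" using p(1) by (simp add: sum_of_four_squares_prime)
    ultimately show ?thesis using sum_of_four_squares_mult by (simp add: k)
  qed
qed

section \<open>The action on Hermitian matrices\<close>

definition adj :: "complex^2^2 \<Rightarrow> complex^2^2" where
  "adj A = (\<chi> i j. cnj (A $ j $ i))"

definition hermat :: "real \<times> real \<times> complex \<Rightarrow> complex^2^2" where
  "hermat H = (\<chi> i j. if i = j then of_real (if i = 1 then fst H else fst (snd H))
     else if i = 1 then snd (snd H) else cnj (snd (snd H)))"

definition unherm :: "complex^2^2 \<Rightarrow> real \<times> real \<times> complex" where
  "unherm N = (Re (N $ 1 $ 1), Re (N $ 2 $ 2), N $ 1 $ 2)"

lemma hermat_unherm: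
  assumes "adj N = N" shows "hermat (unherm N) = N"
proof -
  have c: "cnj (N $ j $ i) = N $ i $ j" for i j
    using arg_cong[OF assms, of "\<lambda>M. M $ i $ j"] by (simp add: adj_def)
  have "Im (N $ i $ i) = 0" for i using arg_cong[OF c[of i i], of Im] by simp
  then show ?thesis
    using c[of 1 2] by (simp add: vec_eq_iff forall_2 hermat_def unherm_def complex_eq_iff)
qed

lemma adj_hermat: "adj (hermat H) = hermat H"
  by (simp add: vec_eq_iff forall_2 adj_def hermat_def)

lemma adj_adj [simp]: "adj (adj A) = A"
  by (simp add: vec_eq_iff adj_def)

lemma adj_mult: "adj (A ** B) = adj B ** adj A"
  by (simp add: vec_eq_iff adj_def matrix_matrix_mult_def mult.commute)

lemma det_adj: "det (adj A) = cnj (det A)"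
  by (simp add: det_2 adj_def mult.commute)

definition herm_act :: "complex^2^2 \<Rightarrow> real \<times> real \<times> complex \<Rightarrow> real \<times> real \<times> complex" where
  "herm_act A H = unherm (A ** hermat H ** adj A)"

lemma hermat_herm_act: "hermat (herm_act A H) = A ** hermat H ** adj A"
  unfolding herm_act_def
  by (rule hermat_unherm) (simp add: adj_mult adj_hermat matrix_mul_assoc)

lemma herm_act_mult: "herm_act (A ** B) H = herm_act A (herm_act B H)"
  unfolding herm_act_def[of "A ** B" H] herm_act_def[of A "herm_act B H"] hermat_herm_act adj_mult
  by (simp only: matrix_mul_assoc)

lemma herm_act_eq:
  "herm_act A (a, d, z) =
    (Re (A$1$1 * a * cnj (A$1$1) + A$1$1 * z * cnj (A$1$2)
       + A$1$2 * cnj z * cnj (A$1$1) + A$1$2 * d * cnj (A$1$2)),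
     Re (A$2$1 * a * cnj (A$2$1) + A$2$1 * z * cnj (A$2$2)
       + A$2$2 * cnj z * cnj (A$2$1) + A$2$2 * d * cnj (A$2$2)),
     A$1$1 * a * cnj (A$2$1) + A$1$1 * z * cnj (A$2$2)
       + A$1$2 * cnj z * cnj (A$2$1) + A$1$2 * d * cnj (A$2$2))"
  by (simp add: herm_act_def unherm_def hermat_def adj_def matrix_matrix_mult_def sum_2 algebra_simps)

lemma herm_act_uminus: "herm_act (- A) H = herm_act A H"
  by (cases H) (simp add: herm_act_eq)

lemma herm_act_one [simp]: "herm_act (mat 1) H = H"
  by (cases H) (simp add: herm_act_eq mat_def)

lemma herm_act_add: "herm_act A (H + K) = herm_act A H + herm_act A K"
  by (cases H; cases K) (simp add: herm_act_eq algebra_simps)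

lemma herm_act_scaleR: "herm_act A (c *\<^sub>R H) = c *\<^sub>R herm_act A H"
  by (cases H) (simp add: herm_act_eq scaleR_conv_of_real algebra_simps)

text \<open>The polarisation of twice the determinant, see \<open>hpair_self\<close>.\<close>

definition hpair :: "real \<times> real \<times> complex \<Rightarrow> real \<times> real \<times> complex \<Rightarrow> real" where
  "hpair H K = fst H * fst (snd K) + fst K * fst (snd H) - 2 * (snd (snd H) \<bullet> snd (snd K))"

lemma hpair_self: "of_real (hpair H H) = 2 * det (hermat H)"
  by (simp add: hpair_def det_2 hermat_def complex_eq_iff inner_complex_def algebra_simps)

lemma hpair_herm_act:
  assumes "det A = 1" shows "hpair (herm_act A H) (herm_act A H) = hpair H H"
proof -
  have "complex_of_real (hpair (herm_act A H) (herm_act A H)) = of_real (hpair H H)"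
    using assms by (simp add: hpair_self hermat_herm_act det_mul det_adj)
  then show ?thesis by (simp only: of_real_eq_iff)
qed

text \<open>The two diagonal idempotents force A to be diagonal, and the off-diagonal test vector
  together with the determinant makes its two entries equal with product 1.\<close>

lemma herm_act_trivial:
  assumes "det A = 1" "\<And>H. herm_act A H = H"
  shows "A = mat 1 \<or> A = - mat 1"
proof -
  have 1: "A$1$1 * cnj (A$1$1) = 1" "A$2$1 = 0"
    using assms(2)[of "(1, 0, 0)"] by (auto simp: herm_act_eq complex_eq_iff)
  have 2: "A$1$2 = 0"
    using assms(2)[of "(0, 1, 0)"] by (auto simp: herm_act_eq complex_eq_iff)
  have 3: "A$1$1 * cnj (A$2$2) = 1"
    using assms(2)[of "(0, 0, 1)"] 1 2 by (auto simp: herm_act_eq)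
  have 4: "A$1$1 * A$2$2 = 1" using assms(1) 1 2 by (simp add: det_2)
  have p0: "A$1$1 \<noteq> 0" using 4 by auto
  have "A$1$1 * cnj (A$1$1) = A$1$1 * cnj (A$2$2)" using 1 3 by simp
  then have "A$1$1 = A$2$2" using p0 by simp
  then have "A$1$1 * A$1$1 = 1" using 4 by simp
  then have "A$1$1 = 1 \<or> A$1$1 = -1" by (simp add: square_eq_1_iff)
  then show ?thesis using 1 2 \<open>A$1$1 = A$2$2\<close>
    by (auto simp: vec_eq_iff forall_2 mat_def)
qed

text \<open>An element \<open>x + y \<surd>-m\<close> is sent to \<open>x u + y s\<close>, which multiplies \<open>|z|\<^sup>2\<close> by 2. The differences
  \<open>z - cnj z\<close> are the integer multiples of \<open>c \<surd>-m\<close>, with \<open>c = 1\<close> if \<open>m \<equiv> 3 (mod 4)\<close> and \<open>c = 2\<close>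
  otherwise. The last assumption describes the projections of integral vectors.\<close>

locale bianchi_lattice =
  fixes m :: nat and u s :: "real^6" and c :: int
  assumes m_pos: "m > 0" and c_pos: "c > 0"
    and u_u: "u \<bullet> u = 2" and u_s: "u \<bullet> s = 0" and s_s: "s \<bullet> s = 2 * m"
    and Om_embed: "z \<in> carrier (Om m) \<Longrightarrow> (Re z *\<^sub>R u + (Im z / sqrt m) *\<^sub>R s) $ i \<in> \<int>"
    and Om_diff_cnj: "z \<in> carrier (Om m) \<Longrightarrow> \<exists>y. z - cnj z = of_int (c * y) * (\<i> * sqrt m)"
    and Om_cnj: "z \<in> carrier (Om m) \<Longrightarrow> cnj z \<in> carrier (Om m)"
    and Om_real: "z \<in> carrier (Om m) \<Longrightarrow> Im z = 0 \<Longrightarrow> Re z \<in> \<int>"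
    and dual_vector: "(\<And>i. X $ i \<in> \<int>) \<Longrightarrow>
       \<exists>\<zeta>\<in>carrier (Om m). Complex (X \<bullet> u / 2) (X \<bullet> s / (2 * m) * sqrt m) = \<i> * sqrt m * \<zeta> / of_int (c * int m)"
begin

text \<open>The coefficients divide by the norms 2 and 2 m of u and s. The factor
  \<open>sqrt m\<close> appears because s represents the square root of -m.\<close>

definition proj :: "lorentz \<Rightarrow> real \<times> real \<times> complex" where
  "proj v = (fst v, fst (snd v),
     Complex (snd (snd v) \<bullet> u / 2) (snd (snd v) \<bullet> s / (2 * m) * sqrt m))"

definition incl :: "real \<times> real \<times> complex \<Rightarrow> lorentz" where
  "incl H = (fst H, fst (snd H), Re (snd (snd H)) *\<^sub>R u + (Im (snd (snd H)) / sqrt m) *\<^sub>R s)"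

lemma s_u: "s \<bullet> u = 0"
  using u_s by (simp add: inner_commute)

lemma proj_incl [simp]: "proj (incl H) = H"
  using m_pos by (simp add: proj_def incl_def inner_add_left u_u u_s s_u s_s complex_eq_iff prod_eq_iff)

lemma proj_add: "proj (v + w) = proj v + proj w"
  by (simp add: proj_def inner_add_left complex_eq_iff add_divide_distrib distrib_right)

lemma proj_scaleR: "proj (r *\<^sub>R v) = r *\<^sub>R proj v"
  by (simp add: proj_def complex_eq_iff)

lemma incl_add: "incl (H + K) = incl H + incl K"
  by (simp add: incl_def algebra_simps add_divide_distrib)

lemma incl_scaleR: "incl (r *\<^sub>R H) = r *\<^sub>R incl H"
  by (simp add: incl_def algebra_simps)

lemma incl_diff: "incl (H - K) = incl H - incl K"
  by (simp add: incl_def algebra_simps diff_divide_distrib)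

text \<open>\<open>incl\<close> and \<open>proj\<close> are adjoint. With \<open>proj_incl\<close>
  this makes \<open>incl\<close> an isometry.\<close>

lemma lor_incl: "lor v (incl H) = hpair (proj v) H"
proof -
  have "sqrt m * sqrt m = m" "sqrt m \<noteq> 0" using m_pos by auto
  then show ?thesis
    by (simp add: lor_def incl_def proj_def hpair_def inner_add_right inner_complex_def field_simps)
qed

text \<open>\<^term>\<open>incl (proj v)\<close> is the orthogonal projection of \<open>v\<close> to the space of Hermitian matrices, so this is
  the identity on the orthogonal complement of that space.\<close>

definition ext_act :: "complex^2^2 \<Rightarrow> lorentz \<Rightarrow> lorentz" where
  "ext_act A v = v + incl (herm_act A (proj v) - proj v)"

lemma proj_ext_act: "proj (ext_act A v) = herm_act A (proj v)"
  by (simp add: ext_act_def proj_add)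

lemma ext_act_mult: "ext_act (A ** B) = ext_act A \<circ> ext_act B"
proof
  fix v
  have "ext_act A (ext_act B v) = ext_act B v + incl (herm_act A (herm_act B (proj v)) - herm_act B (proj v))"
    by (simp add: ext_act_def[of A] proj_ext_act)
  then show "ext_act (A ** B) v = (ext_act A \<circ> ext_act B) v"
    by (simp add: ext_act_def[of B] ext_act_def[of "A ** B"] herm_act_mult incl_diff)
qed

lemma ext_act_uminus: "ext_act (- A) = ext_act A"
  by (simp add: ext_act_def herm_act_uminus fun_eq_iff)

lemma ext_act_one: "ext_act (mat 1) = id"
  using incl_diff[of 0 0] by (simp add: ext_act_def fun_eq_iff)

lemma ext_act_trivial:
  assumes "det A = 1" "ext_act A = id" shows "A = mat 1 \<or> A = - mat 1"
proof (rule herm_act_trivial)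
  show "herm_act A H = H" for H
    using proj_ext_act[of A "incl H"] assms(2) by simp
qed (rule assms)

lemma linear_ext_act: "linear (ext_act A)"
  by (rule linearI)
    (simp_all add: ext_act_def proj_add proj_scaleR herm_act_add herm_act_scaleR incl_diff
      incl_add incl_scaleR scaleR_right_distrib scaleR_right_diff_distrib)

lemma ext_act_isometry:
  assumes "det A = 1" shows "lor (ext_act A v) (ext_act A w) = lor v w"
proof -
  have q: "lor (ext_act A v) (ext_act A v) = lor v v" for v
  proof -
    define D where "D = herm_act A (proj v) - proj v"
    have "lor v (incl D) = hpair (proj v) D" "lor (incl D) (incl D) = hpair D D"
      by (simp_all add: lor_incl)
    then have "lor (ext_act A v) (ext_act A v) = lor v v + 2 * hpair (proj v) D + hpair D D"
      using lor_sym[of "incl D" v] by (simp add: ext_act_def D_def[symmetric] lor_simps)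
    also have "\<dots> = lor v v - hpair (proj v) (proj v) + hpair (proj v + D) (proj v + D)"
      by (simp add: hpair_def algebra_simps inner_add_left inner_add_right inner_commute)
    also have "\<dots> = lor v v" using hpair_herm_act[OF assms] by (simp add: D_def)
    finally show ?thesis .
  qed
  have "lor (ext_act A (v + w)) (ext_act A (v + w)) = lor (v + w) (v + w)" by (rule q)
  then show ?thesis
    using q[of v] q[of w] lor_sym[of w v] lor_sym[of "ext_act A w" "ext_act A v"]
    by (simp add: linear_add[OF linear_ext_act] lor_simps)
qed

text \<open>\<open>kap\<close> projects to a Hermitian matrix with diagonal (2, 2) and off-diagonal
  z with |z|^2 \<le> 3 < 4. It is positive definite, so its transform has positive diagonal, and a
  vector of positive norm with positive a and d pairs positively with \<open>kap\<close>.\<close>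

lemma ext_act_kap_pos:
  assumes "det A = 1" shows "lor (ext_act A kap) kap > 0"
proof -
  define X :: "real^6" where "X = (\<chi> i. 1)"
  define z where "z = snd (snd (proj kap))"
  have pk: "proj kap = (2, 2, z)" by (simp add: z_def proj_def kap_def)
  have z3: "(cmod z)\<^sup>2 \<le> 3"
  proof -
    define Y where "Y = X - (X \<bullet> u / 2) *\<^sub>R u - (X \<bullet> s / (2 * m)) *\<^sub>R s"
    have z: "z = Complex (X \<bullet> u / 2) (X \<bullet> s / (2 * m) * sqrt m)"
      by (simp add: z_def proj_def kap_def X_def)
    have "Y \<bullet> Y = X \<bullet> X - 2 * (cmod z)\<^sup>2"
      using m_pos inner_commute[of u X] inner_commute[of s X]
      unfolding Y_def z cmod_power2
      by (simp add: inner_diff_left inner_diff_right inner_add_left inner_add_right u_u u_s s_u s_s power_mult_distrib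
          power2_eq_square field_simps)
    moreover have "X \<bullet> X = 6" by (simp add: X_def inner_ones)
    ultimately show ?thesis using inner_ge_zero[of Y] by linarith
  qed
  have form: "Re (p * 2 * cnj p + p * z * cnj q + q * cnj z * cnj p + q * 2 * cnj q) > 0"
    if "p \<noteq> 0 \<or> q \<noteq> 0" for p q
  proof -
    have "Re (p * 2 * cnj p + p * z * cnj q + q * cnj z * cnj p + q * 2 * cnj q)
        = 2 * (cmod p)\<^sup>2 + 2 * Re (p * z * cnj q) + 2 * (cmod q)\<^sup>2"
      unfolding cmod_power2 by (simp add: power2_eq_square algebra_simps)
    moreover have "\<bar>Re (p * z * cnj q)\<bar> \<le> cmod p * cmod z * cmod q"
      using abs_Re_le_cmod[of "p * z * cnj q"] by (simp add: norm_mult)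
    \<comment> \<open>7/4 is a rational number between the square root of 3 and 2.\<close>
    moreover have "cmod z \<le> 7 / 4"
    proof (rule power2_le_imp_le)
      have "(7 / 4 :: real)\<^sup>2 = 49 / 16" by (simp add: power_divide)
      then show "(cmod z)\<^sup>2 \<le> (7 / 4)\<^sup>2" using z3 by linarith
    qed simp
    then have "cmod p * cmod z * cmod q \<le> 7 / 4 * (cmod p * cmod q)"
      using mult_right_mono[of "cmod z" "7/4" "cmod p * cmod q"] by (simp add: mult_ac)
    moreover have "2 * (cmod p * cmod q) \<le> (cmod p)\<^sup>2 + (cmod q)\<^sup>2"
      using sum_squares_bound[of "cmod p" "cmod q"] by simp
    moreover have "(cmod p)\<^sup>2 + (cmod q)\<^sup>2 > 0"
      using that by (auto simp: add_pos_nonneg add_nonneg_pos)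
    ultimately show ?thesis by linarith
  qed
  obtain a d Y where g: "ext_act A kap = (a, d, Y)" by (cases "ext_act A kap")
  have "A$1$1 \<noteq> 0 \<or> A$1$2 \<noteq> 0" "A$2$1 \<noteq> 0 \<or> A$2$2 \<noteq> 0"
    using assms by (auto simp: det_2)
  moreover have "a = fst (herm_act A (2, 2, z))" "d = fst (snd (herm_act A (2, 2, z)))"
    unfolding pk[symmetric] proj_ext_act[symmetric] by (simp_all add: g proj_def)
  ultimately have a: "a > 0" "d > 0"
    using form[of "A$1$1" "A$1$2"] form[of "A$2$1" "A$2$2"] by (simp_all add: herm_act_eq)
  have "lor (ext_act A kap) (ext_act A kap) = 2"
    by (simp add: ext_act_isometry[OF assms] lor_kap_kap)
  then have Y: "Y \<bullet> Y = 2 * (a * d) - 2" by (simp add: g)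
  have "(X \<bullet> Y)\<^sup>2 \<le> (X \<bullet> X) * (Y \<bullet> Y)" by (rule Cauchy_Schwarz_ineq)
  also have "X \<bullet> X = 6" by (simp add: X_def inner_ones)
  also have "6 * (Y \<bullet> Y) < (2 * (a + d))\<^sup>2"
  proof -
    have "0 \<le> (a - d)\<^sup>2" "0 < a * d" using a by simp_all
    then show ?thesis unfolding Y by (simp add: power2_eq_square algebra_simps)
  qed
  finally have "X \<bullet> Y < 2 * (a + d)"
    using a by (intro power2_less_imp_less[of "X \<bullet> Y"]) auto
  moreover have "lor kap (a, d, Y) = 2 * a + 2 * d - X \<bullet> Y" by (simp add: kap_def X_def)
  ultimately show ?thesis by (simp add: g lor_sym[of "(a, d, Y)"])
qed

section \<open>Matrices of level 2 act trivially modulo 2\<close>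

definition level2_matrix :: "complex^2^2 \<Rightarrow> bool" where
  "level2_matrix A \<longleftrightarrow> det A = 1 \<and> (\<forall>i j. \<exists>b\<in>carrier (Om m). A $ i $ j - mat 1 $ i $ j = 2 * b)"

definition even_herm :: "real \<times> real \<times> complex \<Rightarrow> bool" where
  "even_herm H \<longleftrightarrow> fst H / 2 \<in> \<int> \<and> fst (snd H) / 2 \<in> \<int> \<and> snd (snd H) / 2 \<in> carrier (Om m)"

lemma of_int_in_Om: "of_int n \<in> carrier (Om m)"
  unfolding carrier_Om by (intro CollectI exI[of _ n] exI[of _ "0::int"]) simp

lemma even_herm_add: "even_herm H \<Longrightarrow> even_herm K \<Longrightarrow> even_herm (H + K)"
  by (auto simp: even_herm_def add_divide_distrib intro: add_in_Om)

lemma even_herm_scaleR: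
  assumes "r \<in> \<int>" "even_herm H" shows "even_herm (r *\<^sub>R H)"
proof -
  obtain n where n: "r = of_int n" using assms(1) Ints_cases by blast
  have "of_int n * (snd (snd H) / 2) \<in> carrier (Om m)"
    using assms(2) by (intro mult_in_Om of_int_in_Om) (simp add: even_herm_def)
  moreover have "r * (fst H / 2) \<in> \<int>" "r * (fst (snd H) / 2) \<in> \<int>"
    using assms unfolding even_herm_def by (blast intro: Ints_mult)+
  ultimately show ?thesis by (simp add: even_herm_def n scaleR_conv_of_real)
qed

lemma even_herm_incl:
  assumes "even_herm H" shows "\<exists>w. integral_vec w \<and> incl H = 2 *\<^sub>R w"
proof (intro exI conjI)
  have "incl (2 *\<^sub>R ((1/2) *\<^sub>R H)) = 2 *\<^sub>R incl ((1/2) *\<^sub>R H)" by (rule incl_scaleR)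
  then show "incl H = 2 *\<^sub>R incl ((1/2) *\<^sub>R H)" by simp
  show "integral_vec (incl ((1/2) *\<^sub>R H))"
    using assms Om_embed[of "snd (snd H) / 2"] by (simp add: incl_def even_herm_def)
qed

lemma herm_act_level2_diag:
  assumes "level2_matrix A" "(a, d) = (1, 0) \<or> (a, d) = (0, 1)"
  shows "even_herm (herm_act A (a, d, 0) - (a, d, 0))"
proof -
  obtain p q r t where A: "A$1$1 = 1 + 2 * p" "A$1$2 = 2 * q" "A$2$1 = 2 * r" "A$2$2 = 1 + 2 * t"
    and O: "p \<in> carrier (Om m)" "q \<in> carrier (Om m)" "r \<in> carrier (Om m)" "t \<in> carrier (Om m)"
    using assms(1) unfolding level2_matrix_def forall_2 by (auto simp: mat_def algebra_simps)
  have two: "2 \<in> carrier (Om m)" using of_int_in_Om[of 2] by simp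
  have norm: "Re ((1 + 2 * x) * cnj (1 + 2 * x) - 1) / 2 \<in> \<int>" if "x \<in> carrier (Om m)" for x
  proof -
    have "x + cnj x + 2 * (x * cnj x) \<in> carrier (Om m)"
      using that by (intro add_in_Om mult_in_Om two Om_cnj)
    then have "Re (x + cnj x + 2 * (x * cnj x)) \<in> \<int>" by (rule Om_real) simp
    moreover have "Re (x + cnj x + 2 * (x * cnj x)) = Re ((1 + 2 * x) * cnj (1 + 2 * x) - 1) / 2"
      by (simp add: algebra_simps add_divide_distrib)
    ultimately show ?thesis by (simp only:)
  qed
  have norm': "Re ((2 * x) * cnj (2 * x)) / 2 \<in> \<int>" if "x \<in> carrier (Om m)" for x
  proof -
    have "2 * (x * cnj x) \<in> carrier (Om m)"
      using that by (intro add_in_Om mult_in_Om two Om_cnj)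
    then have "Re (2 * (x * cnj x)) \<in> \<int>" by (rule Om_real) simp
    moreover have "Re (2 * (x * cnj x)) = Re ((2 * x) * cnj (2 * x)) / 2"
      by (simp add: algebra_simps add_divide_distrib)
    ultimately show ?thesis by (simp only:)
  qed
  from assms(2) show ?thesis
  proof
    assume ad: "(a, d) = (1, 0)"
    have "(1 + 2 * p) * cnj r \<in> carrier (Om m)"
      using O by (intro add_in_Om mult_in_Om two Om_cnj one_in_Om)
    then show ?thesis using norm[OF O(1)] norm'[OF O(3)] ad
      by (simp add: herm_act_eq A even_herm_def del: complex_cnj_add)
  next
    assume ad: "(a, d) = (0, 1)"
    have "q * cnj (1 + 2 * t) \<in> carrier (Om m)"
      using O by (intro add_in_Om mult_in_Om two Om_cnj one_in_Om)
    then show ?thesis using norm[OF O(4)] norm'[OF O(2)] ad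
      by (simp add: herm_act_eq A even_herm_def del: complex_cnj_add)
  qed
qed

text \<open>Here z = \<theta> \<zeta> / (c m) is only a dual vector. The denominator disappears
  because conjugation changes the sign of \<theta>: z enters through differences x - cnj x, which
  are integer multiples of c \<theta>, and \<theta> * \<theta> = -m.\<close>

lemma herm_act_level2_offdiag:
  assumes "level2_matrix A" "\<And>i. X $ i \<in> \<int>"
  shows "even_herm (herm_act A (proj (0, 0, X)) - proj (0, 0, X))"
proof -
  obtain p q r t where A: "A$1$1 = 1 + 2 * p" "A$1$2 = 2 * q" "A$2$1 = 2 * r" "A$2$2 = 1 + 2 * t"
    and O: "p \<in> carrier (Om m)" "q \<in> carrier (Om m)" "r \<in> carrier (Om m)" "t \<in> carrier (Om m)"
    using assms(1) unfolding level2_matrix_def forall_2 by (auto simp: mat_def algebra_simps)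
  have two: "2 \<in> carrier (Om m)" using of_int_in_Om[of 2] by simp
  define \<theta> where "\<theta> = \<i> * sqrt m"
  have th: "\<theta> * \<theta> = - of_nat m" "cnj \<theta> = - \<theta>"
    by (simp_all add: \<theta>_def mult.assoc[symmetric] flip: of_real_mult)
      (simp add: mult_ac flip: of_real_mult)
  obtain \<zeta> where \<zeta>: "\<zeta> \<in> carrier (Om m)"
    and z: "Complex (X \<bullet> u / 2) (X \<bullet> s / (2 * m) * sqrt m) = \<theta> * \<zeta> / of_int (c * int m)"
    using dual_vector[of X] assms(2) unfolding \<theta>_def by blast
  define z where "z = \<theta> * \<zeta> / of_int (c * int m)"
  have pr: "proj (0, 0, X) = (0, 0, z)" using z by (simp add: proj_def z_def)
  have cm: "complex_of_int (c * int m) \<noteq> 0" using c_pos m_pos by simp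
  have key: "\<theta> / of_int (c * int m) * (x - cnj x) \<in> \<int>" if x: "x \<in> carrier (Om m)" for x
  proof -
    obtain y where y: "x - cnj x = of_int (c * y) * \<theta>"
      using Om_diff_cnj[OF x] unfolding \<theta>_def by blast
    have "\<theta> / of_int (c * int m) * (x - cnj x) = of_int y * (\<theta> * \<theta>) / m"
      using c_pos unfolding y by (simp add: field_simps)
    also have "\<dots> = of_int (- y)" using m_pos by (simp add: th)
    finally show ?thesis by simp
  qed
  have cz: "cnj z = - \<theta> * cnj \<zeta> / of_int (c * int m)" by (simp add: z_def th)
  have diag: "Re (x * z * cnj (2 * y) + 2 * y * cnj z * cnj x) / 2 \<in> \<int>"
    if "x \<in> carrier (Om m)" "y \<in> carrier (Om m)" for x y
  proof -
    have "x * cnj y * \<zeta> \<in> carrier (Om m)" using that \<zeta> by (intro mult_in_Om Om_cnj)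
    then obtain n where n: "\<theta> / of_int (c * int m) * (x * cnj y * \<zeta> - cnj (x * cnj y * \<zeta>)) = of_int n"
      using key Ints_cases by metis
    have "x * z * cnj (2 * y) + 2 * y * cnj z * cnj x
        = 2 * (\<theta> / of_int (c * int m) * (x * cnj y * \<zeta> - cnj (x * cnj y * \<zeta>)))"
      unfolding cz unfolding z_def by (simp add: algebra_simps diff_divide_distrib)
    then show ?thesis unfolding n by simp
  qed
  have diag': "Re (2 * y * z * cnj x + x * cnj z * cnj (2 * y)) / 2 \<in> \<int>"
    if "x \<in> carrier (Om m)" "y \<in> carrier (Om m)" for x y
  proof -
    have "y * cnj x * \<zeta> \<in> carrier (Om m)" using that \<zeta> by (intro mult_in_Om Om_cnj)
    then obtain n where n: "\<theta> / of_int (c * int m) * (y * cnj x * \<zeta> - cnj (y * cnj x * \<zeta>)) = of_int n"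
      using key Ints_cases by metis
    have "2 * y * z * cnj x + x * cnj z * cnj (2 * y)
        = 2 * (\<theta> / of_int (c * int m) * (y * cnj x * \<zeta> - cnj (y * cnj x * \<zeta>)))"
      unfolding cz unfolding z_def by (simp add: algebra_simps diff_divide_distrib)
    then show ?thesis unfolding n by simp
  qed
  have dt: "(1 + 2 * p) * (1 + 2 * t) - 2 * q * (2 * r) = 1"
    using assms(1) by (simp add: level2_matrix_def det_2 A)
  have off: "((1 + 2 * p) * z * cnj (1 + 2 * t) + 2 * q * cnj z * cnj (2 * r) - z) / 2 \<in> carrier (Om m)"
  proof -
    have "r * \<zeta> \<in> carrier (Om m)" using O \<zeta> by (intro mult_in_Om)
    then obtain n1 where n1: "\<theta> / of_int (c * int m) * (r * \<zeta> - cnj (r * \<zeta>)) = of_int n1"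
      using key Ints_cases by metis
    obtain n2 where n2: "\<theta> / of_int (c * int m) * (t - cnj t) = of_int n2"
      using key[OF O(4)] Ints_cases by metis
    \<comment> \<open>Multiplying the subtracted z by the determinant 1 pairs each entry with a
      conjugate, so that only differences as in \<open>key\<close> remain.\<close>
    have "((1 + 2 * p) * z * cnj (1 + 2 * t) + 2 * q * cnj z * cnj (2 * r) - z) / 2
      = ((1 + 2 * p) * z * cnj (1 + 2 * t) + 2 * q * cnj z * cnj (2 * r)
          - z * ((1 + 2 * p) * (1 + 2 * t) - 2 * q * (2 * r))) / 2"
      unfolding dt by simp
    also have "\<dots> = 2 * q * (\<theta> / of_int (c * int m) * (r * \<zeta> - cnj (r * \<zeta>)))
        - (1 + 2 * p) * \<zeta> * (\<theta> / of_int (c * int m) * (t - cnj t))"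
      unfolding cz unfolding z_def by (simp add: algebra_simps diff_divide_distrib add_divide_distrib)
    also have "\<dots> = 2 * q * of_int n1 + of_int (-1) * ((1 + 2 * p) * \<zeta> * of_int n2)"
      unfolding n1 n2 by simp
    also have "\<dots> \<in> carrier (Om m)"
      using O \<zeta> by (intro add_in_Om mult_in_Om of_int_in_Om two one_in_Om)
    finally show ?thesis .
  qed
  have "1 + 2 * p \<in> carrier (Om m)" "1 + 2 * t \<in> carrier (Om m)"
    using O by (auto intro!: add_in_Om mult_in_Om two one_in_Om)
  then have d1: "Re ((1 + 2 * p) * z * cnj (2 * q) + 2 * q * cnj z * cnj (1 + 2 * p)) / 2 \<in> \<int>"
    and d2: "Re (2 * r * z * cnj (1 + 2 * t) + (1 + 2 * t) * cnj z * cnj (2 * r)) / 2 \<in> \<int>"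
    using diag diag' O by blast+
  show ?thesis unfolding pr even_herm_def herm_act_eq A
    using d1 d2 off by (simp del: complex_cnj_add complex_cnj_mult)
qed

lemma ext_act_level2:
  assumes A: "level2_matrix A" and v: "integral_vec v"
  shows "\<exists>w. integral_vec w \<and> ext_act A v = v + 2 *\<^sub>R w"
proof -
  obtain a d X where vv: "v = (a, d, X)" by (cases v)
  define D where "D H = herm_act A H - H" for H
  have Dlin: "D (H + K) = D H + D K" "D (r *\<^sub>R H) = r *\<^sub>R D H" for H K r
    by (simp_all add: D_def herm_act_add herm_act_scaleR scaleR_right_diff_distrib)
  have "proj v = a *\<^sub>R (1, 0, 0) + d *\<^sub>R (0, 1, 0) + proj (0, 0, X)"
    by (simp add: proj_def vv)
  then have "D (proj v) = a *\<^sub>R D (1, 0, 0) + d *\<^sub>R D (0, 1, 0) + D (proj (0, 0, X))"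
    by (simp only: Dlin)
  moreover have "even_herm \<dots>"
    unfolding D_def using v vv
    by (intro even_herm_add even_herm_scaleR herm_act_level2_diag[OF A]
        herm_act_level2_offdiag[OF A]) auto
  ultimately have "even_herm (D (proj v))" by simp
  then obtain w where w: "integral_vec w" "incl (D (proj v)) = 2 *\<^sub>R w"
    using even_herm_incl by blast
  then have "ext_act A v = v + 2 *\<^sub>R w" by (simp add: ext_act_def D_def)
  then show ?thesis using w by blast
qed

theorem level2_isometry_ext_act: "level2_matrix A \<Longrightarrow> level2_isometry (ext_act A)"
  unfolding level2_isometry_def
  using linear_ext_act ext_act_isometry ext_act_level2 ext_act_kap_pos level2_matrix_def by blast

end

section \<open>Embedding the level 2 subgroup\<close>

lemma UNIV_6: "(UNIV :: 6 set) = {0, 1, 2, 3, 4, 5}"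
proof -
  have "card {0, 1, 2, 3, 4, 5 :: 6} = CARD(6)" by simp
  then show ?thesis by (intro card_subset_eq[symmetric]) auto
qed

lemma sum_6: "(\<Sum>i\<in>(UNIV :: 6 set). f i) = f 0 + f 1 + f 2 + f 3 + f 4 + f 5"
  unfolding UNIV_6 by (simp add: add.assoc)

lemma forall_6: "(\<forall>i :: 6. P i) \<longleftrightarrow> P 0 \<and> P 1 \<and> P 2 \<and> P 3 \<and> P 4 \<and> P 5"
  by (metis UNIV_6 UNIV_I insertE empty_iff)

definition vec6 :: "real \<Rightarrow> real \<Rightarrow> real \<Rightarrow> real \<Rightarrow> real \<Rightarrow> real \<Rightarrow> real^6" where
  "vec6 a b c d e f = (\<chi> i. if i = 0 then a else if i = 1 then b else if i = 2 then c
     else if i = 3 then d else if i = 4 then e else f)"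

lemma vec6_nth [simp]:
  "vec6 a b c d e f $ 0 = a" "vec6 a b c d e f $ 1 = b" "vec6 a b c d e f $ 2 = c"
  "vec6 a b c d e f $ 3 = d" "vec6 a b c d e f $ 4 = e" "vec6 a b c d e f $ 5 = f"
  by (simp_all add: vec6_def)

lemma inner_vec6: "X \<bullet> vec6 a b c d e f
    = X $ 0 * a + X $ 1 * b + X $ 2 * c + X $ 3 * d + X $ 4 * e + X $ 5 * f"
  by (simp add: inner_vec_def sum_6)

lemma csqrt_minus_nat: "csqrt (- of_nat m) = \<i> * sqrt m"
  using csqrt_of_real_nonpos[of "- of_nat m"] by simp

lemma Om_genE:
  assumes "z \<in> carrier (Om m)"
  obtains a b where "z = of_int a + of_int b * Om_generator m"
  using assms by (auto simp: carrier_Om)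

lemma Om_genI: "of_int a + of_int b * Om_generator m \<in> carrier (Om m)"
  by (auto simp: carrier_Om)

text \<open>u and s occupy disjoint coordinates, two for the norm 2 of u and four for the norm 2 m
  of s.\<close>

lemma bianchi_lattice_exists_12:
  assumes "m > 0" "m mod 4 \<noteq> 3"
  shows "\<exists>u s. bianchi_lattice m u s 2"
proof -
  have g: "Om_generator m = \<i> * sqrt m" using assms by (simp add: Om_generator_def csqrt_minus_nat)
  have q: "sqrt m * sqrt m = m" "sqrt m \<noteq> 0" using assms by auto
  obtain a b c d where "int (2 * m) = a\<^sup>2 + b\<^sup>2 + c\<^sup>2 + d\<^sup>2"
    using four_squares[of "2 * m"] unfolding sum_of_four_squares_def by blast
  then have "real_of_int (int (2 * m)) = of_int (a\<^sup>2 + b\<^sup>2 + c\<^sup>2 + d\<^sup>2)" by simp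
  then have sq: "(of_int a)\<^sup>2 + (of_int b)\<^sup>2 + (of_int c)\<^sup>2 + (of_int d)\<^sup>2 = 2 * real m" by simp
  let ?u = "vec6 1 1 0 0 0 0" and ?s = "vec6 0 0 (of_int a) (of_int b) (of_int c) (of_int d)"
  have "bianchi_lattice m ?u ?s 2"
  proof
    show "?u \<bullet> ?u = 2" "?u \<bullet> ?s = 0" by (simp_all add: inner_vec6)
    show "?s \<bullet> ?s = real (2 * m)" using sq by (simp add: inner_vec6 power2_eq_square)
  next
    fix z i assume "z \<in> carrier (Om m)"
    then obtain x y where "z = of_int x + of_int y * Om_generator m" by (rule Om_genE)
    then have z: "Re z = of_int x" "Im z / sqrt m = of_int y" using q by (simp_all add: g)
    have "\<forall>i. (Re z *\<^sub>R ?u + (Im z / sqrt m) *\<^sub>R ?s) $ i \<in> \<int>"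
      unfolding z forall_6 by simp
    then show "(Re z *\<^sub>R ?u + (Im z / sqrt m) *\<^sub>R ?s) $ i \<in> \<int>" by blast
  next
    fix z assume "z \<in> carrier (Om m)"
    then obtain x y where z: "z = of_int x + of_int y * Om_generator m" by (rule Om_genE)
    show "\<exists>y. z - cnj z = of_int (2 * y) * (\<i> * sqrt m)"
      by (intro exI[of _ y]) (simp add: z g)
    have "cnj z = of_int x + of_int (- y) * Om_generator m" by (simp add: z g)
    then show "cnj z \<in> carrier (Om m)" using Om_genI by metis
    show "Re z \<in> \<int>" by (simp add: z g)
  next
    fix X :: "real^6" assume X: "\<And>i. X $ i \<in> \<int>"
    have "X \<bullet> ?u \<in> \<int>" "X \<bullet> ?s \<in> \<int>" using X by (simp_all add: inner_vec6)
    then obtain x y where xy: "X \<bullet> ?u = of_int x" "X \<bullet> ?s = of_int y" by (auto elim!: Ints_cases)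
    show "\<exists>\<zeta>\<in>carrier (Om m). Complex (X \<bullet> ?u / 2) (X \<bullet> ?s / real (2 * m) * sqrt m)
        = \<i> * sqrt m * \<zeta> / of_int (2 * int m)"
    proof
      \<comment> \<open>With \<theta> the square root of -m, x / 2 + y \<theta> / (2 m) equals
        \<theta> (y - x \<theta>) / (2 m).\<close>
      show "of_int y + of_int (- x) * Om_generator m \<in> carrier (Om m)" by (rule Om_genI)
      show "Complex (X \<bullet> ?u / 2) (X \<bullet> ?s / real (2 * m) * sqrt m)
        = \<i> * sqrt m * (of_int y + of_int (- x) * Om_generator m) / of_int (2 * int m)"
        unfolding xy g using assms(1) q by (simp add: complex_eq_iff field_simps)
    qed
  qed (use assms in auto)
  then show ?thesis by blast
qed

text \<open>The generator is sent to (u + s) / 2, so s must agree with u modulo 2. This dictates two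
  odd entries and four even ones, whence 2 m = 2 + 4 n with n a sum of four squares.\<close>

lemma bianchi_lattice_exists_3:
  assumes "m mod 4 = 3"
  shows "\<exists>u s. bianchi_lattice m u s 1"
proof -
  have m0: "m > 0" using assms by (cases m) auto
  define n where "n = m div 2"
  have mn: "m = 2 * n + 1" using assms unfolding n_def by presburger
  have g: "Om_generator m = (1 + \<i> * sqrt m) / 2"
    using assms by (simp add: Om_generator_def csqrt_minus_nat)
  have q: "sqrt m * sqrt m = m" "sqrt m \<noteq> 0" using m0 by auto
  obtain a b c d where "int n = a\<^sup>2 + b\<^sup>2 + c\<^sup>2 + d\<^sup>2"
    using four_squares[of n] unfolding sum_of_four_squares_def by blast
  then have "real_of_int (int n) = of_int (a\<^sup>2 + b\<^sup>2 + c\<^sup>2 + d\<^sup>2)" by simp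
  then have sq: "(of_int a)\<^sup>2 + (of_int b)\<^sup>2 + (of_int c)\<^sup>2 + (of_int d)\<^sup>2 = real n" by simp
  let ?u = "vec6 1 1 0 0 0 0"
    and ?s = "vec6 (-1) 1 (2 * of_int a) (2 * of_int b) (2 * of_int c) (2 * of_int d)"
  have "bianchi_lattice m ?u ?s 1"
  proof
    show "?u \<bullet> ?u = 2" "?u \<bullet> ?s = 0" by (simp_all add: inner_vec6)
    show "?s \<bullet> ?s = real (2 * m)" using sq by (simp add: inner_vec6 power2_eq_square mn)
  next
    fix z i assume "z \<in> carrier (Om m)"
    then obtain x y where "z = of_int x + of_int y * Om_generator m" by (rule Om_genE)
    then have z: "Re z = of_int x + of_int y / 2" "Im z / sqrt m = of_int y / 2"
      using q by (simp_all add: g)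
    have "\<forall>i. (Re z *\<^sub>R ?u + (Im z / sqrt m) *\<^sub>R ?s) $ i \<in> \<int>"
      unfolding z forall_6 by simp
    then show "(Re z *\<^sub>R ?u + (Im z / sqrt m) *\<^sub>R ?s) $ i \<in> \<int>" by blast
  next
    fix z assume "z \<in> carrier (Om m)"
    then obtain x y where z: "z = of_int x + of_int y * Om_generator m" by (rule Om_genE)
    show "\<exists>y. z - cnj z = of_int (1 * y) * (\<i> * sqrt m)"
      by (intro exI[of _ y]) (simp add: z g field_simps)
    have "cnj z = of_int (x + y) + of_int (- y) * Om_generator m" by (simp add: z g field_simps)
    then show "cnj z \<in> carrier (Om m)" using Om_genI by metis
    show "Re z \<in> \<int>" if "Im z = 0"
      using that q by (simp add: z g)
  next
    fix X :: "real^6" assume X: "\<And>i. X $ i \<in> \<int>"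
    \<comment> \<open>Chosen so that X . s = 2 (X $ 1 + k) - (X $ 0 + X $ 1): the pairings with u
      and s have the same parity, as division by the generator requires.\<close>
    define k where "k = of_int a * X $ 2 + of_int b * X $ 3 + of_int c * X $ 4 + of_int d * X $ 5"
    have "X $ 1 + k \<in> \<int>" "X $ 0 + X $ 1 \<in> \<int>" using X by (simp_all add: k_def)
    then obtain x y where xy: "X $ 0 + X $ 1 = of_int x" "X $ 1 + k = of_int y"
      by (auto elim!: Ints_cases)
    have us: "X \<bullet> ?u = of_int x" "X \<bullet> ?s = 2 * of_int y - of_int x"
      unfolding xy[symmetric] by (simp_all add: inner_vec6 k_def algebra_simps)
    show "\<exists>\<zeta>\<in>carrier (Om m). Complex (X \<bullet> ?u / 2) (X \<bullet> ?s / real (2 * m) * sqrt m)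
        = \<i> * sqrt m * \<zeta> / of_int (1 * int m)"
    proof
      show "of_int y + of_int (- x) * Om_generator m \<in> carrier (Om m)" by (rule Om_genI)
      show "Complex (X \<bullet> ?u / 2) (X \<bullet> ?s / real (2 * m) * sqrt m)
        = \<i> * sqrt m * (of_int y + of_int (- x) * Om_generator m) / of_int (1 * int m)"
        unfolding us g using m0 q by (simp add: complex_eq_iff field_simps)
    qed
  qed (use m0 in auto)
  then show ?thesis by blast
qed

lemma bianchi_lattice_exists: "m > 0 \<Longrightarrow> \<exists>u s c. bianchi_lattice m u s c"
  using bianchi_lattice_exists_12 bianchi_lattice_exists_3 by blast

section \<open>Passage from SL2 to PSL2\<close>

lemma SL2_simps:
  "x \<otimes>\<^bsub>SL2 m\<^esub> y = x ** y" "\<one>\<^bsub>SL2 m\<^esub> = mat 1"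
  by (simp_all add: SL2_def)

lemma coset_plus_minus_one: "plus_minus_one #>\<^bsub>SL2 m\<^esub> A = {A, - A}"
proof -
  have "(- mat 1) ** A = - A"
    by (simp add: matrix_matrix_mult_def vec_eq_iff mat_def sum_2 forall_2)
  then show ?thesis by (auto simp: r_coset_def SL2_simps plus_minus_one_def)
qed

lemma PIdl_Om: "x \<in> PIdl\<^bsub>Om m\<^esub> a \<longleftrightarrow> (\<exists>b\<in>carrier (Om m). x = a * b)"
  by (auto simp: cgenideal_def Om_def complex_ring_def mult.commute)

lemma carrier_PSL2: "carrier (PSL2 m) = (\<lambda>A. plus_minus_one #>\<^bsub>SL2 m\<^esub> A) ` carrier (SL2 m)"
  by (auto simp: PSL2_def FactGroup_def RCOSETS_def)

lemma mult_PSL2: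
  assumes "A \<in> carrier (SL2 m)" "B \<in> carrier (SL2 m)"
  shows "(plus_minus_one #>\<^bsub>SL2 m\<^esub> A) \<otimes>\<^bsub>PSL2 m\<^esub> (plus_minus_one #>\<^bsub>SL2 m\<^esub> B)
    = plus_minus_one #>\<^bsub>SL2 m\<^esub> (A ** B)"
  using normal.rcos_sum[OF normal_plus_minus_one assms] by (simp add: PSL2_def FactGroup_def SL2_simps)

text \<open>Stated for every subgroup of the level 2 subgroup, so that it applies to both choices of
  \<Delta>. \<open>\<phi>\<close> may pick either matrix of a coset, as A and -A act alike.\<close>

lemma (in bianchi_lattice) embeds_in_RACG_level2:
  assumes sub: "subgroup \<Delta> (PSL2 m)"
    and level: "\<Delta> \<subseteq> principal_congruence_subgroup m (PIdl\<^bsub>Om m\<^esub> 2)"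
  shows "embeds_in_RACG ((PSL2 m)\<lparr>carrier := \<Delta>\<rparr>)"
proof -
  interpret SL: group "SL2 m" by (rule group_SL2)
  let ?c = "\<lambda>A. plus_minus_one #>\<^bsub>SL2 m\<^esub> A"
  obtain V e where V: "right_angled_roots lor V e kap" "e ` V = {v. line v}"
    by (rule line_enumeration)
  interpret R: right_angled_roots lor V e kap by (rule V)
  define \<phi> where "\<phi> x = ext_act (SOME A. A \<in> x)" for x
  have \<phi>: "\<phi> (?c A) = ext_act A" for A
  proof -
    have "(SOME B. B \<in> ?c A) \<in> ?c A" by (rule someI[of _ A]) (simp add: coset_plus_minus_one)
    then show ?thesis by (auto simp: \<phi>_def coset_plus_minus_one ext_act_uminus)
  qed
  have rep: "\<exists>A\<in>carrier (SL2 m). x = ?c A \<and> level2_matrix A" if x: "x \<in> \<Delta>" for x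
  proof -
    obtain A where A: "A \<in> carrier (SL2 m)" "x = ?c A"
      "\<forall>i j. A $ i $ j - mat 1 $ i $ j \<in> PIdl\<^bsub>Om m\<^esub> 2"
      using x level unfolding principal_congruence_subgroup_def by blast
    then have "level2_matrix A" by (simp add: level2_matrix_def PIdl_Om SL2_def)
    then show ?thesis using A by blast
  qed
  show ?thesis
  proof (rule R.embeds_in_RACG_if_reflections)
    show "group ((PSL2 m)\<lparr>carrier := \<Delta>\<rparr>)"
      by (rule group.subgroup_imp_group[OF group_PSL2 sub])
  next
    fix x y
    assume "x \<in> carrier ((PSL2 m)\<lparr>carrier := \<Delta>\<rparr>)" "y \<in> carrier ((PSL2 m)\<lparr>carrier := \<Delta>\<rparr>)"
    then obtain A B where "A \<in> carrier (SL2 m)" "B \<in> carrier (SL2 m)" "x = ?c A" "y = ?c B"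
      using rep[of x] rep[of y] by auto
    then show "\<phi> (x \<otimes>\<^bsub>(PSL2 m)\<lparr>carrier := \<Delta>\<rparr>\<^esub> y) = \<phi> x \<circ> \<phi> y"
      by (simp add: mult_PSL2 \<phi> ext_act_mult)
  next
    show "inj_on \<phi> (carrier ((PSL2 m)\<lparr>carrier := \<Delta>\<rparr>))"
    proof (rule inj_onI)
      fix x y
      assume "x \<in> carrier ((PSL2 m)\<lparr>carrier := \<Delta>\<rparr>)" "y \<in> carrier ((PSL2 m)\<lparr>carrier := \<Delta>\<rparr>)"
        and eq: "\<phi> x = \<phi> y"
      then obtain A B where AB: "A \<in> carrier (SL2 m)" "B \<in> carrier (SL2 m)" "x = ?c A" "y = ?c B"
        using rep[of x] rep[of y] by auto
      let ?I = "inv\<^bsub>SL2 m\<^esub> A"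
      have I: "?I ** A = mat 1" "A ** ?I = mat 1" "?I \<in> carrier (SL2 m)"
        using SL.l_inv[OF AB(1)] SL.r_inv[OF AB(1)] AB(1) by (simp_all add: SL2_simps)
      have "ext_act (?I ** B) = ext_act (?I ** A)"
        using eq AB by (simp add: ext_act_mult \<phi>)
      then have "ext_act (?I ** B) = id" by (simp add: I ext_act_one)
      moreover have "det (?I ** B) = 1" using I AB(2) by (simp add: det_mul SL2_def)
      ultimately have "?I ** B = mat 1 \<or> ?I ** B = - mat 1" by (intro ext_act_trivial)
      moreover have "B = A ** (?I ** B)" by (simp add: matrix_mul_assoc I)
      moreover have "A ** (- mat 1) = - A"
        by (simp add: matrix_matrix_mult_def vec_eq_iff mat_def sum_2 forall_2)
      ultimately have "B = A \<or> B = - A" by (metis matrix_mul_rid)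
      then show "x = y" by (auto simp: AB coset_plus_minus_one)
    qed
  next
    fix x assume "x \<in> carrier ((PSL2 m)\<lparr>carrier := \<Delta>\<rparr>)"
    then obtain A where A: "x = ?c A" "level2_matrix A" using rep[of x] by auto
    then show "\<exists>w\<in>group_words V. \<phi> x = R.act w"
      using level2_isometry_reflections[OF V level2_isometry_ext_act] by (simp add: \<phi>)
  qed
qed

section \<open>Indices\<close>

type_synonym parity = "bool \<times> bool"

definition padd :: "parity \<Rightarrow> parity \<Rightarrow> parity" where
  "padd v w = (fst v \<noteq> fst w, snd v \<noteq> snd w)"

text \<open>Multiplication in the ring of order 4 generated over the field of order 2 by \<omega>
  with \<omega> * \<omega> = C + D \<omega>. The pair (x, y) stands for x + y \<omega>, and
  inequality of Booleans is addition.\<close>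

definition pmul :: "bool \<Rightarrow> bool \<Rightarrow> parity \<Rightarrow> parity \<Rightarrow> parity" where
  "pmul C D v w = ((fst v \<and> fst w) \<noteq> (C \<and> snd v \<and> snd w),
     ((fst v \<and> snd w) \<noteq> (snd v \<and> fst w)) \<noteq> (D \<and> snd v \<and> snd w))"

type_synonym parity_matrix = "(parity \<times> parity) \<times> (parity \<times> parity)"

definition parities :: "parity list" where
  "parities = [(False, False), (False, True), (True, False), (True, True)]"

definition parity_matrices :: "parity_matrix list" where
  "parity_matrices = List.product (List.product parities parities) (List.product parities parities)"

definition pmat_det :: "bool \<Rightarrow> bool \<Rightarrow> parity_matrix \<Rightarrow> parity" where
  "pmat_det C D M = padd (pmul C D (fst (fst M)) (snd (snd M))) (pmul C D (snd (fst M)) (fst (snd M)))"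

definition pmat_SL2 :: "bool \<Rightarrow> bool \<Rightarrow> parity_matrix set" where
  "pmat_SL2 C D = {M. pmat_det C D M = (True, False)}"

lemma set_parities: "set parities = UNIV"
  by (auto simp: parities_def)

lemma set_parity_matrices: "set parity_matrices = UNIV"
  by (simp add: parity_matrices_def set_parities)

text \<open>If D and C hold the ring is the field of order 4 (2 is inert), if only D holds it is a
  product of two fields of order 2 (2 splits), and otherwise it is the dual numbers (2 ramifies).
  The orders are 60, 6 * 6 and 6 * 8.\<close>

definition sl2_order :: "bool \<Rightarrow> bool \<Rightarrow> nat" where
  "sl2_order C D = (if D then if C then 60 else 36 else 48)"

lemma pmat_SL2_code: "pmat_SL2 C D = set (filter (\<lambda>M. pmat_det C D M = (True, False)) parity_matrices)"
  by (simp add: pmat_SL2_def set_parity_matrices)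

lemma card_pmat_SL2: "card (pmat_SL2 C D) = sl2_order C D"
proof -
  have "distinct parity_matrices"
    by (simp add: parity_matrices_def distinct_product parities_def)
  then have "card (pmat_SL2 C D) = length (filter (\<lambda>M. pmat_det C D M = (True, False)) parity_matrices)"
    unfolding pmat_SL2_code by (intro distinct_card distinct_filter)
  moreover have "\<forall>C\<in>set [False, True]. \<forall>D\<in>set [False, True].
      length (filter (\<lambda>M. pmat_det C D M = (True, False)) parity_matrices) = sl2_order C D"
    by code_simp
  ultimately show ?thesis by (cases C; cases D) simp_all
qed

text \<open>A finite commutative ring has stable range 1: r and s generate the unit ideal, so some r
  + s d is a unit, here with inverse y.\<close>

lemma parity_stable_range:
  assumes "pmat_det C D ((p, q), (r, s)) = (True, False)"
  shows "\<exists>d y. pmul C D (padd r (pmul C D s d)) y = (True, False)"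
proof -
  obtain p1 p2 q1 q2 r1 r2 s1 s2 where e: "p = (p1, p2)" "q = (q1, q2)" "r = (r1, r2)" "s = (s1, s2)"
    by (metis surj_pair)
  show ?thesis
    using assms unfolding e
    by (cases C; cases D; cases r1; cases r2; cases s1; cases s2;
        (simp add: split_paired_Ex ex_bool_eq pmul_def padd_def pmat_det_def)?;
        cases p1; cases p2; cases q1; cases q2; simp)
qed

section \<open>Reduction of the ring modulo 2\<close>

text \<open>On the ring the quotient is already an integer; the floor only changes its type.\<close>

definition coord_gen :: "nat \<Rightarrow> complex \<Rightarrow> int" where
  "coord_gen m z = \<lfloor>Im z / Im (Om_generator m)\<rfloor>"

definition coord_one :: "nat \<Rightarrow> complex \<Rightarrow> int" where
  "coord_one m z = \<lfloor>Re z - of_int (coord_gen m z) * Re (Om_generator m)\<rfloor>"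

lemma Im_Om_generator: "m > 0 \<Longrightarrow> Im (Om_generator m) \<noteq> 0"
  by (simp add: Om_generator_def csqrt_minus_nat)

lemma
  assumes "m > 0"
  shows coord_gen: "coord_gen m (of_int a + of_int b * Om_generator m) = b"
    and coord_one: "coord_one m (of_int a + of_int b * Om_generator m) = a"
proof -
  show 1: "coord_gen m (of_int a + of_int b * Om_generator m) = b"
    using Im_Om_generator[OF assms] by (simp add: coord_gen_def)
  show "coord_one m (of_int a + of_int b * Om_generator m) = a"
    unfolding coord_one_def 1 by simp
qed

definition parity :: "nat \<Rightarrow> complex \<Rightarrow> parity" where
  "parity m z = (odd (coord_one m z), odd (coord_gen m z))"

lemma parity_eq: "m > 0 \<Longrightarrow> parity m (of_int a + of_int b * Om_generator m) = (odd a, odd b)"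
  by (simp add: parity_def coord_gen coord_one)

lemma parity_of_int: "m > 0 \<Longrightarrow> parity m (of_int a) = (odd a, False)"
  using parity_eq[of m a 0] by simp

lemma
  assumes "m > 0" "z \<in> carrier (Om m)" "w \<in> carrier (Om m)"
  shows parity_add: "parity m (z + w) = padd (parity m z) (parity m w)"
    and parity_diff: "parity m (z - w) = padd (parity m z) (parity m w)"
proof -
  obtain a b where z: "z = of_int a + of_int b * Om_generator m" using assms by (elim Om_genE)
  obtain c d where w: "w = of_int c + of_int d * Om_generator m" using assms by (elim Om_genE)
  have 1: "z + w = of_int (a + c) + of_int (b + d) * Om_generator m"
    and 2: "z - w = of_int (a - c) + of_int (b - d) * Om_generator m"
    unfolding z w by (simp_all add: algebra_simps)
  show "parity m (z + w) = padd (parity m z) (parity m w)"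
    "parity m (z - w) = padd (parity m z) (parity m w)"
    unfolding 1 2 unfolding z w parity_eq[OF assms(1)] by (auto simp: padd_def)
qed

lemma parity_even_iff:
  assumes "m > 0" "z \<in> carrier (Om m)"
  shows "parity m z = (False, False) \<longleftrightarrow> z \<in> PIdl\<^bsub>Om m\<^esub> 2"
proof -
  obtain a b where z: "z = of_int a + of_int b * Om_generator m" using assms by (elim Om_genE)
  show ?thesis
  proof
    assume "parity m z = (False, False)"
    then have "even a" "even b" unfolding z parity_eq[OF assms(1)] by auto
    then obtain c d where "a = 2 * c" "b = 2 * d" by (meson dvdE)
    then have "z = 2 * (of_int c + of_int d * Om_generator m)" by (simp add: z algebra_simps)
    then show "z \<in> PIdl\<^bsub>Om m\<^esub> 2" unfolding PIdl_Om using Om_genI by blast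
  next
    assume "z \<in> PIdl\<^bsub>Om m\<^esub> 2"
    then obtain w where "w \<in> carrier (Om m)" "z = 2 * w" unfolding PIdl_Om by blast
    then obtain c d where "z = 2 * (of_int c + of_int d * Om_generator m)" by (auto elim: Om_genE)
    then have "z = of_int (2 * c) + of_int (2 * d) * Om_generator m" by (simp add: algebra_simps)
    then show "parity m z = (False, False)" by (simp only: parity_eq[OF assms(1)]) simp
  qed
qed

lemma parity_eq_iff:
  assumes "m > 0" "z \<in> carrier (Om m)" "w \<in> carrier (Om m)"
  shows "parity m z = parity m w \<longleftrightarrow> z - w \<in> PIdl\<^bsub>Om m\<^esub> 2"
proof -
  have "z - w \<in> carrier (Om m)"
    using add_in_Om[OF assms(2) uminus_in_Om[OF assms(3)]] by simp
  then show ?thesis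
    by (subst parity_even_iff[symmetric]) (auto simp: assms parity_diff padd_def prod_eq_iff)
qed

text \<open>The coefficients of \<open>\<omega>\<^sup>2 = c + d \<omega>\<close> modulo 2, where \<open>\<omega>\<close> is the generator.\<close>

definition sq_one :: "nat \<Rightarrow> bool" where
  "sq_one m \<longleftrightarrow> m mod 4 = 1 \<or> m mod 8 = 3"

definition sq_gen :: "nat \<Rightarrow> bool" where
  "sq_gen m \<longleftrightarrow> m mod 4 = 3"

lemma Om_generator_square_parity:
  assumes "m mod 4 \<noteq> 0"
  shows "\<exists>c d. Om_generator m * Om_generator m = of_int c + of_int d * Om_generator m
    \<and> odd c = sq_one m \<and> odd d = sq_gen m"
proof (cases "m mod 4 = 3")
  case False
  have "Om_generator m = \<i> * sqrt m" using False by (simp add: Om_generator_def csqrt_minus_nat)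
  then have "Om_generator m * Om_generator m = of_int (- int m) + of_int 0 * Om_generator m"
    by (simp add: mult_ac flip: of_real_mult)
  moreover have "odd (- int m) = sq_one m"
    using assms False unfolding sq_one_def by simp presburger
  ultimately show ?thesis using False by (intro exI[of _ "- int m"] exI[of _ 0]) (simp add: sq_gen_def)
next
  case True
  define k where "k = m div 4"
  have m: "m = 4 * k + 3" using True k_def by presburger
  have g: "Om_generator m = (1 + \<i> * sqrt m) / 2"
    using True by (simp add: Om_generator_def csqrt_minus_nat)
  have "(\<i> * sqrt m) * (\<i> * sqrt m) = - of_nat m"
    by (simp add: mult_ac flip: of_real_mult)
  then have "Om_generator m * Om_generator m = (1 - of_nat m + 2 * (\<i> * sqrt m)) / 4"
    unfolding g by (simp add: field_simps)
  also have "\<dots> = of_int (- int k - 1) + of_int 1 * Om_generator m"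
    unfolding g by (simp add: m field_simps)
  finally have "Om_generator m * Om_generator m = of_int (- int k - 1) + of_int 1 * Om_generator m" .
  moreover have "odd (- int k - 1) = sq_one m" using True unfolding sq_one_def m by simp presburger
  ultimately show ?thesis
    using True by (intro exI[of _ "- int k - 1"] exI[of _ 1]) (simp add: sq_gen_def)
qed

text \<open>F is any invariant that separates the cosets. It need not be a homomorphism, which
  allows one built from chosen representatives.\<close>

lemma card_rcosets_image:
  assumes "group P" "subgroup \<Delta> P" "carrier P = \<pi> ` S"
    and "\<And>a b. a \<in> S \<Longrightarrow> b \<in> S \<Longrightarrow> F a = F b \<longleftrightarrow> \<pi> a \<otimes>\<^bsub>P\<^esub> inv\<^bsub>P\<^esub> \<pi> b \<in> \<Delta>"
  shows "card (rcosets\<^bsub>P\<^esub> \<Delta>) = card (F ` S)"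
proof -
  interpret group P by fact
  define g where "g a = \<Delta> #>\<^bsub>P\<^esub> \<pi> a" for a
  have R: "rcosets\<^bsub>P\<^esub> \<Delta> = g ` S" by (auto simp: RCOSETS_def assms(3) g_def)
  have g: "g a = g b \<longleftrightarrow> F a = F b" if "a \<in> S" "b \<in> S" for a b
  proof -
    have c: "\<pi> a \<in> carrier P" "\<pi> b \<in> carrier P" using that assms(3) by auto
    have sub: "\<Delta> \<subseteq> carrier P" using assms(2) by (rule subgroup.subset)
    have "g a = g b \<longleftrightarrow> \<pi> a \<otimes>\<^bsub>P\<^esub> inv\<^bsub>P\<^esub> \<pi> b \<in> \<Delta>"
    proof
      assume "g a = g b"
      then have "\<pi> a \<in> \<Delta> #>\<^bsub>P\<^esub> \<pi> b"
        using rcos_self[OF c(1) assms(2)] by (simp add: g_def)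
      then obtain d where d: "d \<in> \<Delta>" "\<pi> a = d \<otimes>\<^bsub>P\<^esub> \<pi> b" by (auto simp: r_coset_def)
      then have "\<pi> a \<otimes>\<^bsub>P\<^esub> inv\<^bsub>P\<^esub> \<pi> b = d" using c sub by (auto simp: m_assoc)
      then show "\<pi> a \<otimes>\<^bsub>P\<^esub> inv\<^bsub>P\<^esub> \<pi> b \<in> \<Delta>" using d by simp
    next
      assume d: "\<pi> a \<otimes>\<^bsub>P\<^esub> inv\<^bsub>P\<^esub> \<pi> b \<in> \<Delta>"
      have "\<pi> a = (\<pi> a \<otimes>\<^bsub>P\<^esub> inv\<^bsub>P\<^esub> \<pi> b) \<otimes>\<^bsub>P\<^esub> \<pi> b" using c by (simp add: m_assoc)
      then have "\<pi> a \<in> \<Delta> #>\<^bsub>P\<^esub> \<pi> b" using d unfolding r_coset_def by blast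
      then show "g a = g b" unfolding g_def using repr_independence c(2) assms(2) by metis
    qed
    then show ?thesis using assms(4)[OF that] by simp
  qed
  have "bij_betw (\<lambda>t. g (inv_into S F t)) (F ` S) (g ` S)"
  proof (rule bij_betwI')
    fix x y assume "x \<in> F ` S" "y \<in> F ` S"
    then show "(g (inv_into S F x) = g (inv_into S F y)) = (x = y)"
      by (simp add: g inv_into_into f_inv_into_f)
  next
    fix x assume "x \<in> F ` S"
    then show "g (inv_into S F x) \<in> g ` S" by (intro imageI inv_into_into)
  next
    fix y assume "y \<in> g ` S"
    then obtain a where a: "a \<in> S" "y = g a" by auto
    then have "g (inv_into S F (F a)) = y"
      by (simp add: g inv_into_into f_inv_into_f)
    then show "\<exists>x\<in>F ` S. y = g (inv_into S F x)" using a by auto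
  qed
  then show ?thesis unfolding R by (rule bij_betw_same_card[symmetric])
qed

definition mat2 :: "complex \<Rightarrow> complex \<Rightarrow> complex \<Rightarrow> complex \<Rightarrow> complex^2^2" where
  "mat2 p q r s = (\<chi> i j. if i = 1 then if j = 1 then p else q else if j = 1 then r else s)"

lemma mat2_nth [simp]:
  "mat2 p q r s $ 1 $ 1 = p" "mat2 p q r s $ 1 $ 2 = q"
  "mat2 p q r s $ 2 $ 1 = r" "mat2 p q r s $ 2 $ 2 = s"
  by (simp_all add: mat2_def)

lemma mat2_SL2: "mat2 p q r s \<in> carrier (SL2 m) \<longleftrightarrow>
    p \<in> carrier (Om m) \<and> q \<in> carrier (Om m) \<and> r \<in> carrier (Om m) \<and> s \<in> carrier (Om m)
    \<and> p * s - q * r = 1"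
  by (auto simp: SL2_def det_2 forall_2)

locale reduction =
  fixes m :: nat
  assumes m_pos: "m > 0" and m_mod_4: "m mod 4 \<noteq> 0"
begin

sublocale SL: group "SL2 m" by (rule group_SL2)

abbreviation "O\<^sub>m \<equiv> carrier (Om m)"
abbreviation "pml \<equiv> pmul (sq_one m) (sq_gen m)"

lemma of_int_Om: "of_int n \<in> O\<^sub>m"
  using Om_genI[of n 0 m] by simp

lemma numeral_Om: "numeral n \<in> O\<^sub>m"
  using of_int_Om[of "numeral n"] by simp

lemma diff_Om: "x \<in> O\<^sub>m \<Longrightarrow> y \<in> O\<^sub>m \<Longrightarrow> x - y \<in> O\<^sub>m"
  using add_in_Om[of x m "- y"] uminus_in_Om by simp

lemmas Om_intros = add_in_Om mult_in_Om diff_Om numeral_Om one_in_Om zero_in_Om uminus_in_Om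

lemma parity_mult:
  assumes "z \<in> O\<^sub>m" "w \<in> O\<^sub>m"
  shows "parity m (z * w) = pml (parity m z) (parity m w)"
proof -
  let ?g = "Om_generator m"
  obtain c d where cd: "?g * ?g = of_int c + of_int d * ?g" "odd c = sq_one m" "odd d = sq_gen m"
    using Om_generator_square_parity[OF m_mod_4] by blast
  obtain x y where z: "z = of_int x + of_int y * ?g" using assms by (elim Om_genE)
  obtain x' y' where w: "w = of_int x' + of_int y' * ?g" using assms by (elim Om_genE)
  have "z * w = of_int (x * x') + of_int (x * y' + y * x') * ?g + of_int (y * y') * (?g * ?g)"
    unfolding z w by (simp add: algebra_simps)
  also have "\<dots> = of_int (x * x' + y * y' * c) + of_int (x * y' + y * x' + y * y' * d) * ?g"
    unfolding cd(1) by (simp add: algebra_simps)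
  finally have "parity m (z * w) = (odd (x * x' + y * y' * c), odd (x * y' + y * x' + y * y' * d))"
    by (simp only: parity_eq[OF m_pos])
  moreover have "parity m z = (odd x, odd y)" "parity m w = (odd x', odd y')"
    unfolding z w by (simp_all only: parity_eq[OF m_pos])
  ultimately show ?thesis by (auto simp: pmul_def cd(2,3)[symmetric])
qed

definition pmat :: "complex^2^2 \<Rightarrow> parity_matrix" where
  "pmat A = ((parity m (A$1$1), parity m (A$1$2)), (parity m (A$2$1), parity m (A$2$2)))"

lemma SL2_entry: "A \<in> carrier (SL2 m) \<Longrightarrow> A $ i $ j \<in> O\<^sub>m"
  by (simp add: SL2_def)

lemma pmat_mult_cong:
  assumes "A \<in> carrier (SL2 m)" "B \<in> carrier (SL2 m)" "C \<in> carrier (SL2 m)" "pmat A = pmat B"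
  shows "pmat (A ** C) = pmat (B ** C)"
  using assms(4) SL2_entry[OF assms(1)] SL2_entry[OF assms(2)] SL2_entry[OF assms(3)]
  by (simp add: pmat_def matrix_matrix_mult_def sum_2 parity_add[OF m_pos] parity_mult mult_in_Om)

definition \<Gamma>2 :: "(complex^2^2) set" where
  "\<Gamma>2 = {A \<in> carrier (SL2 m). \<forall>i j. A $ i $ j - mat 1 $ i $ j \<in> PIdl\<^bsub>Om m\<^esub> 2}"

lemma mat_1_nth_Om: "mat 1 $ i $ j \<in> O\<^sub>m"
  by (simp add: mat_def one_in_Om zero_in_Om)

lemma \<Gamma>2_iff: "A \<in> \<Gamma>2 \<longleftrightarrow> A \<in> carrier (SL2 m) \<and> pmat A = pmat (mat 1)"
  by (auto simp: \<Gamma>2_def pmat_def forall_2 parity_eq_iff[OF m_pos SL2_entry mat_1_nth_Om, symmetric])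

lemma pmat_eq_iff:
  assumes "A \<in> carrier (SL2 m)" "B \<in> carrier (SL2 m)"
  shows "pmat A = pmat B \<longleftrightarrow> A \<otimes>\<^bsub>SL2 m\<^esub> inv\<^bsub>SL2 m\<^esub> B \<in> \<Gamma>2"
proof -
  let ?C = "inv\<^bsub>SL2 m\<^esub> B"
  have C: "?C \<in> carrier (SL2 m)" "B ** ?C = mat 1" "?C ** B = mat 1"
    using assms(2) SL.r_inv[OF assms(2)] SL.l_inv[OF assms(2)] by (simp_all add: SL2_simps)
  have AC: "A ** ?C \<in> carrier (SL2 m)" using SL.m_closed[OF assms(1) C(1)] by (simp add: SL2_simps)
  have one: "mat 1 \<in> carrier (SL2 m)" using SL.one_closed by (simp add: SL2_simps)
  show ?thesis
    unfolding \<Gamma>2_iff SL2_simps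
    using AC pmat_mult_cong[OF assms C(1)] pmat_mult_cong[OF AC one assms(2)]
    by (auto simp: C(2,3) matrix_mul_assoc[symmetric])
qed

text \<open>Surjectivity of reduction modulo 2. Arbitrary lifts of the entries have determinant 1
  only modulo 2, so the given matrix is first factored modulo 2 into elementary matrices, which lift
  with determinant exactly 1.\<close>

lemma pmat_image: "pmat ` carrier (SL2 m) = pmat_SL2 (sq_one m) (sq_gen m)"
proof
  show "pmat ` carrier (SL2 m) \<subseteq> pmat_SL2 (sq_one m) (sq_gen m)"
  proof
    fix M assume "M \<in> pmat ` carrier (SL2 m)"
    then obtain A where A: "A \<in> carrier (SL2 m)" "M = pmat A" by blast
    have "A$1$1 * A$2$2 - A$1$2 * A$2$1 = 1" using A(1) by (simp add: SL2_def det_2)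
    then have "parity m (A$1$1 * A$2$2 - A$1$2 * A$2$1) = (True, False)"
      using parity_of_int[OF m_pos, of 1] by simp
    then show "M \<in> pmat_SL2 (sq_one m) (sq_gen m)"
      using SL2_entry[OF A(1)]
      by (simp add: A(2) pmat_SL2_def pmat_det_def pmat_def parity_diff[OF m_pos] parity_mult mult_in_Om)
  qed
  show "pmat_SL2 (sq_one m) (sq_gen m) \<subseteq> pmat ` carrier (SL2 m)"
  proof
    fix M assume M: "M \<in> pmat_SL2 (sq_one m) (sq_gen m)"
    have lift: "\<exists>x\<in>O\<^sub>m. parity m x = v" for v
    proof
      show "of_int (of_bool (fst v)) + of_int (of_bool (snd v)) * Om_generator m \<in> O\<^sub>m" by (rule Om_genI)
      show "parity m (of_int (of_bool (fst v)) + of_int (of_bool (snd v)) * Om_generator m) = v"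
        by (simp only: parity_eq[OF m_pos]) (cases v; auto)
    qed
    obtain p q r s where pqrs: "p \<in> O\<^sub>m" "q \<in> O\<^sub>m" "r \<in> O\<^sub>m" "s \<in> O\<^sub>m"
      and Meq: "M = ((parity m p, parity m q), (parity m r, parity m s))"
      using lift by (metis surj_pair)
    obtain d' y' where dy': "pml (padd (parity m r) (pml (parity m s) d')) y' = (True, False)"
      using parity_stable_range M unfolding pmat_SL2_def Meq by blast
    obtain d y where dy: "d \<in> O\<^sub>m" "y \<in> O\<^sub>m" "parity m d = d'" "parity m y = y'"
      using lift by metis
    have one: "parity m 1 = (True, False)" using parity_of_int[OF m_pos, of 1] by simp
    have "parity m (p * s - q * r) = parity m 1"
      using M pqrs unfolding pmat_SL2_def Meq
      by (simp add: parity_diff[OF m_pos] parity_mult mult_in_Om pmat_det_def one)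
    then obtain l where l: "l \<in> O\<^sub>m" "p * s - q * r = 1 + 2 * l"
      using pqrs by (subst (asm) parity_eq_iff[OF m_pos])
        (auto simp: PIdl_Om algebra_simps intro: Om_intros)
    define b where "b = r + s * d"
    have b: "b \<in> O\<^sub>m" using pqrs dy unfolding b_def by (intro Om_intros)
    have "parity m (b * y) = parity m 1"
      using dy' pqrs dy b unfolding b_def
      by (simp add: parity_add[OF m_pos] parity_mult mult_in_Om one)
    then obtain k where k: "k \<in> O\<^sub>m" "b * y = 1 + 2 * k"
      using b dy by (subst (asm) parity_eq_iff[OF m_pos])
        (auto simp: PIdl_Om algebra_simps intro: Om_intros)
    define p' where "p' = p + q * d"
    define a where "a = (p' - 1) * y"
    define c where "c = (s - 1) * y"
    have O': "p' \<in> O\<^sub>m" "a \<in> O\<^sub>m" "c \<in> O\<^sub>m"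
      using pqrs dy unfolding a_def c_def p'_def by (auto intro!: Om_intros)
    \<comment> \<open>The product of four elementary matrices: upper a, lower b, upper c, lower -d.
      As y inverts b modulo 2, the choice of a and c makes the diagonal of the product of the first
      three p' and s modulo 2; the last factor undoes the column operation by d.\<close>
    define N where "N = mat2 (1 + a * b - d * (c * (1 + a * b) + a)) (c * (1 + a * b) + a)
      (b - d * (1 + b * c)) (1 + b * c)"
    have ab: "1 + a * b = p' + 2 * (k * (p' - 1))"
    proof -
      have "1 + a * b = 1 + (p' - 1) * (b * y)" by (simp add: a_def algebra_simps)
      then show ?thesis unfolding k by (simp add: algebra_simps)
    qed
    have bc: "1 + b * c = s + 2 * (k * (s - 1))"
    proof -
      have "1 + b * c = 1 + (s - 1) * (b * y)" by (simp add: c_def algebra_simps)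
      then show ?thesis unfolding k by (simp add: algebra_simps)
    qed
    have n12: "c * (1 + a * b) + a = q + 2 * (q * k + l * y + c * k * (p' - 1))"
    proof -
      have det: "p' * s - 1 = q * b + 2 * l" using l by (simp add: p'_def b_def algebra_simps)
      have "c * (1 + a * b) + a = (p' * s - 1) * y + 2 * (c * k * (p' - 1))"
        unfolding ab by (simp add: c_def a_def algebra_simps)
      also have "\<dots> = q * (b * y) + 2 * (l * y) + 2 * (c * k * (p' - 1))"
        unfolding det by (simp add: algebra_simps)
      finally show ?thesis unfolding k by (simp add: algebra_simps)
    qed
    have N_SL2: "N \<in> carrier (SL2 m)"
      unfolding N_def mat2_SL2
      by (intro conjI Om_intros O' b dy) (simp add: algebra_simps)
    have par: "parity m x = parity m z" if "x = z + 2 * w" "z \<in> O\<^sub>m" "w \<in> O\<^sub>m" for x z w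
      using that by (subst parity_eq_iff[OF m_pos]) (auto simp: PIdl_Om intro: Om_intros)
    have "parity m (N$2$2) = parity m s"
      by (rule par[of _ _ "k * (s - 1)"]) (use bc k pqrs in \<open>auto simp: N_def intro!: Om_intros\<close>)
    moreover have "parity m (N$1$2) = parity m q"
      by (rule par[of _ _ "q * k + l * y + c * k * (p' - 1)"])
        (use n12 k l dy O' pqrs in \<open>auto simp: N_def intro!: Om_intros\<close>)
    moreover have "parity m (N$2$1) = parity m r"
    proof (rule par)
      show "N$2$1 = r + 2 * (- (d * (k * (s - 1))))"
        unfolding N_def mat2_nth bc by (simp add: b_def algebra_simps)
    qed (use k dy pqrs in \<open>auto intro!: Om_intros\<close>)
    moreover have "parity m (N$1$1) = parity m p"
    proof (rule par)
      show "N$1$1 = p + 2 * (k * (p' - 1) - d * (q * k + l * y + c * k * (p' - 1)))"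
        unfolding N_def mat2_nth n12 unfolding ab by (simp add: p'_def algebra_simps)
    qed (use k l dy O' pqrs in \<open>auto intro!: Om_intros\<close>)
    ultimately have "M = pmat N" by (simp add: Meq pmat_def)
    then show "M \<in> pmat ` carrier (SL2 m)" using N_SL2 by blast
  qed
qed

lemma subgroup_if_inv_mult:
  assumes "K \<subseteq> carrier (SL2 m)" "mat 1 \<in> K"
    and "\<And>A B. A \<in> K \<Longrightarrow> B \<in> K \<Longrightarrow> A \<otimes>\<^bsub>SL2 m\<^esub> inv\<^bsub>SL2 m\<^esub> B \<in> K"
  shows "subgroup K (SL2 m)"
proof (rule SL.subgroupI)
  have inv: "inv\<^bsub>SL2 m\<^esub> A \<in> K" if "A \<in> K" for A
  proof -
    have "mat 1 \<otimes>\<^bsub>SL2 m\<^esub> inv\<^bsub>SL2 m\<^esub> A \<in> K" using assms(2) that by (rule assms(3))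
    then show ?thesis by (simp add: SL2_simps)
  qed
  show "inv\<^bsub>SL2 m\<^esub> A \<in> K" if "A \<in> K" for A using that by (rule inv)
  show "A \<otimes>\<^bsub>SL2 m\<^esub> B \<in> K" if "A \<in> K" "B \<in> K" for A B
  proof -
    have "A \<otimes>\<^bsub>SL2 m\<^esub> inv\<^bsub>SL2 m\<^esub> (inv\<^bsub>SL2 m\<^esub> B) \<in> K" using that inv by (intro assms(3))
    moreover have "B \<in> carrier (SL2 m)" using that assms(1) by blast
    ultimately show ?thesis by simp
  qed
qed (use assms in auto)

lemma subgroup_\<Gamma>2: "subgroup \<Gamma>2 (SL2 m)"
proof (rule subgroup_if_inv_mult)
  fix A B assume "A \<in> \<Gamma>2" "B \<in> \<Gamma>2"
  then have "A \<in> carrier (SL2 m)" "B \<in> carrier (SL2 m)" "pmat A = pmat B" by (auto simp: \<Gamma>2_iff)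
  then show "A \<otimes>\<^bsub>SL2 m\<^esub> inv\<^bsub>SL2 m\<^esub> B \<in> \<Gamma>2" using pmat_eq_iff by blast
qed (use SL.one_closed in \<open>auto simp: \<Gamma>2_iff SL2_simps\<close>)

abbreviation "proj_coset A \<equiv> plus_minus_one #>\<^bsub>SL2 m\<^esub> A"

lemma uminus_mult_mat: "(- A) ** B = - (A ** (B :: complex^2^2))"
  by (simp add: matrix_matrix_mult_def vec_eq_iff sum_2)

text \<open>K contains the kernel {1, -1} of the projection, so K is the full preimage of its image
  and membership can be tested on matrices.\<close>

lemma
  assumes K: "subgroup K (SL2 m)" and neg: "- mat 1 \<in> K"
  shows subgroup_proj: "subgroup (proj_coset ` K) (PSL2 m)"
    and proj_mem: "A \<in> carrier (SL2 m) \<Longrightarrow> B \<in> carrier (SL2 m) \<Longrightarrow>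
      proj_coset A \<otimes>\<^bsub>PSL2 m\<^esub> inv\<^bsub>PSL2 m\<^esub> proj_coset B \<in> proj_coset ` K
        \<longleftrightarrow> A \<otimes>\<^bsub>SL2 m\<^esub> inv\<^bsub>SL2 m\<^esub> B \<in> K"
proof -
  have "proj_coset \<in> hom (SL2 m) (PSL2 m)"
    unfolding PSL2_def by (rule normal.r_coset_hom_Mod[OF normal_plus_minus_one])
  then interpret h: group_hom "SL2 m" "PSL2 m" proj_coset
    by (intro group_hom.intro group_hom_axioms.intro group_SL2 group_PSL2)
  show "subgroup (proj_coset ` K) (PSL2 m)" by (rule h.subgroup_img_is_subgroup[OF K])
  assume AB: "A \<in> carrier (SL2 m)" "B \<in> carrier (SL2 m)"
  let ?C = "A \<otimes>\<^bsub>SL2 m\<^esub> inv\<^bsub>SL2 m\<^esub> B"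
  have "proj_coset A \<otimes>\<^bsub>PSL2 m\<^esub> inv\<^bsub>PSL2 m\<^esub> proj_coset B = proj_coset ?C"
    using AB by simp
  moreover have "proj_coset ?C \<in> proj_coset ` K \<longleftrightarrow> ?C \<in> K"
  proof
    assume "proj_coset ?C \<in> proj_coset ` K"
    then obtain X where X: "X \<in> K" "{?C, - ?C} = {X, - X}" by (auto simp: coset_plus_minus_one)
    have "(- mat 1) \<otimes>\<^bsub>SL2 m\<^esub> X \<in> K" by (rule subgroup.m_closed[OF K neg X(1)])
    then have "- X \<in> K" by (simp add: SL2_simps uminus_mult_mat)
    then show "?C \<in> K" using X by (auto simp: doubleton_eq_iff)
  qed auto
  ultimately show "proj_coset A \<otimes>\<^bsub>PSL2 m\<^esub> inv\<^bsub>PSL2 m\<^esub> proj_coset B \<in> proj_coset ` K \<longleftrightarrow> ?C \<in> K"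
    by simp
qed

lemma mat_1_SL2: "mat 1 \<in> carrier (SL2 m)" "- mat 1 \<in> carrier (SL2 m)"
  by (auto simp: SL2_def det_2 mat_def intro!: Om_intros)

lemma uminus_one_\<Gamma>2: "- mat 1 \<in> \<Gamma>2"
proof -
  have "parity m (-1) = parity m 1"
    using parity_of_int[OF m_pos, of 1] parity_of_int[OF m_pos, of "-1"] by simp
  then have "pmat (- mat 1) = pmat (mat 1)" by (simp add: pmat_def mat_def)
  then show ?thesis by (simp add: \<Gamma>2_iff mat_1_SL2)
qed

lemma card_rcosets_\<Gamma>2:
  "card (rcosets\<^bsub>PSL2 m\<^esub> (proj_coset ` \<Gamma>2)) = sl2_order (sq_one m) (sq_gen m)"
proof -
  have "card (rcosets\<^bsub>PSL2 m\<^esub> (proj_coset ` \<Gamma>2)) = card (pmat ` carrier (SL2 m))"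
    using subgroup_proj[OF subgroup_\<Gamma>2 uminus_one_\<Gamma>2] proj_mem[OF subgroup_\<Gamma>2 uminus_one_\<Gamma>2]
    by (intro card_rcosets_image[where \<pi> = proj_coset] group_PSL2 carrier_PSL2)
       (simp_all add: pmat_eq_iff)
  then show ?thesis by (simp only: pmat_image card_pmat_SL2)
qed

section \<open>A subgroup of index 2 in the level 2 subgroup\<close>

text \<open>For A = 1 + 2 P this is the parity of the \<omega>-coordinate of the upper left entry of
  P. The other coordinate would not do: it is odd for -1, which has to lie in the kernel for the
  index to survive in PSL2.\<close>

definition upper_left_odd :: "complex^2^2 \<Rightarrow> bool" where
  "upper_left_odd A \<longleftrightarrow> snd (parity m ((A$1$1 - 1) / 2))"

lemma \<Gamma>2_entries:
  assumes "A \<in> \<Gamma>2"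
  shows "\<exists>p q r. p \<in> O\<^sub>m \<and> q \<in> O\<^sub>m \<and> r \<in> O\<^sub>m \<and> A$1$1 = 1 + 2 * p \<and> A$1$2 = 2 * q \<and> A$2$1 = 2 * r"
  using assms by (auto simp: \<Gamma>2_def forall_2 mat_def PIdl_Om algebra_simps)

lemma parity_double: "w \<in> O\<^sub>m \<Longrightarrow> parity m (2 * w) = (False, False)"
  using parity_even_iff[OF m_pos, of "2 * w"] mult_in_Om[OF numeral_Om] PIdl_Om by blast

text \<open>(1 + 2 P) (1 + 2 Q) = 1 + 2 (P + Q + 2 P Q), so P modulo 2 is additive.\<close>

lemma upper_left_odd_mult:
  assumes "A \<in> \<Gamma>2" "B \<in> \<Gamma>2"
  shows "upper_left_odd (A ** B) \<longleftrightarrow> upper_left_odd A \<noteq> upper_left_odd B"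
proof -
  obtain p q where A: "p \<in> O\<^sub>m" "q \<in> O\<^sub>m" "A$1$1 = 1 + 2 * p" "A$1$2 = 2 * q"
    using \<Gamma>2_entries[OF assms(1)] by blast
  obtain p' r where B: "p' \<in> O\<^sub>m" "r \<in> O\<^sub>m" "B$1$1 = 1 + 2 * p'" "B$2$1 = 2 * r"
    using \<Gamma>2_entries[OF assms(2)] by blast
  have W: "p * p' + q * r \<in> O\<^sub>m" using A B by (intro Om_intros)
  have "((A ** B)$1$1 - 1) / 2 = (p + p') + 2 * (p * p' + q * r)"
    by (simp add: matrix_matrix_mult_def sum_2 A B algebra_simps add_divide_distrib)
  then have "parity m (((A ** B)$1$1 - 1) / 2) = padd (parity m (p + p')) (parity m (2 * (p * p' + q * r)))"
    using A B W by (simp only: parity_add[OF m_pos] Om_intros)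
  also have "\<dots> = padd (padd (parity m p) (parity m p')) (False, False)"
    using A B by (simp only: parity_double[OF W] parity_add[OF m_pos])
  finally show ?thesis by (simp add: upper_left_odd_def padd_def A B)
qed

definition \<Gamma>2_even :: "(complex^2^2) set" where
  "\<Gamma>2_even = {A \<in> \<Gamma>2. \<not> upper_left_odd A}"

lemma upper_left_odd_quotient:
  assumes "A \<in> \<Gamma>2" "B \<in> \<Gamma>2"
  shows "A \<otimes>\<^bsub>SL2 m\<^esub> inv\<^bsub>SL2 m\<^esub> B \<in> \<Gamma>2_even \<longleftrightarrow> upper_left_odd A = upper_left_odd B"
proof -
  let ?C = "A \<otimes>\<^bsub>SL2 m\<^esub> inv\<^bsub>SL2 m\<^esub> B"
  have c: "A \<in> carrier (SL2 m)" "B \<in> carrier (SL2 m)" using assms by (auto simp: \<Gamma>2_iff)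
  have C: "?C \<in> \<Gamma>2"
    using assms subgroup_\<Gamma>2 by (intro subgroup.m_closed subgroup.m_inv_closed)
  have "?C \<otimes>\<^bsub>SL2 m\<^esub> B = A" using c by (simp add: SL.m_assoc)
  then have "upper_left_odd A \<longleftrightarrow> upper_left_odd ?C \<noteq> upper_left_odd B"
    using upper_left_odd_mult[OF C assms(2)] by (simp add: SL2_simps)
  then show ?thesis using C by (auto simp: \<Gamma>2_even_def)
qed

lemma upper_left_odd_one: "\<not> upper_left_odd (mat 1)" "\<not> upper_left_odd (- mat 1)"
  using parity_of_int[OF m_pos, of 0] parity_of_int[OF m_pos, of "-1"]
  by (simp_all add: upper_left_odd_def mat_def)

lemma subgroup_\<Gamma>2_even: "subgroup \<Gamma>2_even (SL2 m)"
proof (rule subgroup_if_inv_mult)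
  show "mat 1 \<in> \<Gamma>2_even"
    using upper_left_odd_one mat_1_SL2 by (simp add: \<Gamma>2_even_def \<Gamma>2_iff)
next
  fix A B assume "A \<in> \<Gamma>2_even" "B \<in> \<Gamma>2_even"
  then show "A \<otimes>\<^bsub>SL2 m\<^esub> inv\<^bsub>SL2 m\<^esub> B \<in> \<Gamma>2_even"
    by (subst upper_left_odd_quotient) (auto simp: \<Gamma>2_even_def)
qed (auto simp: \<Gamma>2_even_def \<Gamma>2_iff)

lemma uminus_one_\<Gamma>2_even: "- mat 1 \<in> \<Gamma>2_even"
  using upper_left_odd_one uminus_one_\<Gamma>2 by (simp add: \<Gamma>2_even_def)

lemma upper_left_odd_exists: "\<exists>X\<in>\<Gamma>2. upper_left_odd X"
proof
  let ?g = "Om_generator m"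
  \<comment> \<open>the conjugate of an elementary matrix with entry \<open>2 ?g\<close> by one with entry 1\<close>
  let ?X = "mat2 (1 - 2 * ?g) (2 * ?g) (- 2 * ?g) (1 + 2 * ?g)"
  have g: "?g \<in> O\<^sub>m" using Om_genI[of 0 1 m] by simp
  have "?X \<in> carrier (SL2 m)"
    unfolding mat2_SL2 using g by (auto intro!: Om_intros simp: algebra_simps)
  then show "?X \<in> \<Gamma>2"
    using g uminus_in_Om[OF g] by (auto simp: \<Gamma>2_def forall_2 mat_def PIdl_Om)
  have "((1 - 2 * ?g) - 1) / 2 = of_int 0 + of_int (-1) * ?g" by simp
  then show "upper_left_odd ?X"
    unfolding upper_left_odd_def mat2_nth by (simp only: parity_eq[OF m_pos]) simp
qed

text \<open>\<open>upper_left_odd\<close> is meaningful only on \<open>\<Gamma>2\<close>, so A is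
  first divided by a fixed representative of its class modulo 2. Both parities occur over each
  class, which doubles the count.\<close>

lemma card_rcosets_\<Gamma>2_even:
  "card (rcosets\<^bsub>PSL2 m\<^esub> (proj_coset ` \<Gamma>2_even)) = 2 * sl2_order (sq_one m) (sq_gen m)"
proof -
  define rep where "rep t = (SOME A. A \<in> carrier (SL2 m) \<and> pmat A = t)" for t
  have rep: "rep (pmat A) \<in> carrier (SL2 m)" "pmat (rep (pmat A)) = pmat A"
    if "A \<in> carrier (SL2 m)" for A
    using someI[of "\<lambda>B. B \<in> carrier (SL2 m) \<and> pmat B = pmat A" A] that unfolding rep_def by auto
  define quot where "quot A = A \<otimes>\<^bsub>SL2 m\<^esub> inv\<^bsub>SL2 m\<^esub> rep (pmat A)" for A
  have quot: "quot A \<in> \<Gamma>2" if "A \<in> carrier (SL2 m)" for A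
    using pmat_eq_iff[OF that rep(1)[OF that]] rep[OF that] by (simp add: quot_def)
  define F where "F A = (pmat A, upper_left_odd (quot A))" for A
  have F: "F A = F B \<longleftrightarrow> A \<otimes>\<^bsub>SL2 m\<^esub> inv\<^bsub>SL2 m\<^esub> B \<in> \<Gamma>2_even"
    if AB: "A \<in> carrier (SL2 m)" "B \<in> carrier (SL2 m)" for A B
  proof (cases "pmat A = pmat B")
    case True
    let ?R = "rep (pmat A)"
    have R: "?R \<in> carrier (SL2 m)" by (rule rep[OF AB(1)])
    have "quot A \<otimes>\<^bsub>SL2 m\<^esub> inv\<^bsub>SL2 m\<^esub> quot B = A \<otimes>\<^bsub>SL2 m\<^esub> inv\<^bsub>SL2 m\<^esub> B"
    proof -
      have "inv\<^bsub>SL2 m\<^esub> ?R \<otimes>\<^bsub>SL2 m\<^esub> (?R \<otimes>\<^bsub>SL2 m\<^esub> inv\<^bsub>SL2 m\<^esub> B) = inv\<^bsub>SL2 m\<^esub> B"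
        using AB R by (simp add: SL.m_assoc[symmetric])
      then show ?thesis
        using AB R unfolding quot_def True[symmetric] by (simp add: SL.inv_mult_group SL.m_assoc)
    qed
    then show ?thesis
      using upper_left_odd_quotient[OF quot[OF AB(1)] quot[OF AB(2)]] True by (simp add: F_def)
  next
    case False
    then show ?thesis using pmat_eq_iff[OF AB] by (auto simp: F_def \<Gamma>2_even_def)
  qed
  have "F ` carrier (SL2 m) = pmat ` carrier (SL2 m) \<times> UNIV"
  proof (intro equalityI subsetI)
    fix x assume "x \<in> pmat ` carrier (SL2 m) \<times> (UNIV :: bool set)"
    then obtain A b where A: "A \<in> carrier (SL2 m)" and x: "x = (pmat A, b)" by auto
    obtain X where X: "X \<in> \<Gamma>2" "upper_left_odd X" using upper_left_odd_exists by blast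
    define Y where "Y = (if b then X else mat 1)"
    have Y: "Y \<in> \<Gamma>2" "Y \<in> carrier (SL2 m)" "upper_left_odd Y = b"
      using X upper_left_odd_one mat_1_SL2 by (auto simp: Y_def \<Gamma>2_iff)
    let ?R = "rep (pmat A)"
    have R: "?R \<in> carrier (SL2 m)" by (rule rep[OF A])
    define Z where "Z = Y \<otimes>\<^bsub>SL2 m\<^esub> ?R"
    have Z: "Z \<in> carrier (SL2 m)" using Y R by (simp add: Z_def)
    have "Z \<otimes>\<^bsub>SL2 m\<^esub> inv\<^bsub>SL2 m\<^esub> ?R = Y" using Y R by (simp add: Z_def SL.m_assoc)
    moreover from this have "pmat Z = pmat A" using pmat_eq_iff[OF Z R] Y rep[OF A] by simp
    ultimately have "F Z = x" using Y by (simp add: F_def quot_def x)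
    then show "x \<in> F ` carrier (SL2 m)" using Z by blast
  qed (auto simp: F_def)
  moreover have "card (rcosets\<^bsub>PSL2 m\<^esub> (proj_coset ` \<Gamma>2_even)) = card (F ` carrier (SL2 m))"
    using subgroup_proj[OF subgroup_\<Gamma>2_even uminus_one_\<Gamma>2_even]
      proj_mem[OF subgroup_\<Gamma>2_even uminus_one_\<Gamma>2_even]
    by (intro card_rcosets_image[where \<pi> = proj_coset] group_PSL2 carrier_PSL2) (simp_all add: F)
  ultimately show ?thesis
    by (simp add: card_cartesian_product pmat_image card_pmat_SL2)
qed

lemma \<Gamma>4_subset:
  "{A \<in> carrier (SL2 m). \<forall>i j. A $ i $ j - mat 1 $ i $ j \<in> PIdl\<^bsub>Om m\<^esub> 4} \<subseteq> \<Gamma>2_even"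
proof
  fix A assume "A \<in> {A \<in> carrier (SL2 m). \<forall>i j. A $ i $ j - mat 1 $ i $ j \<in> PIdl\<^bsub>Om m\<^esub> 4}"
  then have A: "A \<in> carrier (SL2 m)" "A $ i $ j - mat 1 $ i $ j \<in> PIdl\<^bsub>Om m\<^esub> 4" for i j by auto
  have half: "x \<in> PIdl\<^bsub>Om m\<^esub> 2" "x / 2 \<in> PIdl\<^bsub>Om m\<^esub> 2" if x: "x \<in> PIdl\<^bsub>Om m\<^esub> 4" for x
  proof -
    obtain b where b: "b \<in> O\<^sub>m" "x = 4 * b" using x by (auto simp: PIdl_Om)
    then have "x = 2 * (2 * b)" "2 * b \<in> O\<^sub>m" by (auto intro: Om_intros)
    then show "x \<in> PIdl\<^bsub>Om m\<^esub> 2" unfolding PIdl_Om by blast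
    show "x / 2 \<in> PIdl\<^bsub>Om m\<^esub> 2" using b by (auto simp: PIdl_Om)
  qed
  have "(A$1$1 - 1) / 2 \<in> PIdl\<^bsub>Om m\<^esub> 2" using half(2)[OF A(2)[of 1 1]] by (simp add: mat_def)
  moreover from this have "(A$1$1 - 1) / 2 \<in> O\<^sub>m" by (auto simp: PIdl_Om intro!: Om_intros)
  ultimately have "parity m ((A$1$1 - 1) / 2) = (False, False)"
    using parity_even_iff[OF m_pos] by blast
  then have "\<not> upper_left_odd A" by (simp add: upper_left_odd_def)
  then show "A \<in> \<Gamma>2_even" using A half(1) by (simp add: \<Gamma>2_even_def \<Gamma>2_def)
qed

end

theorem theorem1p2:
  fixes m :: nat
  assumes "squarefree m" and "m > 0"
  shows "\<exists>\<Delta>. subgroup \<Delta> (PSL2 m)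
    \<and> embeds_in_RACG ((PSL2 m)\<lparr>carrier := \<Delta>\<rparr>)
    \<and> (m mod 4 \<in> {1, 2} \<longrightarrow>
         card (rcosets\<^bsub>PSL2 m\<^esub> \<Delta>) = 48 \<and> \<Delta> = principal_congruence_subgroup m (PIdl\<^bsub>Om m\<^esub> 2))
    \<and> (m mod 8 = 3 \<longrightarrow>
         card (rcosets\<^bsub>PSL2 m\<^esub> \<Delta>) = 120 \<and> congruence_subgroup_of_level m (PIdl\<^bsub>Om m\<^esub> 4) \<Delta>)
    \<and> (m mod 8 = 7 \<longrightarrow>
         card (rcosets\<^bsub>PSL2 m\<^esub> \<Delta>) = 72 \<and> congruence_subgroup_of_level m (PIdl\<^bsub>Om m\<^esub> 4) \<Delta>)"
proof -
  have "m mod 4 \<noteq> 0"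
  proof
    assume "m mod 4 = 0"
    then have "2\<^sup>2 dvd m" by (simp add: mod_eq_0_iff_dvd)
    then have "(2 :: nat) dvd 1" using assms(1) unfolding squarefree_def by blast
    then show False by simp
  qed
  then interpret reduction m using assms(2) by unfold_locales
  obtain u s c where "bianchi_lattice m u s c" using bianchi_lattice_exists[OF assms(2)] by blast
  then interpret bianchi_lattice m u s c .
  have P2: "principal_congruence_subgroup m (PIdl\<^bsub>Om m\<^esub> 2) = proj_coset ` \<Gamma>2"
    by (simp add: principal_congruence_subgroup_def \<Gamma>2_def)
  show ?thesis
  proof (cases "m mod 4 = 3")
    case False
    have s: "subgroup (proj_coset ` \<Gamma>2) (PSL2 m)"
      by (rule subgroup_proj[OF subgroup_\<Gamma>2 uminus_one_\<Gamma>2])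
    have "m mod 8 \<noteq> 3" "m mod 8 \<noteq> 7" using False by presburger+
    then show ?thesis
      using s embeds_in_RACG_level2[OF s] card_rcosets_\<Gamma>2 False
      by (intro exI[of _ "proj_coset ` \<Gamma>2"]) (simp add: P2 sl2_order_def sq_gen_def)
  next
    case True
    have s: "subgroup (proj_coset ` \<Gamma>2_even) (PSL2 m)"
      by (rule subgroup_proj[OF subgroup_\<Gamma>2_even uminus_one_\<Gamma>2_even])
    have "embeds_in_RACG ((PSL2 m)\<lparr>carrier := proj_coset ` \<Gamma>2_even\<rparr>)"
      by (rule embeds_in_RACG_level2[OF s]) (auto simp: P2 \<Gamma>2_even_def)
    moreover have "congruence_subgroup_of_level m (PIdl\<^bsub>Om m\<^esub> 4) (proj_coset ` \<Gamma>2_even)"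
      unfolding congruence_subgroup_of_level_def principal_congruence_subgroup_def
      by (intro conjI s image_mono \<Gamma>4_subset)
    moreover have "sl2_order (sq_one m) (sq_gen m) = (if m mod 8 = 3 then 60 else 36)"
      using True by (simp add: sl2_order_def sq_gen_def sq_one_def)
    ultimately show ?thesis
      using s card_rcosets_\<Gamma>2_even True
      by (intro exI[of _ "proj_coset ` \<Gamma>2_even"]) simp
  qed
qed

end
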